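(* Let $\alpha$, $a_n$, $t_n$, $L_\alpha$ and the $\alpha$-sum-level sets $\mathcal{L}^{(\alpha)}_n$ be as in the context. (1) The series $\sum_{n=1}^{\infty}\lambda(\mathcal{L}^{(\alpha)}_n)$ diverges, and \[\lim_{n\to\infty}\lambda(\mathcal{L}^{(\alpha)}_n)=\begin{cases}0, & \text{if } \alpha \text{ is of infinite type},\\ \left(\sum_{k=1}^\infty t_k\right)^{-1}, & \text{if } \alpha \text{ is of finite type}.\end{cases}\] (2) Suppose $\alpha$ is either expansive of exponent $\theta\in[0,1]$ or of finite type. (i) (Weak renewal law) With $K_\alpha:=(\Gamma(2-\theta)\Gamma(1+\theta))^{-1}$ if $\alpha$ is expansive of exponent $\theta\in[0,1]$, and $K_\alpha:=1$ if $\alpha$ is of finite type, we have \[\sum_{k=1}^{n}\lambda(\mathcal{L}^{(\alpha)}_k)\sim K_\alpha\cdot n\cdot\Big(\sum_{k=1}^{n}t_k\Big)^{-1}.\] (ii) (Strong renewal law) With $k_\alpha:=(\Gamma(2-\theta)\Gamma(\theta))^{-1}$ if $\alpha$ is expansive of exponent $\theta\in(1/2,1]$, and $k_\alpha:=1$ if $\alpha$ is of finite type, we have (in each of these two cases) \[\lambda(\mathcal{L}^{(\alpha)}_n)\sim k_\alpha\cdot\Big(\sum_{k=1}^{n}t_k\Big)^{-1}.\]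
   Context: Let $\mathcal{U}=[0,1]$ and $\lambda$ Lebesgue measure. $\alpha=\{A_n:n\in\mathbb{N}\}$ is a countable partition of $\mathcal U$ (up to the point $0$) into left-open, right-closed intervals of positive length, ordered from right to left starting with $A_1$ (so $A_1$ contains $1$), whose atoms accumulate only at $0$. Write $a_n:=\lambda(A_n)$ and $t_n:=\sum_{k\ge n}a_k$, so $A_n=(t_{n+1},t_n]$ and $t_1=1$. The $\alpha$-Lüroth map $L_\alpha:\mathcal U\to\mathcal U$ is $L_\alpha(x)=(t_n-x)/a_n$ for $x\in A_n$, and $L_\alpha(0)=0$. For $\ell_1,\dots,\ell_k\in\mathbb N$ let $C_\alpha(\ell_1,\dots,\ell_k):=\{x\in\mathcal U: L_\alpha^{i-1}(x)\in A_{\ell_i}\text{ for } i=1,\dots,k\}$. The $\alpha$-sum-level sets are $\mathcal{L}^{(\alpha)}_n:=\{x\in C_\alpha(\ell_1,\dots,\ell_k):\sum_{i=1}^k\ell_i=n \text{ for some } k\in\mathbb N\}$ for $n\in\mathbb N$. $\alpha$ is of finite type if $\sum_{n}t_n<\infty$, otherwise of infinite type. $\alpha$ is expansive of exponent $\theta\ge0$ if $t_n=\psi(n)n^{-\theta}$ for all $n\in\mathbb N$ for some slowly varying function $\psi$ (a measurable $f:\mathbb R^+\to\mathbb R^+$ with $\lim_{x\to\infty}f(xy)/f(x)=1$ for all $y>0$). $a_n\sim b_n$ means $\lim_{n\to\infty}a_n/b_n=1$. *)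

theory Defs
  imports "HOL-Analysis.Analysis" "HOL-Library.Landau_Symbols"
begin

text \<open>A partition alpha is encoded by its sequence of atom lengths a 1, a 2, ...
  (the value a 0 is irrelevant). A partition requires a n > 0 for n >= 1 and
  sum over n >= 1 of a n = 1.\<close>

definition is_partition_seq :: "(nat \<Rightarrow> real) \<Rightarrow> bool" where
  "is_partition_seq a \<longleftrightarrow> (\<forall>n\<ge>1. a n > 0) \<and> (\<lambda>n. a (Suc n)) sums 1"

definition tail :: "(nat \<Rightarrow> real) \<Rightarrow> nat \<Rightarrow> real" where
  "tail a n = (\<Sum>k. a (k + n))"

definition atom :: "(nat \<Rightarrow> real) \<Rightarrow> nat \<Rightarrow> real set" where
  "atom a n = (if n \<ge> 1 then {tail a (Suc n)<..tail a n} else {})"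

definition digit :: "(nat \<Rightarrow> real) \<Rightarrow> real \<Rightarrow> nat" where
  "digit a x = (THE n. n \<ge> 1 \<and> x \<in> atom a n)"

definition luroth :: "(nat \<Rightarrow> real) \<Rightarrow> real \<Rightarrow> real" where
  "luroth a x = (if \<exists>n\<ge>1. x \<in> atom a n
                 then (tail a (digit a x) - x) / a (digit a x) else 0)"

definition cylinder :: "(nat \<Rightarrow> real) \<Rightarrow> nat list \<Rightarrow> real set" where
  "cylinder a ls = {x \<in> {0..1}. \<forall>i<length ls. (luroth a ^^ i) x \<in> atom a (ls ! i)}"

definition sum_level :: "(nat \<Rightarrow> real) \<Rightarrow> nat \<Rightarrow> real set" where
  "sum_level a n = {x. \<exists>ls. ls \<noteq> [] \<and> (\<forall>l\<in>set ls. l \<ge> 1) \<and> sum_list ls = n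
                           \<and> x \<in> cylinder a ls}"

definition finite_type :: "(nat \<Rightarrow> real) \<Rightarrow> bool" where
  "finite_type a \<longleftrightarrow> summable (\<lambda>n. tail a (Suc n))"

definition slowly_varying :: "(real \<Rightarrow> real) \<Rightarrow> bool" where
  "slowly_varying f \<longleftrightarrow> set_borel_measurable borel {0<..} f \<and> (\<forall>x>0. f x > 0) \<and>
     (\<forall>y>0. ((\<lambda>x. f (x * y) / f x) \<longlongrightarrow> 1) at_top)"

definition expansive :: "(nat \<Rightarrow> real) \<Rightarrow> real \<Rightarrow> bool" where
  "expansive a \<theta> \<longleftrightarrow> \<theta> \<ge> 0 \<and>
     (\<exists>\<psi>. slowly_varying \<psi> \<and> (\<forall>n\<ge>1. tail a n = \<psi> (real n) * real n powr (-\<theta>)))"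

end

theory Submission
  imports Defs "HOL-Real_Asymp.Real_Asymp"
begin

text \<open>
  The sum-level measures \<open>u n\<close> form a renewal sequence, \<open>u n = (\<Sum>k=1..n. a k * u (n - k))\<close>,
  because the branch of the map on the \<open>k\<close>-th atom is affine of slope \<open>- 1 / a k\<close>; summing up,
  \<open>(\<Sum>k\<le>n. u k * t (n + 1 - k)) = 1\<close>. The limit of \<open>u\<close> follows as in Erdoes--Feller--Pollard: along
  a subsequence attaining the upper limit all backward shifts have the same limit, as \<open>a 1 > 0\<close>.

  The weak law is Karamata's Tauberian theorem for \<open>U(r) T(r) = r / (1 - r)\<close>, where regular variation
  of \<open>t\<close> is first transferred to the partial sums \<open>T n\<close>. The Gamma factors enter only through the
  Abelian direction, since the Tauberian direction compares \<open>u\<close> with the increments of \<open>k powr \<theta>\<close>.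

  For the strong law, \<open>n * u n\<close> is the coefficient of \<open>z A'(z) / (1 - A(z))\<^sup>2\<close>. On the circle of radius
  \<open>exp (- 1 / n)\<close> the numerator is at most \<open>T n\<close> and \<open>1 - A\<close> is bounded below by
  \<open>(T n / n) * (1 + n * \<bar>x\<bar>) powr (1 - \<beta>)\<close> for some \<open>\<beta> < 1/2\<close>, so that \<open>n * u n\<close> varies little over
  \<open>[n, (1 + \<delta>) n]\<close>, and the weak law determines its local average.
\<close>

section \<open>The renewal equation\<close>

text \<open>\<open>u\<close> need not be monotone, so the weak law cannot simply be differenced;
  this is why the strong law needs its own regularity estimate. It is made for
  \<open>n * u n\<close> because \<open>1 / (1 - A)\<close> is controlled only by
  \<open>(1 + n * \<bar>x\<bar>) powr - (1 - \<beta>)\<close>, whose integral over the circle is not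
  of order \<open>1 / n\<close>, whereas for the square the exponent
  \<open>2 * (1 - \<beta>)\<close> exceeds 1. The exponent \<beta> comes from a Potter bound for
  \<open>T\<close>, valid for \<open>\<beta> > 1 - \<theta>\<close>; together with
  \<open>\<beta> < 1/2\<close> this leaves exactly \<open>\<theta> > 1/2\<close>. The lower bound
  for \<open>1 - A\<close> near the point 1 has two sources. For \<open>\<theta> < 1\<close> the
  mass that \<open>a\<close> puts on \<open>{N..<2*N}\<close>, with \<open>N\<close> about
  \<open>1 / \<bar>x\<bar>\<close>, is comparable with \<open>T N / N\<close>, and these terms of
  the real part suffice. For \<open>\<theta> = 1\<close> that mass is of smaller order, and the
  first-order term \<open>T N * (1 - z)\<close> has to be extracted instead. At
  \<open>\<theta> = 1\<close> the partition may be of finite or of infinite type, so the behaviour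
  of \<open>T\<close> under dilation is proved for both.\<close>

locale partition =
  fixes a :: "nat \<Rightarrow> real"
  assumes a_pos: "n \<ge> 1 \<Longrightarrow> a n > 0"
    and a_sums: "(\<lambda>n. a (Suc n)) sums 1"
begin

abbreviation t :: "nat \<Rightarrow> real" where "t \<equiv> tail a"

lemma a_nonneg: "n \<ge> 1 \<Longrightarrow> a n \<ge> 0"
  using a_pos less_imp_le by blast

lemma summable_a: "summable (\<lambda>k. a (k + n))"
proof -
  have "summable (\<lambda>k. a (k + 1))"
    using a_sums sums_summable by auto
  then have "summable a"
    using summable_iff_shift by blast
  then show ?thesis
    using summable_iff_shift by blast
qed

lemma t_1: "t (Suc 0) = 1"
  using a_sums by (simp add: tail_def sums_iff)

lemma t_Suc: "t n = a n + t (Suc n)"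
  using suminf_split_head[OF summable_a[of n]] by (simp add: tail_def)

lemma t_pos: "n \<ge> 1 \<Longrightarrow> t n > 0"
  unfolding tail_def by (rule suminf_pos[OF summable_a]) (simp add: a_pos)

lemma t_nonneg: "n \<ge> 1 \<Longrightarrow> t n \<ge> 0"
  using t_pos less_imp_le by blast

lemma t_antimono: "1 \<le> m \<Longrightarrow> m \<le> n \<Longrightarrow> t n \<le> t m"
proof -
  assume "1 \<le> m" and "m \<le> n"
  from this(2,1) show ?thesis
  proof (induction n rule: dec_induct)
    case (step n)
    then show ?case using t_Suc[of n] a_nonneg[of n] by simp
  qed auto
qed

lemma t_le_1: "n \<ge> 1 \<Longrightarrow> t n \<le> 1"
  using t_antimono[of 1 n] t_1 by simp

lemma t_lim: "t \<longlonglongrightarrow> 0"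
  unfolding tail_def
  using suminf_exist_split2[of a] summable_a[of 0] by simp

lemma sum_a_eq: "1 \<le> m \<Longrightarrow> m \<le> n \<Longrightarrow> (\<Sum>k=m..<n. a k) = t m - t n"
proof -
  assume "1 \<le> m" and "m \<le> n"
  from this(2,1) show ?thesis
  proof (induction n rule: dec_induct)
    case (step n)
    then show ?case using t_Suc[of n] by simp
  qed auto
qed

definition T :: "nat \<Rightarrow> real" where "T n = (\<Sum>k=1..n. t k)"

lemma T_Suc: "T (Suc n) = T n + t (Suc n)"
  by (simp add: T_def)

lemma T_0: "T 0 = 0"
  by (simp add: T_def)

lemma T_mono: "m \<le> n \<Longrightarrow> T m \<le> T n"
  unfolding T_def using t_nonneg by (intro sum_mono2) auto

lemma T_ge_1: "n \<ge> 1 \<Longrightarrow> T n \<ge> 1"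
  using T_mono[of 1 n] t_1 by (simp add: T_def)

lemma T_pos: "n \<ge> 1 \<Longrightarrow> T n > 0"
  using T_ge_1[of n] by simp

lemma T_nonneg: "T n \<ge> 0"
  using T_mono[of 0 n] by (simp add: T_0)

text \<open>Monotonicity of \<open>t\<close> on one dyadic block. These two inequalities are the
  exchange rate between increments of \<open>T\<close> and single values of \<open>t\<close>, used
  in both directions.\<close>

lemma T_double_diff: "real n * t (2 * n) \<le> T (2 * n) - T n" "T (2 * n) - T n \<le> real n * t (Suc n)"
proof -
  have "T (2 * n) = T n + (\<Sum>k=n+1..2*n. t k)"
    unfolding T_def by (subst sum.union_disjoint[symmetric]) (auto intro!: sum.cong)
  moreover have "(\<Sum>k=n+1..2*n. t (2 * n)) \<le> (\<Sum>k=n+1..2*n. t k)"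
    by (intro sum_mono t_antimono) auto
  moreover have "(\<Sum>k=n+1..2*n. t k) \<le> (\<Sum>k=n+1..2*n. t (Suc n))"
    by (intro sum_mono t_antimono) auto
  ultimately show "real n * t (2 * n) \<le> T (2 * n) - T n" "T (2 * n) - T n \<le> real n * t (Suc n)" by simp_all
qed

lemma T_lim_at_top:
  assumes "\<not> finite_type a"
  shows "filterlim T at_top sequentially"
proof -
  have "\<exists>N. \<forall>n\<ge>N. Z \<le> T n" for Z
  proof (rule ccontr)
    assume "\<not> ?thesis"
    then have *: "\<exists>n\<ge>N. T n < Z" for N by (meson not_le)
    have "(\<Sum>i<n. t (Suc i)) \<le> Z" for n
    proof -
      obtain m where "m \<ge> n" "T m < Z" using * by blast
      moreover have "(\<Sum>i<n. t (Suc i)) = T n"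
        by (induction n) (auto simp: T_0 T_Suc)
      ultimately show ?thesis using T_mono[of n m] by simp
    qed
    then have "summable (\<lambda>i. t (Suc i))"
      by (intro summableI_nonneg_bounded) (auto simp: t_nonneg)
    with assms show False by (simp add: finite_type_def)
  qed
  then show ?thesis by (simp add: filterlim_at_top eventually_sequentially)
qed

lemma T_lim_finite:
  assumes "finite_type a"
  shows "T \<longlonglongrightarrow> (\<Sum>k. t (Suc k))"
proof -
  have "T = (\<lambda>n. \<Sum>i<n. t (Suc i))"
  proof
    fix n show "T n = (\<Sum>i<n. t (Suc i))" by (induction n) (auto simp: T_0 T_Suc)
  qed
  then show ?thesis using assms by (auto simp: finite_type_def intro: summable_LIMSEQ)
qed

end

text \<open>The asymptotic analysis uses only the recursion, so \<open>u\<close> stays abstract: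
  \<open>u n\<close> is the probability that \<open>n\<close> is a renewal time when the waiting
  times have law \<open>a\<close>.\<close>

locale renewal = partition a for a :: "nat \<Rightarrow> real" +
  fixes u :: "nat \<Rightarrow> real"
  assumes u_0: "u 0 = 1"
    and u_rec: "n \<ge> 1 \<Longrightarrow> u n = (\<Sum>k=1..n. a k * u (n - k))"
begin

definition U :: "nat \<Rightarrow> real" where "U n = (\<Sum>k\<le>n. u k)"

lemma u_bounds: "0 < u n \<and> u n \<le> 1"
proof (induction n rule: less_induct)
  case (less n)
  show ?case
  proof (cases "n = 0")
    case True then show ?thesis by (simp add: u_0)
  next
    case False
    then have n: "n \<ge> 1" by simp
    have "(\<Sum>k=1..n. a k * u (n - k)) \<le> (\<Sum>k=1..n. a k * 1)"
      using less a_nonneg by (intro sum_mono mult_left_mono) auto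
    also have "\<dots> = (\<Sum>k=1..<Suc n. a k)"
      by (simp add: atLeastLessThanSuc_atLeastAtMost)
    also have "\<dots> \<le> 1"
      using sum_a_eq[of 1 "Suc n"] n t_1 t_nonneg[of "Suc n"] by simp
    finally have "u n \<le> 1" using u_rec[OF n] by simp
    moreover have "(\<Sum>k=1..n. a k * u (n - k)) > 0"
      using less a_pos n by (intro sum_pos) auto
    ultimately show ?thesis using u_rec[OF n] by simp
  qed
qed

lemma u_pos: "0 < u n" and u_nonneg: "0 \<le> u n" and u_le_1: "u n \<le> 1"
  using u_bounds[of n] by auto

text \<open>Decomposition by the last renewal time \<open>k\<close> up to \<open>n\<close>: the next
  waiting time must exceed \<open>n - k\<close>, which has probability \<open>t (Suc n - k)\<close>.
  In the induction each tail loses one atom, and by the recursion the losses add up to the new term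
  \<open>u (Suc n)\<close>.\<close>

lemma conv_eq_1: "(\<Sum>k\<le>n. u k * t (Suc n - k)) = 1"
proof (induction n)
  case 0 then show ?case by (simp add: u_0 t_1)
next
  case (Suc n)
  have "(\<Sum>k\<le>n. u k * t (Suc (Suc n) - k)) = (\<Sum>k\<le>n. u k * t (Suc n - k) - a (Suc n - k) * u k)"
  proof (rule sum.cong[OF refl])
    fix k assume "k \<in> {..n}"
    then have "Suc (Suc n) - k = Suc (Suc n - k)" by auto
    then show "u k * t (Suc (Suc n) - k) = u k * t (Suc n - k) - a (Suc n - k) * u k"
      using t_Suc[of "Suc n - k"] by (simp add: algebra_simps)
  qed
  also have "\<dots> = 1 - (\<Sum>k\<le>n. a (Suc n - k) * u k)"
    using Suc by (simp add: sum_subtractf)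
  also have "(\<Sum>k\<le>n. a (Suc n - k) * u k) = (\<Sum>k=1..Suc n. a k * u (Suc n - k))"
    by (rule sum.reindex_bij_witness[of _ "\<lambda>k. Suc n - k" "\<lambda>k. Suc n - k"]) auto
  also have "\<dots> = u (Suc n)" by (rule u_rec[symmetric]) simp
  finally show ?case by (simp add: t_1)
qed

lemma conv_eq_1': "(\<Sum>j\<le>n. t (Suc j) * u (n - j)) = 1"
proof -
  have "(\<Sum>j\<le>n. t (Suc j) * u (n - j)) = (\<Sum>k\<le>n. u k * t (Suc n - k))"
    by (rule sum.reindex_bij_witness[of _ "\<lambda>k. n - k" "\<lambda>k. n - k"]) (auto simp: Suc_diff_le)
  then show ?thesis using conv_eq_1 by simp
qed

text \<open>The convolution of a summable sequence with the null sequence \<open>t\<close> would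
  tend to 0, but it is constantly 1.\<close>

lemma not_summable_u: "\<not> summable u"
proof
  assume s: "summable u"
  have "(\<lambda>n. \<Sum>k\<le>n. u k * t (Suc (n - k))) \<longlonglongrightarrow> 0"
  proof (rule LIMSEQ_I)
    fix e :: real assume e: "e > 0"
    obtain M where M: "\<And>n. n \<ge> M \<Longrightarrow> norm (\<Sum>i. u (i + n)) < e/2"
      using suminf_exist_split[OF _ s, of "e/2"] e by auto
    obtain N where N: "\<And>n. n \<ge> N \<Longrightarrow> norm (t n) < e/2 / (M+1)"
      using LIMSEQ_D[OF t_lim, of "e/2 / (M+1)"] e by auto
    show "\<exists>no. \<forall>n\<ge>no. norm ((\<Sum>k\<le>n. u k * t (Suc (n - k))) - 0) < e"
    proof (intro exI[of _ "M+N"] allI impI)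
      fix n assume n: "n \<ge> M + N"
      have "(\<Sum>k\<le>n. u k * t (Suc (n - k))) = (\<Sum>k<M. u k * t (Suc (n - k))) + (\<Sum>k=M..n. u k * t (Suc (n - k)))"
        using n by (subst sum.union_disjoint[symmetric]) (auto intro!: sum.cong)
      moreover have "(\<Sum>k<M. u k * t (Suc (n - k))) \<le> (\<Sum>k<M. 1 * (e/2/(M+1)))"
      proof (intro sum_mono mult_mono)
        fix k assume "k \<in> {..<M}"
        then have "norm (t (Suc (n - k))) < e/2/(M+1)" using n by (intro N) auto
        then show "t (Suc (n - k)) \<le> e/2/(M+1)" by simp
      qed (auto simp: u_le_1 t_nonneg)
      moreover have "(\<Sum>k<M. 1 * (e/2/(M+1))) \<le> e/2" using e by (simp add: field_simps)
      moreover have "(\<Sum>k=M..n. u k * t (Suc (n - k))) \<le> (\<Sum>k=M..n. u k * 1)"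
        by (intro sum_mono mult_left_mono) (auto simp: t_le_1 u_nonneg)
      moreover have "(\<Sum>k=M..n. u k * 1) = (\<Sum>k<Suc n - M. u (k + M))"
        by (simp, rule sum.reindex_bij_witness[of _ "\<lambda>k. k + M" "\<lambda>k. k - M"]) auto
      moreover have "(\<Sum>k<Suc n - M. u (k + M)) \<le> (\<Sum>i. u (i + M))"
        using s by (intro sum_le_suminf) (auto simp: u_nonneg summable_iff_shift)
      moreover have "(\<Sum>i. u (i + M)) < e/2" using M[of M] by auto
      moreover have "(\<Sum>k\<le>n. u k * t (Suc (n - k))) \<ge> 0"
        by (intro sum_nonneg) (auto simp: u_nonneg t_nonneg)
      ultimately have "0 \<le> (\<Sum>k\<le>n. u k * t (Suc (n - k))) \<and> (\<Sum>k\<le>n. u k * t (Suc (n - k))) < e"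
        by linarith
      then show "norm ((\<Sum>k\<le>n. u k * t (Suc (n - k))) - 0) < e" by simp
    qed
  qed
  moreover have "(\<Sum>k\<le>n. u k * t (Suc (n - k))) = 1" for n
    by (subst conv_eq_1[of n, symmetric], rule sum.cong) (auto simp: Suc_diff_le)
  ultimately show False using LIMSEQ_unique[OF _ tendsto_const, of 0] by (auto simp: LIMSEQ_const_iff)
qed

lemma U_mono: "m \<le> n \<Longrightarrow> U m \<le> U n"
  unfolding U_def by (intro sum_mono2) (auto simp: u_nonneg)
lemma U_pos: "U n > 0" using U_mono[of 0 n] by (simp add: U_def u_0)

lemma U_lim_at_top: "filterlim U at_top sequentially"
proof -
  have "\<exists>N. \<forall>n\<ge>N. Z \<le> U n" for Z
  proof (rule ccontr)
    assume "\<not> ?thesis"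
    then have *: "\<exists>n\<ge>N. U n < Z" for N by (meson not_le)
    have "(\<Sum>i<n. u i) \<le> Z" for n
    proof -
      obtain m where "m \<ge> n" "U m < Z" using * by blast
      moreover have "(\<Sum>i<n. u i) \<le> U m" unfolding U_def
        using \<open>m \<ge> n\<close> by (intro sum_mono2) (auto simp: u_nonneg)
      ultimately show ?thesis by simp
    qed
    then have "summable u"
      by (intro summableI_nonneg_bounded) (auto simp: u_nonneg)
    with not_summable_u show False by simp
  qed
  then show ?thesis by (simp add: filterlim_at_top eventually_sequentially)
qed

end

section \<open>Lebesgue measure of the sum-level sets\<close>

context partition
begin

lemma atom_subset: "atom a k \<subseteq> {0<..1}"
  using t_pos[of "Suc k"] t_antimono[of 1 k] t_1 by (auto simp: atom_def)

lemma atom_disjoint: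
  assumes "x \<in> atom a m" "x \<in> atom a n"
  shows "m = n"
proof -
  have "\<not> m < n" if "x \<in> atom a m" "x \<in> atom a n" for m n
  proof
    assume "m < n"
    then have "tail a n \<le> tail a (Suc m)" by (intro t_antimono) auto
    then show False using that by (auto simp: atom_def split: if_splits)
  qed
  then show ?thesis using assms by (meson linorder_neqE_nat)
qed

lemma atom_index: "x \<in> atom a k \<Longrightarrow> k \<ge> 1"
  by (auto simp: atom_def split: if_splits)

lemma luroth_on_atom:
  assumes "x \<in> atom a k"
  shows "luroth a x = (tail a k - x) / a k"
proof -
  have "digit a x = k" unfolding digit_def
    using assms atom_index atom_disjoint by (intro the_equality) auto
  then show ?thesis using assms atom_index by (auto simp: luroth_def)
qed

lemma luroth_in_unit: "luroth a x \<in> {0..1}"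
proof (cases "\<exists>k. x \<in> atom a k")
  case True
  then obtain k where k: "x \<in> atom a k" by blast
  have "a k > 0" using atom_index[OF k] a_pos by blast
  moreover have "luroth a x = (t k - x) / a k" by (rule luroth_on_atom[OF k])
  ultimately show ?thesis using k t_Suc[of k] atom_index[OF k]
    by (auto simp: atom_def)
next
  case False then show ?thesis by (auto simp: luroth_def)
qed

lemma cylinder_Cons:
  "x \<in> cylinder a (l # ls) \<longleftrightarrow> x \<in> atom a l \<and> luroth a x \<in> cylinder a ls"
proof -
  have "(\<forall>i<length (l # ls). (luroth a ^^ i) x \<in> atom a ((l # ls) ! i)) \<longleftrightarrow>
    x \<in> atom a l \<and> (\<forall>i<length ls. (luroth a ^^ i) (luroth a x) \<in> atom a (ls ! i))"
    by (simp add: All_less_Suc2 funpow_swap1)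
  moreover have "x \<in> atom a l \<Longrightarrow> x \<in> {0..1}" using atom_subset[of l] by auto
  ultimately show ?thesis using luroth_in_unit[of x] by (auto simp: cylinder_def)
qed

lemma cylinder_Nil: "cylinder a [] = {0..1}"
  by (auto simp: cylinder_def)

text \<open>The sum-level set of index 0 is empty, whereas the renewal recursion needs the whole
  interval there.\<close>

definition level :: "nat \<Rightarrow> real set" where
  "level n = (if n = 0 then {0..1} else sum_level a n)"

text \<open>Admitting the empty word absorbs the case \<open>n = 0\<close>, since its cylinder is
  the whole interval and no other word with positive digits has sum 0.\<close>

lemma level_eq:
  "level n = {x. \<exists>ls. (\<forall>l\<in>set ls. l \<ge> 1) \<and> sum_list ls = n \<and> x \<in> cylinder a ls}"
proof (cases "n = 0")
  case True
  have Nil: "((\<forall>l\<in>set ls. l \<ge> 1) \<and> sum_list ls = 0) = (ls = [])" for ls :: "nat list"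
    by (cases ls) auto
  have "{x. \<exists>ls. (\<forall>l\<in>set ls. l \<ge> 1) \<and> sum_list ls = 0 \<and> x \<in> cylinder a ls} = cylinder a []"
    by (simp only: conj_assoc[symmetric] Nil) simp
  then show ?thesis using True by (simp add: level_def cylinder_Nil)
next
  case False
  then have "ls \<noteq> []" if "sum_list ls = n" for ls :: "nat list" using that by auto
  with False show ?thesis unfolding level_def sum_level_def if_not_P[OF False] by blast
qed

text \<open>Sort the points by their first digit \<open>k\<close>; the map deletes this digit and
  leaves a word of sum \<open>n - k\<close>, possibly the empty one.\<close>

lemma level_rec:
  assumes "n \<ge> 1"
  shows "level n = (\<Union>k\<in>{1..n}. {x \<in> atom a k. luroth a x \<in> level (n - k)})"
proof (intro equalityI subsetI)
  fix x assume "x \<in> level n"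
  then obtain ls where ls: "\<forall>l\<in>set ls. l \<ge> 1" "sum_list ls = n" "x \<in> cylinder a ls"
    by (auto simp: level_eq)
  then obtain l ls' where eq: "ls = l # ls'" using assms by (cases ls) auto
  have "luroth a x \<in> level (n - l)" "x \<in> atom a l" "l \<in> {1..n}"
    using ls by (auto simp: eq level_eq cylinder_Cons intro!: exI[of _ ls'])
  then show "x \<in> (\<Union>k\<in>{1..n}. {x \<in> atom a k. luroth a x \<in> level (n - k)})" by blast
next
  fix x assume "x \<in> (\<Union>k\<in>{1..n}. {x \<in> atom a k. luroth a x \<in> level (n - k)})"
  then obtain k ls where "k \<in> {1..n}" "x \<in> atom a k"
    "\<forall>l\<in>set ls. l \<ge> 1" "sum_list ls = n - k" "luroth a x \<in> cylinder a ls"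
    by (auto simp: level_eq)
  then show "x \<in> level n" unfolding level_eq
    by (intro CollectI exI[of _ "k # ls"]) (auto simp: cylinder_Cons)
qed

lemma level_subset: "level n \<subseteq> {0..1}"
  by (auto simp: level_eq cylinder_def)

text \<open>The branch reverses orientation, so the left-open, right-closed atom is the affine image
  of \<open>{0..<1}\<close>, and the point 1 of \<open>S\<close> is not reached.\<close>

lemma branch_eq:
  assumes "k \<ge> 1"
  shows "{x \<in> atom a k. luroth a x \<in> S} = (\<lambda>y. (- a k) *\<^sub>R y + tail a k) ` (S \<inter> {0..<1})"
    (is "?L = ?R")
proof (intro equalityI subsetI)
  have ak: "a k > 0" using assms a_pos by blast
  {
    fix x assume x: "x \<in> ?L"
    then have "luroth a x = (tail a k - x) / a k" by (simp add: luroth_on_atom)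
    moreover from this have "x = (- a k) *\<^sub>R luroth a x + tail a k" using ak by simp
    moreover have "(t k - x) / a k \<in> {0..<1}"
      using x ak assms t_Suc[of k] by (auto simp: atom_def)
    then have "luroth a x \<in> S \<inter> {0..<1}" using x calculation(1) by simp
    ultimately show "x \<in> ?R" by blast
  next
    fix x assume "x \<in> ?R"
    then obtain y where y: "y \<in> S" "0 \<le> y" "y < 1" "x = tail a k - a k * y" by auto
    then have "x \<in> atom a k" using ak assms t_Suc[of k] by (auto simp: atom_def)
    moreover from this have "luroth a x = y" using ak y by (simp add: luroth_on_atom)
    ultimately show "x \<in> ?L" using y by simp
  }
qed

lemma branch_measure:
  assumes k: "k \<ge> 1" and S: "S \<in> sets borel" "S \<subseteq> {0..1}"
  shows "{x \<in> atom a k. luroth a x \<in> S} \<in> sets borel"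
    and "measure lborel {x \<in> atom a k. luroth a x \<in> S} = a k * measure lborel S"
proof -
  have ak: "a k > 0" using k a_pos by blast
  have "{x \<in> atom a k. luroth a x \<in> S} = atom a k \<inter> (\<lambda>x. (tail a k - x) / a k) -` S"
    by (auto simp: luroth_on_atom)
  moreover have "(\<lambda>x. (tail a k - x) / a k) -` S \<in> sets borel"
    using S(1) measurable_sets[of "\<lambda>x. (tail a k - x) / a k" borel borel S] by simp
  moreover have "atom a k \<in> sets borel" by (simp add: atom_def)
  ultimately show meas: "{x \<in> atom a k. luroth a x \<in> S} \<in> sets borel" by simp
  \<comment> \<open>The point 1 missing from the image in \<open>branch_eq\<close> is a null
    set.\<close>
  have null: "{1} \<inter> S \<in> null_sets lborel"
    using countable_imp_null_set_lborel[of "{1} \<inter> S"] by (simp add: countable_finite)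
  have "measure lborel (S \<inter> {0..<1}) = measure lborel (S - ({1} \<inter> S))"
    using S(2) by (intro arg_cong[of _ _ "measure lborel"]) force
  also have "\<dots> = measure lborel S"
    using S(1) null by (intro measure_Diff_null_set) auto
  finally have 1: "measure lborel (S \<inter> {0..<1}) = measure lborel S" .
  have "measure lborel {x \<in> atom a k. luroth a x \<in> S} = measure lebesgue {x \<in> atom a k. luroth a x \<in> S}"
    using meas by simp
  also have "\<dots> = \<bar>- a k\<bar> ^ DIM(real) * measure lebesgue (S \<inter> {0..<1})"
    unfolding branch_eq[OF k] using measure_lebesgue_affine[of "- a k" "tail a k" "S \<inter> {0..<1}"]
    by (simp add: add.commute)
  also have "\<dots> = a k * measure lborel (S \<inter> {0..<1})" using S(1) ak by simp
  finally show "measure lborel {x \<in> atom a k. luroth a x \<in> S} = a k * measure lborel S"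
    using 1 by simp
qed

lemma level_borel: "level n \<in> sets borel"
proof (induction n rule: less_induct)
  case (less n)
  show ?case
  proof (cases "n = 0")
    case True then show ?thesis by (simp add: level_def)
  next
    case False
    then show ?thesis using less level_subset
      by (subst level_rec) (auto intro!: sets.finite_UN branch_measure(1))
  qed
qed

lemma measure_level_rec:
  assumes "n \<ge> 1"
  shows "measure lborel (level n) = (\<Sum>k=1..n. a k * measure lborel (level (n - k)))"
proof -
  let ?B = "\<lambda>k. {x \<in> atom a k. luroth a x \<in> level (n - k)}"
  have sub: "?B k \<subseteq> {0..1}" for k using atom_subset[of k] by auto
  have "measure lborel (level n) = measure lborel (\<Union>k\<in>{1..n}. ?B k)"
    using level_rec[OF assms] by simp
  also have "\<dots> = (\<Sum>k=1..n. measure lborel (?B k))"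
  proof (rule measure_finite_Union)
    show "disjoint_family_on ?B {1..n}"
      using atom_disjoint by (auto simp: disjoint_family_on_def)
    show "?B ` {1..n} \<subseteq> sets lborel"
      using branch_measure(1)[OF _ level_borel level_subset] by auto
    fix k
    have "emeasure lborel (?B k) \<le> emeasure lborel {0..1::real}"
      by (rule emeasure_mono[OF sub]) simp
    then show "emeasure lborel (?B k) \<noteq> \<infinity>"
      by (auto simp: top_unique)
  qed simp
  also have "\<dots> = (\<Sum>k=1..n. a k * measure lborel (level (n - k)))"
    by (intro sum.cong refl branch_measure(2) level_borel level_subset) auto
  finally show ?thesis .
qed

lemma renewal_level: "renewal a (\<lambda>n. measure lborel (level n))"
  by unfold_locales
     (auto simp: measure_level_rec level_def[of 0])

end

section \<open>Limits of renewal sequences\<close>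

context renewal begin

lemma abs_u_le_1: "\<bar>u n\<bar> \<le> 1"
  using u_nonneg[of n] u_le_1[of n] by simp

text \<open>Since \<^term>\<open>a 1 > 0\<close>, a recursion value close to the upper limit forces its predecessor
  to be close to it as well.\<close>

lemma limsup_step:
  fixes v :: "nat \<Rightarrow> real" and \<psi> :: "nat \<Rightarrow> nat"
  assumes rec: "\<And>n. n \<ge> 1 \<Longrightarrow> v n = (\<Sum>k=1..n. a k * v (n - k))"
    and bd: "\<And>n. \<bar>v n\<bar> \<le> 1"
    and up: "\<And>e. e > 0 \<Longrightarrow> \<exists>M. \<forall>m\<ge>M. v m \<le> L + e"
    and psi: "filterlim \<psi> at_top sequentially" and lim: "(\<lambda>n. v (\<psi> n)) \<longlonglongrightarrow> L"
  shows "(\<lambda>n. v (\<psi> n - 1)) \<longlonglongrightarrow> L"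
proof (rule LIMSEQ_I)
  fix e :: real assume e: "e > 0"
  \<comment> \<open>The errors collected below stay under \<open>4 * d\<close>, and solving for
    \<open>v (m - 1)\<close> divides them by \<open>a 1\<close>.\<close>
  define d where "d = e * a 1 / 4"
  have a1: "a 1 > 0" "a 1 \<le> 1" using a_pos[of 1] t_Suc[of 1] t_1 t_nonneg[of 2]
    by (auto simp: numeral_2_eq_2)
  have d: "d > 0" "d \<le> e/4" using e a1 by (auto simp: d_def mult_left_le)
  obtain M where M: "\<And>m. m \<ge> M \<Longrightarrow> v m \<le> L + d" using up[of d] d by blast
  have L: "L \<le> 1" using lim bd by (meson LIMSEQ_le_const2 abs_le_D1)
  have L': "-1 \<le> L" using lim bd by (intro LIMSEQ_le_const[OF lim]) (auto simp: abs_le_iff minus_le_iff)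
  obtain N where N: "\<And>n. n \<ge> N \<Longrightarrow> norm (t n) < d / 2" using LIMSEQ_D[OF t_lim, of "d/2"] d by auto
  obtain K where K: "\<And>n. n \<ge> K \<Longrightarrow> norm (v (\<psi> n) - L) < d" using LIMSEQ_D[OF lim] d by auto
  obtain K' where K': "\<And>n. n \<ge> K' \<Longrightarrow> \<psi> n \<ge> M + N + 2"
    using psi by (auto simp: filterlim_at_top eventually_sequentially)
  show "\<exists>no. \<forall>n\<ge>no. norm (v (\<psi> n - 1) - L) < e"
  proof (intro exI[of _ "K + K'"] allI impI)
    fix n assume n: "n \<ge> K + K'"
    define m where "m = \<psi> n"
    have m: "m \<ge> M + N + 2" using K' n by (simp add: m_def)
    have "v m = (\<Sum>k=1..m. a k * v (m - k))" using rec m by simp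
    \<comment> \<open>Three ranges: the term of interest \<open>k = 1\<close>; the middle, where
      \<open>m - k\<close> exceeds \<open>M\<close> and so \<open>v\<close> is at most
      \<open>L + d\<close>; and the end, where only \<open>\<bar>v\<bar> <= 1\<close> is known but
      the total weight is at most \<open>t (m - M)\<close>.\<close>
    also have "{1..m} = {1} \<union> ({2..<m - M} \<union> {m - M..<Suc m})" using m by auto
    also have "(\<Sum>k\<in>{1} \<union> ({2..<m - M} \<union> {m - M..<Suc m}). a k * v (m - k))
       = a 1 * v (m - 1) + ((\<Sum>k=2..<m - M. a k * v (m - k)) + (\<Sum>k=m - M..<Suc m. a k * v (m - k)))"
      using m by (subst sum.union_disjoint; (subst sum.union_disjoint)?; auto)
    finally have eq: "v m = \<dots>" .
    have "(\<Sum>k=2..<m - M. a k * v (m - k)) \<le> (\<Sum>k=2..<m - M. a k * (L + d))"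
      using M by (intro sum_mono mult_left_mono) (auto simp: a_nonneg)
    also have "\<dots> = (t 2 - t (m - M)) * (L + d)"
      using sum_a_eq[of 2 "m - M"] m by (simp add: sum_distrib_right[symmetric])
    finally have 1: "(\<Sum>k=2..<m - M. a k * v (m - k)) \<le> (t 2 - t (m - M)) * (L + d)" .
    have "(\<Sum>k=m - M..<Suc m. a k * v (m - k)) \<le> (\<Sum>k=m - M..<Suc m. a k * 1)"
      using bd m by (intro sum_mono mult_left_mono) (auto simp: a_nonneg abs_le_iff)
    also have "\<dots> = t (m - M) - t (Suc m)" using sum_a_eq[of "m - M" "Suc m"] m by simp
    also have "\<dots> \<le> t (m - M)" using t_nonneg[of "Suc m"] by simp
    finally have 2: "(\<Sum>k=m - M..<Suc m. a k * v (m - k)) \<le> t (m - M)" .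
    have 3: "norm (t (m - M)) < d / 2" using N m by simp
    have 4: "norm (v m - L) < d" using K n by (simp add: m_def)
    have t2: "t 2 = 1 - a 1" using t_Suc[of 1] t_1 by (simp add: numeral_2_eq_2)
    have 5: "- (t (m - M) * L) \<le> t (m - M) * 1" "0 \<le> t (m - M) * d"
      using mult_left_mono[OF L', of "t (m - M)"] t_nonneg[of "m - M"] m d by simp_all
    have "a 1 * L - a 1 * v (m - 1) \<le> (L - v m) + d + 2 * t (m - M)"
    proof -
      have "v m \<le> a 1 * v (m - 1) + ((1 - a 1 - t (m - M)) * (L + d) + t (m - M))"
        using eq 1 2 unfolding t2 by linarith
      moreover have "0 \<le> a 1 * d" using a1 d by simp
      ultimately show ?thesis using 5 by (simp add: algebra_simps)
    qed
    moreover have "L - v m < d" "t (m - M) < d / 2" using 3 4 by (simp_all add: abs_less_iff)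
    ultimately have "a 1 * (L - v (m - 1)) < 4 * d" using d unfolding right_diff_distrib by linarith
    then have "L - v (m - 1) < e" using a1 by (simp add: d_def mult.commute)
    moreover have "v (m - 1) \<le> L + d" using M m by simp
    ultimately show "norm (v (\<psi> n - 1) - L) < e" using d e by (simp add: m_def abs_if)
  qed
qed

text \<open>The shifted indices again tend to infinity, so \<open>limsup_step\<close> can be
  iterated.\<close>

lemma limsup_shift:
  fixes v :: "nat \<Rightarrow> real" and \<psi> :: "nat \<Rightarrow> nat"
  assumes rec: "\<And>n. n \<ge> 1 \<Longrightarrow> v n = (\<Sum>k=1..n. a k * v (n - k))"
    and bd: "\<And>n. \<bar>v n\<bar> \<le> 1"
    and up: "\<And>e. e > 0 \<Longrightarrow> \<exists>M. \<forall>m\<ge>M. v m \<le> L + e"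
    and psi: "filterlim \<psi> at_top sequentially" and lim: "(\<lambda>n. v (\<psi> n)) \<longlonglongrightarrow> L"
  shows "(\<lambda>n. v (\<psi> n - j)) \<longlonglongrightarrow> L"
proof (induction j)
  case 0 then show ?case using lim by simp
next
  case (Suc j)
  have "filterlim (\<lambda>n. \<psi> n - j) at_top sequentially"
  proof -
    have "\<forall>\<^sub>F n in sequentially. \<psi> n - j \<ge> Z" for Z
      using filterlim_at_top[THEN iffD1, OF psi, rule_format, of "Z + j"]
      by eventually_elim auto
    then show ?thesis by (simp add: filterlim_at_top)
  qed
  from limsup_step[OF rec bd up this Suc] show ?case by simp
qed

lemma ex_limsup_seq:
  fixes v :: "nat \<Rightarrow> real"
  assumes bd: "\<And>n. \<bar>v n\<bar> \<le> 1"
  obtains L \<psi> where "\<bar>L\<bar> \<le> 1" "\<And>e. e > 0 \<Longrightarrow> \<exists>M. \<forall>m\<ge>M. v m \<le> L + e"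
    "filterlim \<psi> at_top sequentially" "(\<lambda>n. v (\<psi> n)) \<longlonglongrightarrow> L"
proof -
  let ?w = "\<lambda>n. ereal (v n)"
  obtain \<psi> where psi: "strict_mono \<psi>" "(?w \<circ> \<psi>) \<longlonglongrightarrow> limsup ?w"
    using limsup_subseq_lim[of ?w] by blast
  have "limsup ?w \<le> 1" using bd
    by (intro Limsup_bounded always_eventually) (auto simp: abs_le_iff one_ereal_def)
  moreover have "limsup ?w \<ge> ereal (-1)"
    using bd by (intro le_Limsup always_eventually) (auto simp: abs_le_iff one_ereal_def minus_le_iff)
  ultimately obtain L where L: "limsup ?w = ereal L" "\<bar>L\<bar> \<le> 1"
    by (cases "limsup ?w") (auto simp: abs_le_iff)
  have "\<exists>M. \<forall>m\<ge>M. v m \<le> L + e" if "e > 0" for e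
  proof -
    have "limsup ?w < ereal (L + e)" using that L by simp
    then have "\<forall>\<^sub>F n in sequentially. ?w n < ereal (L + e)" by (rule Limsup_lessD)
    then show ?thesis by (auto simp: eventually_sequentially intro: less_imp_le)
  qed
  moreover have "(\<lambda>n. v (\<psi> n)) \<longlonglongrightarrow> L" using psi(2) L by (simp add: o_def)
  ultimately show ?thesis using that L psi(1) filterlim_subseq by blast
qed

text \<open>Pass to the limit along \<open>\<psi>\<close> in \<open>conv_eq_1'\<close>. Each of the
  first \<open>J\<close> terms has a limit by \<open>limsup_shift\<close>, together
  \<open>L * T J\<close>. The remaining terms are nonnegative after multiplication by
  \<open>c\<close>, and in the finite case they are bounded by the tail of the series of
  \<open>t\<close>. The sign \<open>c\<close> treats upper and lower limits of \<open>u\<close> at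
  once.\<close>

lemma limsup_times_T:
  fixes v :: "nat \<Rightarrow> real" and \<psi> :: "nat \<Rightarrow> nat"
  assumes v: "\<And>n. v n = c * u n" and c: "\<bar>c\<bar> = 1"
    and up: "\<And>e. e > 0 \<Longrightarrow> \<exists>M. \<forall>m\<ge>M. v m \<le> L + e"
    and psi: "filterlim \<psi> at_top sequentially" and lim: "(\<lambda>n. v (\<psi> n)) \<longlonglongrightarrow> L"
  shows "c * L * T J \<le> 1" and "finite_type a \<Longrightarrow> L * (\<Sum>k. t (Suc k)) = c"
proof -
  have rec: "v n = (\<Sum>k=1..n. a k * v (n - k))" if "n \<ge> 1" for n
    using u_rec[OF that] by (simp add: v sum_distrib_left mult.left_commute)
  have bd: "\<bar>v n\<bar> \<le> 1" for n using c u_nonneg[of n] u_le_1[of n] by (simp add: v abs_mult)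
  note sh = limsup_shift[OF rec bd up psi lim]
  have cc: "c * c = 1" using c by (metis abs_mult_self_eq mult_1)
  have TJ: "T J = (\<Sum>j<J. t (Suc j))" for J by (induction J) (auto simp: T_0 T_Suc)
  have limJ: "(\<lambda>n. \<Sum>j<J. t (Suc j) * v (\<psi> n - j)) \<longlonglongrightarrow> L * T J" for J
  proof -
    have "(\<lambda>n. \<Sum>j<J. t (Suc j) * v (\<psi> n - j)) \<longlonglongrightarrow> (\<Sum>j<J. t (Suc j) * L)"
      by (intro tendsto_intros sh)
    then show ?thesis by (simp add: TJ sum_distrib_left mult.commute)
  qed
  have ev: "\<forall>\<^sub>F n in sequentially. \<psi> n \<ge> J" for J
    using psi by (auto simp: filterlim_at_top)
  have split: "c = (\<Sum>j<J. t (Suc j) * v (m - j)) + (\<Sum>j=J..m. t (Suc j) * v (m - j))" if "m \<ge> J" for m J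
  proof -
    have "c = c * (\<Sum>j\<le>m. t (Suc j) * u (m - j))" using conv_eq_1'[of m] by simp
    also have "\<dots> = (\<Sum>j\<in>{..<J} \<union> {J..m}. t (Suc j) * v (m - j))"
      using that by (auto simp: v sum_distrib_left mult.left_commute intro!: sum.cong)
    finally show ?thesis by (subst (asm) sum.union_disjoint) auto
  qed
  show "c * L * T J \<le> 1" for J
  proof -
    have "(\<lambda>n. c * (\<Sum>j<J. t (Suc j) * v (\<psi> n - j))) \<longlonglongrightarrow> c * (L * T J)"
      by (intro tendsto_intros limJ)
    moreover have "\<forall>\<^sub>F n in sequentially. c * (\<Sum>j<J. t (Suc j) * v (\<psi> n - j)) \<le> 1"
      using ev[of J]
    proof eventually_elim
      case (elim n)
      have "c * (\<Sum>j=J..\<psi> n. t (Suc j) * v (\<psi> n - j)) = (\<Sum>j=J..\<psi> n. (c * c) * (t (Suc j) * u (\<psi> n - j)))"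
        by (simp add: v sum_distrib_left mult_ac)
      also have "\<dots> \<ge> 0" unfolding cc by (intro sum_nonneg) (auto simp: t_nonneg u_nonneg)
      finally show ?case using arg_cong[OF split[OF elim], of "\<lambda>x. c * x"] cc by (simp add: algebra_simps)
    qed
    ultimately show ?thesis by (simp add: tendsto_upperbound mult.assoc)
  qed
  show "L * (\<Sum>k. t (Suc k)) = c" if fin: "finite_type a"
  proof -
    let ?S = "\<Sum>k. t (Suc k)"
    have sm: "summable (\<lambda>k. t (Suc k))" using fin by (simp add: finite_type_def)
    have "\<bar>c - L * T J\<bar> \<le> ?S - T J" for J
    proof -
      have "(\<lambda>n. \<bar>c - (\<Sum>j<J. t (Suc j) * v (\<psi> n - j))\<bar>) \<longlonglongrightarrow> \<bar>c - L * T J\<bar>"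
        by (intro tendsto_intros limJ)
      moreover have "\<forall>\<^sub>F n in sequentially. \<bar>c - (\<Sum>j<J. t (Suc j) * v (\<psi> n - j))\<bar> \<le> ?S - T J"
        using ev[of J]
      proof eventually_elim
        case (elim n)
        have "\<bar>c - (\<Sum>j<J. t (Suc j) * v (\<psi> n - j))\<bar> = \<bar>\<Sum>j=J..\<psi> n. t (Suc j) * v (\<psi> n - j)\<bar>"
          using split[OF elim] by simp
        also have "\<dots> \<le> (\<Sum>j=J..\<psi> n. t (Suc j) * 1)"
          by (rule order.trans[OF sum_abs])
             (intro sum_mono, use bd t_nonneg in \<open>auto simp: abs_mult mult_left_le\<close>)
        also have "\<dots> = (\<Sum>j<Suc (\<psi> n). t (Suc j)) - T J"
        proof -
          have "(\<Sum>j<Suc (\<psi> n). t (Suc j)) = (\<Sum>j\<in>{..<J} \<union> {J..\<psi> n}. t (Suc j))"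
            using elim by (intro sum.cong) auto
          also have "\<dots> = T J + (\<Sum>j=J..\<psi> n. t (Suc j))"
            unfolding TJ by (rule sum.union_disjoint) auto
          finally show ?thesis by simp
        qed
        also have "(\<Sum>j<Suc (\<psi> n). t (Suc j)) \<le> ?S"
          using sm by (intro sum_le_suminf) (auto simp: t_nonneg)
        finally show ?case by simp
      qed
      ultimately show ?thesis by (rule tendsto_upperbound) simp
    qed
    moreover have "(\<lambda>J. \<bar>c - L * T J\<bar>) \<longlonglongrightarrow> \<bar>c - L * ?S\<bar>" "(\<lambda>J. ?S - T J) \<longlonglongrightarrow> ?S - ?S"
      by (intro tendsto_intros T_lim_finite[OF fin])+
    ultimately have "\<bar>c - L * ?S\<bar> \<le> ?S - ?S" by (intro LIMSEQ_le[of "\<lambda>J. \<bar>c - L * T J\<bar>"]) auto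
    then show ?thesis by simp
  qed
qed

text \<open>Since \<open>T\<close> is unbounded, \<open>L * T J <= 1\<close> for all
  \<open>J\<close> leaves no positive upper limit.\<close>

theorem u_lim_infinite:
  assumes "\<not> finite_type a"
  shows "u \<longlonglongrightarrow> 0"
proof -
  obtain L \<psi> where L: "\<bar>L\<bar> \<le> 1" "\<And>e. e > 0 \<Longrightarrow> \<exists>M. \<forall>m\<ge>M. u m \<le> L + e"
    "filterlim \<psi> at_top sequentially" "(\<lambda>n. u (\<psi> n)) \<longlonglongrightarrow> L"
    by (rule ex_limsup_seq[of u]) (use abs_u_le_1 in auto)
  have le: "L * T J \<le> 1" for J
    using limsup_times_T(1)[of u 1 L \<psi> J] L by simp
  have "L \<le> 0"
  proof (rule ccontr)
    assume "\<not> L \<le> 0"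
    then have "L > 0" by simp
    moreover obtain J where "T J > 1 / L"
      using T_lim_at_top[OF assms] by (auto simp: filterlim_at_top_dense eventually_sequentially)
    ultimately show False using le[of J] by (simp add: field_simps)
  qed
  show ?thesis
  proof (rule LIMSEQ_I)
    fix e :: real assume "e > 0"
    then obtain M where "\<And>m. m \<ge> M \<Longrightarrow> u m \<le> L + e/2" using L(2)[of "e/2"] by auto
    then show "\<exists>no. \<forall>n\<ge>no. norm (u n - 0) < e"
      using \<open>L \<le> 0\<close> \<open>e > 0\<close> u_nonneg by (intro exI[of _ M]) (smt (verit) real_norm_def field_sum_of_halves)
  qed
qed

text \<open>Applied to \<open>u\<close> and to \<open>- u\<close>, the exact value in
  \<open>limsup_times_T\<close> makes the upper and the lower limit coincide.\<close>

theorem u_lim_finite: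
  assumes fin: "finite_type a"
  shows "u \<longlonglongrightarrow> 1 / (\<Sum>k. t (Suc k))"
proof -
  let ?S = "\<Sum>k. t (Suc k)"
  have S: "?S > 0" using fin by (intro suminf_pos) (auto simp: finite_type_def t_pos)
  obtain L \<psi> where L: "\<bar>L\<bar> \<le> 1" "\<And>e. e > 0 \<Longrightarrow> \<exists>M. \<forall>m\<ge>M. u m \<le> L + e"
    "filterlim \<psi> at_top sequentially" "(\<lambda>n. u (\<psi> n)) \<longlonglongrightarrow> L"
    by (rule ex_limsup_seq[of u]) (use abs_u_le_1 in auto)
  obtain L' \<psi>' where L': "\<bar>L'\<bar> \<le> 1" "\<And>e. e > 0 \<Longrightarrow> \<exists>M. \<forall>m\<ge>M. - u m \<le> L' + e"
    "filterlim \<psi>' at_top sequentially" "(\<lambda>n. - u (\<psi>' n)) \<longlonglongrightarrow> L'"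
    by (rule ex_limsup_seq[of "\<lambda>n. - u n"]) (use abs_u_le_1 in auto)
  have "L = 1 / ?S" using limsup_times_T(2)[of u 1 L \<psi>] L fin S by (simp add: field_simps)
  moreover have "L' = - 1 / ?S"
    using limsup_times_T(2)[of "\<lambda>n. - u n" "-1" L' \<psi>'] L' fin S by (simp add: field_simps)
  ultimately have LL: "L' = - L" by simp
  have "u \<longlonglongrightarrow> L"
  proof (rule LIMSEQ_I)
    fix e :: real assume "e > 0"
    then obtain M M' where "\<And>m. m \<ge> M \<Longrightarrow> u m \<le> L + e/2" "\<And>m. m \<ge> M' \<Longrightarrow> - u m \<le> L' + e/2"
      using L(2)[of "e/2"] L'(2)[of "e/2"] by auto
    then show "\<exists>no. \<forall>n\<ge>no. norm (u n - L) < e"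
      using LL \<open>e > 0\<close> by (intro exI[of _ "M + M'"]) (smt (verit) real_norm_def field_sum_of_halves le_add1 le_add2 order.trans)
  qed
  then show ?thesis using \<open>L = 1 / ?S\<close> by simp
qed

end

section \<open>Karamata's theorem\<close>

text \<open>The Stolz-Cesaro theorem in summed form: because the weights \<open>b\<close> have a
  divergent sum, the finitely many terms whose ratio is not yet close to \<open>l\<close> are
  negligible.\<close>

lemma weighted_cesaro:
  fixes b x :: "nat \<Rightarrow> real"
  assumes b: "\<And>k. k \<ge> 1 \<Longrightarrow> b k > 0"
    and B: "filterlim (\<lambda>n. \<Sum>k=1..n. b k) at_top sequentially"
    and lim: "(\<lambda>k. x k / b k) \<longlonglongrightarrow> l"
  shows "(\<lambda>n. (\<Sum>k=1..n. x k) / (\<Sum>k=1..n. b k)) \<longlonglongrightarrow> l"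
proof (rule LIMSEQ_I)
  fix e :: real assume e: "e > 0"
  obtain K where K: "\<And>k. k \<ge> K \<Longrightarrow> norm (x k / b k - l) < e/2"
    using LIMSEQ_D[OF lim, of "e/2"] e by auto
  define D where "D = (\<Sum>k=1..K. \<bar>x k - l * b k\<bar>)"
  obtain M where M: "\<And>n. n \<ge> M \<Longrightarrow> (\<Sum>k=1..n. b k) > max 0 (2 * D / e)"
    using B[unfolded filterlim_at_top_dense, rule_format, of "max 0 (2 * D / e)"]
    unfolding eventually_sequentially by blast
  show "\<exists>no. \<forall>n\<ge>no. norm ((\<Sum>k=1..n. x k) / (\<Sum>k=1..n. b k) - l) < e"
  proof (intro exI[of _ M] allI impI)
    fix n assume n: "n \<ge> M"
    let ?B = "\<Sum>k=1..n. b k"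
    have Bp: "?B > 0" and BD: "?B > 2 * D / e" using M[OF n] by auto
    have "\<bar>(\<Sum>k=1..n. x k) - l * ?B\<bar> = \<bar>\<Sum>k=1..n. x k - l * b k\<bar>"
      by (simp add: sum_subtractf sum_distrib_left)
    also have "\<dots> \<le> (\<Sum>k=1..n. \<bar>x k - l * b k\<bar>)" by (rule sum_abs)
    also have "\<dots> \<le> (\<Sum>k=1..n. (if k \<le> K then \<bar>x k - l * b k\<bar> else 0) + e/2 * b k)"
    proof (rule sum_mono)
      fix k assume k: "k \<in> {1..n}"
      then have bk: "b k > 0" using b by simp
      have "\<bar>x k - l * b k\<bar> \<le> e/2 * b k" if "k > K"
      proof -
        have "\<bar>x k - l * b k\<bar> = \<bar>x k / b k - l\<bar> * b k"
          using bk by (simp add: abs_mult[symmetric] field_simps)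
        also have "\<dots> \<le> e/2 * b k" using K[of k] that bk by (intro mult_right_mono) auto
        finally show ?thesis .
      qed
      then show "\<bar>x k - l * b k\<bar> \<le> (if k \<le> K then \<bar>x k - l * b k\<bar> else 0) + e/2 * b k"
        using bk e by auto
    qed
    also have "\<dots> = (\<Sum>k=1..n. if k \<le> K then \<bar>x k - l * b k\<bar> else 0) + e/2 * ?B"
      by (simp add: sum.distrib sum_distrib_left)
    also have "(\<Sum>k=1..n. if k \<le> K then \<bar>x k - l * b k\<bar> else 0) \<le> D"
      unfolding D_def by (subst sum.inter_filter[symmetric]) (auto intro!: sum_mono2)
    also have "D < e/2 * ?B" using BD e by (simp add: field_simps)
    finally have "\<bar>(\<Sum>k=1..n. x k) - l * ?B\<bar> < e * ?B" by simp
    moreover have "(\<Sum>k=1..n. x k) / ?B - l = ((\<Sum>k=1..n. x k) - l * ?B) / ?B"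
      using Bp by (simp add: field_simps)
    ultimately show "norm ((\<Sum>k=1..n. x k) / ?B - l) < e"
      using Bp by (simp add: field_simps)
  qed
qed

text \<open>Monotonicity upgrades integer dilations to real ones. With \<open>P = P q\<close> the
  integer part of \<open>q * y\<close> and \<open>k = n div q\<close>, the ratio lies between
  \<open>f (k * P) / f (k * (q + 1))\<close> and \<open>f (k * (P + 2)) / f (k * q)\<close>. Their
  limits are powers of \<open>P / (q + 1)\<close> and \<open>(P + 2) / q\<close>, both close to
  \<open>y\<close> for large \<open>q\<close>.\<close>

lemma mono_regularly_varying_real:
  fixes f :: "nat \<Rightarrow> real"
  assumes mono: "\<And>m n. m \<le> n \<Longrightarrow> f m \<le> f n"
    and pos: "\<And>n. n \<ge> 1 \<Longrightarrow> f n > 0"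
    and rv: "\<And>m. m \<ge> 1 \<Longrightarrow> (\<lambda>n. f (m * n) / f n) \<longlonglongrightarrow> real m powr \<sigma>"
    and y: "y > 0"
  shows "(\<lambda>n. f (nat \<lfloor>real n * y\<rfloor>) / f n) \<longlonglongrightarrow> y powr \<sigma>"
proof -
  define P where "P q = nat \<lfloor>real q * y\<rfloor>" for q :: nat
  have P1: "real (P q) \<le> real q * y" "real q * y < real (P q) + 1" for q
    using y by (auto simp: P_def)
  have Pq: "(\<lambda>q. real (P q + d) / real (q + d')) \<longlonglongrightarrow> y" for d d'
  proof (rule tendsto_sandwich)
    show "(\<lambda>q. (real q * y - 1) / (real q + real d')) \<longlonglongrightarrow> y" "(\<lambda>q. (real q * y + real d) / (real q + real d')) \<longlonglongrightarrow> y"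
      by real_asymp+
    show "\<forall>\<^sub>F q in sequentially. (real q * y - 1) / (real q + real d') \<le> real (P q + d) / real (q + d')"
    proof (intro always_eventually allI)
      fix q
      have "real q * y - 1 \<le> real (P q + d)" using P1(2)[of q] by simp
      then show "(real q * y - 1) / (real q + real d') \<le> real (P q + d) / real (q + d')"
        by (simp add: divide_right_mono)
    qed
    show "\<forall>\<^sub>F q in sequentially. real (P q + d) / real (q + d') \<le> (real q * y + real d) / (real q + real d')"
      using P1 by (intro always_eventually allI) (simp add: divide_right_mono)
  qed
  have fpow: "(\<lambda>n. f (n div q * m) / f (n div q * m')) \<longlonglongrightarrow> (real m / real m') powr \<sigma>"
    if "m \<ge> 1" "m' \<ge> 1" "q \<ge> 1" for m m' q
  proof -
    have q: "filterlim (\<lambda>n. n div q) at_top sequentially"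
      using that(3) by real_asymp
    have "(\<lambda>k. (f (m * k) / f k) / (f (m' * k) / f k)) \<longlonglongrightarrow> (real m powr \<sigma>) / (real m' powr \<sigma>)"
      using that by (intro tendsto_divide rv) auto
    then have "(\<lambda>k. f (m * k) / f (m' * k)) \<longlonglongrightarrow> (real m powr \<sigma>) / (real m' powr \<sigma>)"
    proof (rule Lim_transform_eventually)
      show "\<forall>\<^sub>F k in sequentially. (f (m * k) / f k) / (f (m' * k) / f k) = f (m * k) / f (m' * k)"
        using eventually_gt_at_top[of 0] by eventually_elim (use pos in \<open>auto simp: less_imp_neq[symmetric]\<close>)
    qed
    from filterlim_compose[OF this q] show ?thesis
      by (simp add: powr_divide mult.commute)
  qed
  show ?thesis
  proof (rule LIMSEQ_I)
    fix e :: real assume e: "e > 0"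
    have "(\<lambda>q. (real (P q + 0) / real (q + 1)) powr \<sigma>) \<longlonglongrightarrow> y powr \<sigma>"
         "(\<lambda>q. (real (P q + 2) / real (q + 0)) powr \<sigma>) \<longlonglongrightarrow> y powr \<sigma>"
      by (intro tendsto_powr Pq tendsto_const; use y in simp)+
    from order_tendstoD(1)[OF this(1), of "y powr \<sigma> - e/2"] order_tendstoD(2)[OF this(2), of "y powr \<sigma> + e/2"]
      eventually_ge_at_top[of "nat \<lceil>1/y\<rceil> + 1"]
    have "\<forall>\<^sub>F q in sequentially. (real (P q) / real (q + 1)) powr \<sigma> > y powr \<sigma> - e/2 \<and>
      (real (P q + 2) / real q) powr \<sigma> < y powr \<sigma> + e/2 \<and> q \<ge> nat \<lceil>1/y\<rceil> + 1"
      using e by (auto elim: eventually_elim2 simp: eventually_conj_iff)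
    then obtain q where q: "(real (P q) / real (q + 1)) powr \<sigma> > y powr \<sigma> - e/2"
      "(real (P q + 2) / real q) powr \<sigma> < y powr \<sigma> + e/2" "q \<ge> nat \<lceil>1/y\<rceil> + 1"
      by (auto simp: eventually_sequentially)
    \<comment> \<open>\<open>q\<close> was taken beyond \<open>1/y\<close> to make
      \<open>P q\<close> at least 1, as the dilation factors in \<open>fpow\<close> must be.\<close>
    have "1/y \<le> real q" using q(3) by linarith
    then have "real q * y \<ge> 1" using y by (simp add: field_simps)
    then have Pge: "P q \<ge> 1" by (simp add: P_def le_nat_floor)
    have q1: "q \<ge> 1" using q(3) by simp
    have lo: "\<forall>\<^sub>F n in sequentially. f (n div q * P q) / f (n div q * (q + 1)) > y powr \<sigma> - e"
      using fpow[of "P q" "q + 1" q] Pge q1 q(1) e by (intro order_tendstoD(1)) auto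
    have hi: "\<forall>\<^sub>F n in sequentially. f (n div q * (P q + 2)) / f (n div q * q) < y powr \<sigma> + e"
      using fpow[of "P q + 2" q q] q1 q(2) e by (intro order_tendstoD(2)) auto
    \<comment> \<open>For \<open>n\<close> beyond \<open>q * (q + P q + 1)\<close> the quotient
      \<open>k\<close> is at least \<open>q + P q + 1\<close>, which gives both
      \<open>(k + 1) * q <= k * (q + 1)\<close> and
      \<open>(k + 1) * (P q + 1) <= k * (P q + 2)\<close>.\<close>
    have "\<forall>\<^sub>F n in sequentially. norm (f (nat \<lfloor>real n * y\<rfloor>) / f n - y powr \<sigma>) < e"
      using lo hi eventually_ge_at_top[of "q * (q + P q + 1)"]
    proof eventually_elim
      case (elim n)
      define k where "k = n div q"
      have k: "k \<ge> q + P q + 1" using div_le_mono[OF elim(3), of q] q1 by (simp add: k_def)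
      have n1: "k * q \<le> n" unfolding k_def by simp
      have n2: "n < (k + 1) * q" unfolding k_def using q1
        by (metis add.commute dividend_less_times_div mult.commute plus_1_eq_Suc mult_Suc_right zero_less_one less_le_trans)
      have fl: "real (nat \<lfloor>real n * y\<rfloor>) \<le> real n * y" using y by simp
      have "real k * real (P q) \<le> real k * (real q * y)" using P1(1) by (intro mult_left_mono) auto
      also have "\<dots> \<le> real n * y" using n1 y
        by (metis mult.assoc mult_right_mono of_nat_le_iff of_nat_mult less_imp_le)
      finally have a: "k * P q \<le> nat \<lfloor>real n * y\<rfloor>" by (simp add: le_nat_floor)
      have "n \<le> (k + 1) * q" using n2 by simp
      also have "\<dots> \<le> k * (q + 1)" using k by simp
      finally have b: "n \<le> k * (q + 1)" .
      have "real n * y \<le> real ((k + 1) * q) * y"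
        using n2 y by (intro mult_right_mono of_nat_mono) auto
      also have "\<dots> = real (k + 1) * (real q * y)" by (simp add: algebra_simps)
      also have "\<dots> \<le> real (k + 1) * (real (P q) + 1)"
        using P1(2)[of q] by (intro mult_left_mono) auto
      also have "\<dots> = real ((k + 1) * (P q + 1))" by (simp add: algebra_simps)
      finally have "real (nat \<lfloor>real n * y\<rfloor>) \<le> real ((k + 1) * (P q + 1))"
        using fl by (rule order.trans[rotated])
      then have "nat \<lfloor>real n * y\<rfloor> \<le> (k + 1) * (P q + 1)" using of_nat_le_iff by blast
      also have "\<dots> \<le> k * (P q + 2)" using k by simp
      finally have c: "nat \<lfloor>real n * y\<rfloor> \<le> k * (P q + 2)" .
      have kp: "k \<ge> 1" "n \<ge> 1" using k n1 q1 by (auto simp: Suc_le_eq intro: order.strict_trans2[of 0 "k * q"])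
      have "1 \<le> k * P q" "1 \<le> k * q" using kp q1 Pge by simp_all
      then have f0: "0 < f n" "0 < f (k * q)" "0 < f (k * P q)" "0 < f (nat \<lfloor>real n * y\<rfloor>)"
        using kp le_trans[OF _ a] by (blast intro: pos)+
      have "f (k * P q) / f (k * (q + 1)) \<le> f (nat \<lfloor>real n * y\<rfloor>) / f n"
        using mono[OF a] mono[OF b] f0 by (intro frac_le) auto
      moreover have "f (nat \<lfloor>real n * y\<rfloor>) / f n \<le> f (k * (P q + 2)) / f (k * q)"
        using mono[OF c] mono[OF n1] f0 by (intro frac_le) auto
      ultimately show ?case using elim(1,2) by (simp add: k_def abs_less_iff)
    qed
    then show "\<exists>no. \<forall>n\<ge>no. norm (f (nat \<lfloor>real n * y\<rfloor>) / f n - y powr \<sigma>) < e"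
      by (simp add: eventually_sequentially)
  qed
qed

section \<open>Laplace sums and the Abelian half\<close>

definition laplace :: "(nat \<Rightarrow> real) \<Rightarrow> real \<Rightarrow> real" where
  "laplace b s = (\<Sum>k. b k * exp (- (real k * s)))"

lemma exp_neg_mult: "exp (- (real k * s)) = exp (- s) ^ k"
  by (metis exp_of_nat_mult mult_minus_right)

lemma laplace_summable:
  assumes "\<And>k. 0 \<le> b k \<and> b k \<le> 1" and "s > 0"
  shows "summable (\<lambda>k. b k * exp (- (real k * s)))"
proof (rule summable_comparison_test)
  show "\<exists>N. \<forall>n\<ge>N. norm (b n * exp (- (real n * s))) \<le> exp (- s) ^ n"
    using assms by (auto simp: exp_neg_mult abs_mult intro!: mult_left_le_one_le)
  show "summable (\<lambda>n. exp (- s) ^ n)" using assms(2) by (simp add: summable_geometric)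
qed

lemma laplace_nonneg:
  assumes "\<And>k. 0 \<le> b k \<and> b k \<le> 1" and "s > 0"
  shows "laplace b s \<ge> 0"
  unfolding laplace_def using assms by (intro suminf_nonneg laplace_summable) auto

lemma laplace_pos:
  assumes "\<And>k. 0 \<le> b k \<and> b k \<le> 1" and "s > 0" and "b j > 0"
  shows "laplace b s > 0"
  unfolding laplace_def using assms
  by (intro suminf_pos2[where i = j] laplace_summable) auto

lemma nn_integral_exp_atLeast:
  assumes "c \<ge> 0"
  shows "(\<integral>\<^sup>+ y. ennreal (c * exp (- y)) * indicator {a..} y \<partial>lborel) = ennreal (c * exp (- a))"
proof -
  have "(\<integral>\<^sup>+ y. ennreal (c * exp (- y)) * indicator {a..} y \<partial>lborel) = ennreal (0 - (- c * exp (- a)))"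
  proof (rule nn_integral_FTC_atLeast)
    show "((\<lambda>y. - c * exp (- y)) \<longlongrightarrow> 0) at_top" by real_asymp
    show "((\<lambda>y. - c * exp (- y)) has_real_derivative c * exp (- x)) (at x)" for x
      by (auto intro!: derivative_eq_intros)
  qed (use assms in auto)
  then show ?thesis by simp
qed

text \<open>Summation by parts, with the exponential weights written as integrals.\<close>

lemma laplace_conv_nn_integral:
  assumes b: "\<And>k. 0 \<le> b k \<and> b k \<le> 1" and s: "s > 0"
  shows "ennreal (laplace b s) =
    (\<integral>\<^sup>+ y. ennreal ((\<Sum>k\<le>nat \<lfloor>y / s\<rfloor>. b k) * exp (- y)) * indicator {0..} y \<partial>lborel)"
proof -
  have "(\<integral>\<^sup>+ y. ennreal ((\<Sum>k\<le>nat \<lfloor>y / s\<rfloor>. b k) * exp (- y)) * indicator {0..} y \<partial>lborel)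
    = (\<integral>\<^sup>+ y. (\<Sum>k. ennreal (b k * exp (- y)) * indicator {real k * s..} y) \<partial>lborel)"
  proof (rule nn_integral_cong)
    fix y :: real
    show "ennreal ((\<Sum>k\<le>nat \<lfloor>y / s\<rfloor>. b k) * exp (- y)) * indicator {0..} y
      = (\<Sum>k. ennreal (b k * exp (- y)) * indicator {real k * s..} y)"
    proof (cases "y \<ge> 0")
      case True
      have iff: "k \<le> nat \<lfloor>y / s\<rfloor> \<longleftrightarrow> real k * s \<le> y" for k
        using True s by (simp add: le_nat_iff le_floor_iff field_simps)
      have "(\<Sum>k. ennreal (b k * exp (- y)) * indicator {real k * s..} y)
        = (\<Sum>k\<le>nat \<lfloor>y / s\<rfloor>. ennreal (b k * exp (- y)) * indicator {real k * s..} y)"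
        by (rule suminf_finite) (auto simp: iff indicator_def)
      also have "\<dots> = (\<Sum>k\<le>nat \<lfloor>y / s\<rfloor>. ennreal (b k * exp (- y)))"
        by (rule sum.cong) (auto simp: iff indicator_def)
      also have "\<dots> = ennreal ((\<Sum>k\<le>nat \<lfloor>y / s\<rfloor>. b k) * exp (- y))"
        using b by (simp add: sum_ennreal sum_distrib_right)
      finally show ?thesis using True by simp
    next
      case False
      then have "indicator {real k * s..} y = (0 :: ennreal)" for k
      proof -
        have "0 \<le> real k * s" using s by simp
        then show ?thesis using False by (auto simp: indicator_def)
      qed
      then show ?thesis using False by simp
    qed
  qed
  also have "\<dots> = (\<Sum>k. \<integral>\<^sup>+ y. ennreal (b k * exp (- y)) * indicator {real k * s..} y \<partial>lborel)"
    by (rule nn_integral_suminf) simp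
  also have "\<dots> = (\<Sum>k. ennreal (b k * exp (- (real k * s))))"
    using b by (simp add: nn_integral_exp_atLeast)
  also have "\<dots> = ennreal (laplace b s)"
    unfolding laplace_def using b laplace_summable[OF b s] by (intro suminf_ennreal2) auto
  finally show ?thesis ..
qed

text \<open>With \<open>s = c / n\<close> the integral form of \<open>laplace\<close> divided by the
  partial sum up to \<open>n\<close> has the integrand
  \<open>B (nat \<lfloor>n * y / c\<rfloor>) / B n * exp (- y)\<close>. It tends to
  \<open>(y / c) powr \<rho> * exp (- y)\<close>, whose integral is the Gamma value. The hypothesis
  \<open>dom\<close> supplies the integrable majorant for dominated convergence.\<close>

lemma karamata_abelian:
  assumes b: "\<And>k. 0 \<le> b k \<and> b k \<le> 1"
    and B_pos: "\<And>n. n \<ge> 1 \<Longrightarrow> (\<Sum>k\<le>n. b k) > 0"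
    and rv: "\<And>y. y > 0 \<Longrightarrow> (\<lambda>n. (\<Sum>k\<le>nat \<lfloor>real n * y\<rfloor>. b k) / (\<Sum>k\<le>n. b k)) \<longlonglongrightarrow> y powr \<rho>"
    and dom: "\<And>n y. n \<ge> 1 \<Longrightarrow> y \<ge> 0 \<Longrightarrow> (\<Sum>k\<le>nat \<lfloor>real n * y\<rfloor>. b k) \<le> D * (y + 1) * (\<Sum>k\<le>n. b k)"
    and rho: "\<rho> \<ge> 0" and D: "D > 0" and c: "c > 0"
  shows "(\<lambda>n. laplace b (c / real n) / (\<Sum>k\<le>n. b k)) \<longlonglongrightarrow> c powr (- \<rho>) * Gamma (1 + \<rho>)"
proof -
  define B where "B n = (\<Sum>k\<le>n. b k)" for n
  \<comment> \<open>Indexing by \<open>Suc i\<close>, because \<open>B 0\<close> may vanish while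
    the majorant has to hold at every index.\<close>
  define f where "f i y = ennreal (B (nat \<lfloor>real (Suc i) * (y / c)\<rfloor>) / B (Suc i) * exp (- y)) * indicator {0..} y" for i y
  define w where "w y = ennreal (D * (y / c + 1) * exp (- y)) * indicator {0..} y" for y
  \<comment> \<open>Written in the shape of the Gamma integrand with exponent
    \<open>1 + \<rho> - 1\<close>, so that \<open>Gamma_conv_nn_integral_real\<close> applies
    directly.\<close>
  define g where "g y = ennreal (c powr (- \<rho>)) * ennreal (indicator {0..} y * y powr (1 + \<rho> - 1) / exp y)" for y
  have B_Suc: "B (Suc i) > 0" for i
    using B_pos[of "Suc i"] by (simp add: B_def del: sum.atMost_Suc)
  have Bnn: "B n \<ge> 0" for n using b by (simp add: B_def sum_nonneg)
  have [measurable]: "(\<lambda>y. B (nat \<lfloor>real i * (y / c)\<rfloor>)) \<in> borel_measurable borel" for i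
    by measurable
  have "(\<lambda>i. \<integral>\<^sup>+ y. f i y \<partial>lborel) \<longlonglongrightarrow> (\<integral>\<^sup>+ y. g y \<partial>lborel)"
  proof (rule nn_integral_dominated_convergence)
    show "f i \<in> borel_measurable lborel" for i unfolding f_def by measurable
    show "g \<in> borel_measurable lborel" unfolding g_def by measurable
    show "w \<in> borel_measurable lborel" unfolding w_def by measurable
    show "AE y in lborel. f i y \<le> w y" for i
    proof (rule AE_I2)
      fix y :: real
      show "f i y \<le> w y"
      proof (cases "y \<ge> 0")
        case True
        have "B (nat \<lfloor>real (Suc i) * (y / c)\<rfloor>) / B (Suc i) \<le> D * (y / c + 1)"
          using dom[of "Suc i" "y / c"] True c B_Suc[of i] by (simp add: B_def field_simps)
        then show ?thesis unfolding f_def w_def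
          by (intro mult_right_mono ennreal_leI) auto
      qed (simp add: f_def w_def)
    qed
    have "(\<integral>\<^sup>+ y. w y \<partial>lborel) = ennreal (0 - (- D * (0 / c + 1 + 1 / c) * exp (- 0)))"
      unfolding w_def
    proof (rule nn_integral_FTC_atLeast)
      show "((\<lambda>y. - D * (y / c + 1 + 1 / c) * exp (- y)) \<longlongrightarrow> 0) at_top"
        using c D by real_asymp
      show "((\<lambda>y. - D * (y / c + 1 + 1 / c) * exp (- y)) has_real_derivative D * (x / c + 1) * exp (- x)) (at x)" for x
        using c by (auto intro!: derivative_eq_intros simp: field_simps)
    qed (use D c in \<open>auto simp: add_nonneg_nonneg\<close>)
    then show "(\<integral>\<^sup>+ y. w y \<partial>lborel) < \<infinity>" by simp
    show "AE y in lborel. (\<lambda>i. f i y) \<longlonglongrightarrow> g y"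
    proof -
      \<comment> \<open>Pointwise convergence is assumed for \<open>y > 0\<close> only.\<close>
      have "AE y in lborel. y \<noteq> (0::real)" by (rule AE_lborel_singleton)
      then show ?thesis
      proof eventually_elim
        fix y :: real assume y: "y \<noteq> 0"
        show "(\<lambda>i. f i y) \<longlonglongrightarrow> g y"
        proof (cases "y > 0")
          case True
          have "(\<lambda>i. B (nat \<lfloor>real (Suc i) * (y / c)\<rfloor>) / B (Suc i) * exp (- y)) \<longlonglongrightarrow> (y / c) powr \<rho> * exp (- y)"
            using LIMSEQ_Suc[OF rv[of "y / c"]] True c by (intro tendsto_mult tendsto_const) (simp add: B_def)
          then have "(\<lambda>i. f i y) \<longlonglongrightarrow> ennreal ((y / c) powr \<rho> * exp (- y))"
            using True unfolding f_def by simp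
          also have "ennreal ((y / c) powr \<rho> * exp (- y)) = g y"
            using True c unfolding g_def
            by (simp add: ennreal_mult[symmetric] powr_divide powr_minus exp_minus field_simps)
          finally show ?thesis .
        next
          case False then show ?thesis using y by (simp add: f_def g_def)
        qed
      qed
    qed
  qed
  moreover have "(\<integral>\<^sup>+ y. g y \<partial>lborel) = ennreal (c powr (- \<rho>) * Gamma (1 + \<rho>))"
  proof -
    have "(\<integral>\<^sup>+ y. g y \<partial>lborel) = ennreal (c powr (- \<rho>)) * ennreal (Gamma (1 + \<rho>))"
      unfolding g_def using Gamma_conv_nn_integral_real[of "1 + \<rho>"] rho by (subst nn_integral_cmult) auto
    then show ?thesis using rho by (simp add: ennreal_mult)
  qed
  moreover have "(\<integral>\<^sup>+ y. f i y \<partial>lborel) = ennreal (laplace b (c / real (Suc i)) / B (Suc i))" for i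
  proof -
    have "(\<integral>\<^sup>+ y. f i y \<partial>lborel) = (\<integral>\<^sup>+ y. ennreal (1 / B (Suc i)) *
        (ennreal (B (nat \<lfloor>y / (c / real (Suc i))\<rfloor>) * exp (- y)) * indicator {0..} y) \<partial>lborel)"
      using B_Suc[of i] Bnn c unfolding f_def
      by (intro nn_integral_cong) (simp add: ennreal_mult[symmetric] mult.assoc[symmetric] field_simps)
    also have "\<dots> = ennreal (1 / B (Suc i)) * ennreal (laplace b (c / real (Suc i)))"
      using c by (subst nn_integral_cmult) (auto simp: laplace_conv_nn_integral[OF b] B_def)
    finally show ?thesis
      using B_Suc[of i] laplace_nonneg[OF b, of "c / real (Suc i)"] c by (simp add: ennreal_mult[symmetric])
  qed
  ultimately have "(\<lambda>i. ennreal (laplace b (c / real (Suc i)) / B (Suc i))) \<longlonglongrightarrow> ennreal (c powr (- \<rho>) * Gamma (1 + \<rho>))"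
    by simp
  then have "(\<lambda>i. laplace b (c / real (Suc i)) / B (Suc i)) \<longlonglongrightarrow> c powr (- \<rho>) * Gamma (1 + \<rho>)"
    using laplace_nonneg[OF b] c Bnn rho
    by (subst (asm) tendsto_ennreal_iff) (auto intro!: always_eventually)
  then have "(\<lambda>n. laplace b (c / real n) / B n) \<longlonglongrightarrow> c powr (- \<rho>) * Gamma (1 + \<rho>)"
    by (rule LIMSEQ_imp_Suc)
  then show ?thesis by (simp add: B_def)
qed

section \<open>Weighted averages and the Tauberian half\<close>

definition laplace_avg :: "(nat \<Rightarrow> real) \<Rightarrow> real \<Rightarrow> (real \<Rightarrow> real) \<Rightarrow> real" where
  "laplace_avg b s f =
     (\<Sum>k. b k * exp (- (real k * s)) * f (exp (- (real k * s)))) / laplace b s"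

lemma exp_neg_in_unit: "s > 0 \<Longrightarrow> exp (- (real k * s)) \<in> {0..1}"
  by simp

lemma laplace_avg_summable:
  assumes b: "\<And>k. 0 \<le> b k \<and> b k \<le> 1" and s: "s > 0" and f: "continuous_on {0..1} f"
  shows "summable (\<lambda>k. b k * exp (- (real k * s)) * f (exp (- (real k * s))))"
proof -
  have "bounded (f ` {0..1})" using f by (intro compact_imp_bounded compact_continuous_image) auto
  then obtain M where "\<forall>x\<in>f ` {0..1}. norm x \<le> M" unfolding bounded_iff by blast
  then have M: "\<And>x. x \<in> {0..1} \<Longrightarrow> norm (f x) \<le> M" by blast
  show ?thesis
  proof (rule summable_comparison_test)
    show "summable (\<lambda>k. b k * exp (- (real k * s)) * M)"
      by (intro summable_mult2 laplace_summable b s)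
    show "\<exists>N. \<forall>n\<ge>N. norm (b n * exp (- (real n * s)) * f (exp (- (real n * s)))) \<le> b n * exp (- (real n * s)) * M"
      using M[OF exp_neg_in_unit[OF s]] b by (auto simp: abs_mult intro!: mult_left_mono)
  qed
qed

text \<open>The weights \<open>b k * exp (- (k * s)) / laplace b s\<close> are nonnegative with
  total mass 1, so averaging does not increase the uniform distance.\<close>

lemma laplace_avg_diff_le:
  assumes b: "\<And>k. 0 \<le> b k \<and> b k \<le> 1" "b 0 > 0" and s: "s > 0"
    and f: "continuous_on {0..1} f" and g: "continuous_on {0..1} g"
    and fg: "\<And>x. x \<in> {0..1} \<Longrightarrow> \<bar>f x - g x\<bar> \<le> e"
  shows "\<bar>laplace_avg b s f - laplace_avg b s g\<bar> \<le> e"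
proof -
  let ?w = "\<lambda>k. b k * exp (- (real k * s))" and ?x = "\<lambda>k. exp (- (real k * s))"
  have pos: "laplace b s > 0" by (rule laplace_pos[where b = b, OF b(1) s b(2)])
  have sm: "summable (\<lambda>k. ?w k * e)" by (intro summable_mult2 laplace_summable b s)
  have le: "\<bar>?w k * f (?x k) - ?w k * g (?x k)\<bar> \<le> ?w k * e" for k
  proof -
    have "\<bar>?w k * f (?x k) - ?w k * g (?x k)\<bar> = ?w k * \<bar>f (?x k) - g (?x k)\<bar>"
      using b(1)[of k] by (simp add: abs_mult right_diff_distrib[symmetric])
    also have "\<dots> \<le> ?w k * e"
      using b(1)[of k] exp_neg_in_unit[OF s] by (intro mult_left_mono fg) auto
    finally show ?thesis .
  qed
  have "(\<Sum>k. ?w k * f (?x k)) - (\<Sum>k. ?w k * g (?x k)) = (\<Sum>k. ?w k * f (?x k) - ?w k * g (?x k))"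
    by (intro suminf_diff laplace_avg_summable b s f g)
  also have "\<bar>\<dots>\<bar> \<le> (\<Sum>k. ?w k * e)"
  proof -
    have "summable (\<lambda>k. \<bar>?w k * f (?x k) - ?w k * g (?x k)\<bar>)"
      using le by (intro summable_comparison_test'[OF sm, of 0]) auto
    then show ?thesis using le sm by (intro order.trans[OF summable_rabs] suminf_le) auto
  qed
  also have "\<dots> = laplace b s * e"
    unfolding laplace_def by (intro suminf_mult2[symmetric] laplace_summable b s)
  finally have "\<bar>(\<Sum>k. ?w k * f (?x k)) - (\<Sum>k. ?w k * g (?x k))\<bar> / laplace b s \<le> e"
    using pos by (simp add: field_simps)
  then show ?thesis using pos
    by (simp add: laplace_avg_def diff_divide_distrib[symmetric])
qed

lemma laplace_avg_polynomial:
  assumes b: "\<And>k. 0 \<le> b k \<and> b k \<le> 1" and s: "s > 0"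
  shows "laplace_avg b s (\<lambda>x. \<Sum>i\<le>d. \<alpha> i * x ^ i) = (\<Sum>i\<le>d. \<alpha> i * (laplace b (real (Suc i) * s) / laplace b s))"
proof -
  have eq: "b k * exp (- (real k * s)) * (\<Sum>i\<le>d. \<alpha> i * exp (- (real k * s)) ^ i)
     = (\<Sum>i\<le>d. \<alpha> i * (b k * exp (- (real k * (real (Suc i) * s)))))" for k
  proof -
    have "exp (- (real k * s)) * exp (- (real k * s)) ^ i = exp (- (real k * (real (Suc i) * s)))" for i
      by (simp add: exp_add[symmetric] exp_of_nat_mult[symmetric] algebra_simps)
    then show ?thesis by (simp add: sum_distrib_left mult_ac)
  qed
  have "(\<Sum>k. \<Sum>i\<le>d. \<alpha> i * (b k * exp (- (real k * (real (Suc i) * s)))))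
    = (\<Sum>i\<le>d. \<alpha> i * laplace b (real (Suc i) * s))"
  proof -
    have sm: "summable (\<lambda>k. b k * exp (- (real k * (real (Suc i) * s))))" for i
      by (rule laplace_summable[OF b]) (use s in simp)
    show ?thesis using sm
      by (subst suminf_sum) (auto simp: laplace_def suminf_mult intro!: summable_mult)
  qed
  then show ?thesis
    unfolding laplace_avg_def eq by (simp add: sum_divide_distrib)
qed

text \<open>Averages of monomials are ratios of Laplace sums, so by Weierstrass two sequences with the
  same asymptotic ratios give the same weight to every continuous function.\<close>

lemma laplace_avg_compare:
  assumes u: "\<And>k. 0 \<le> u k \<and> u k \<le> 1" "u 0 > 0" and c: "\<And>k. 0 \<le> c k \<and> c k \<le> 1" "c 0 > 0"
    and lim_u: "\<And>j. j \<ge> 1 \<Longrightarrow> (\<lambda>n. laplace u (real j / real n) / laplace u (1 / real n)) \<longlonglongrightarrow> m j"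
    and lim_c: "\<And>j. j \<ge> 1 \<Longrightarrow> (\<lambda>n. laplace c (real j / real n) / laplace c (1 / real n)) \<longlonglongrightarrow> m j"
    and f: "continuous_on {0..1} f"
  shows "(\<lambda>n. laplace_avg u (1 / real n) f - laplace_avg c (1 / real n) f) \<longlonglongrightarrow> 0"
proof (rule LIMSEQ_I)
  fix e :: real assume e: "e > 0"
  obtain g where g: "real_polynomial_function g" "\<And>x. x \<in> {0..1} \<Longrightarrow> \<bar>f x - g x\<bar> < e/4"
    using Stone_Weierstrass_real_polynomial_function[of "{0..1::real}" f "e/4"] f e by auto
  obtain \<alpha> d where gd: "g = (\<lambda>x. \<Sum>i\<le>d. \<alpha> i * x ^ i)"
    using g(1) by (auto simp: real_polynomial_function_iff_sum)
  have gc: "continuous_on {0..1} g" unfolding gd by (intro continuous_intros)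
  have lim: "(\<lambda>n. laplace_avg b (1 / real n) g) \<longlonglongrightarrow> (\<Sum>i\<le>d. \<alpha> i * m (Suc i))"
    if b: "\<And>k. 0 \<le> b k \<and> b k \<le> 1"
      and lb: "\<And>j. j \<ge> 1 \<Longrightarrow> (\<lambda>n. laplace b (real j / real n) / laplace b (1 / real n)) \<longlonglongrightarrow> m j" for b
  proof -
    have "(\<lambda>n. \<Sum>i\<le>d. \<alpha> i * (laplace b (real (Suc i) / real n) / laplace b (1 / real n))) \<longlonglongrightarrow> (\<Sum>i\<le>d. \<alpha> i * m (Suc i))"
      by (intro tendsto_intros lb) auto
    then show ?thesis
    proof (rule Lim_transform_eventually)
      show "\<forall>\<^sub>F n in sequentially. (\<Sum>i\<le>d. \<alpha> i * (laplace b (real (Suc i) / real n) / laplace b (1 / real n)))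
          = laplace_avg b (1 / real n) g"
        using eventually_gt_at_top[of 0]
        by eventually_elim (simp add: gd laplace_avg_polynomial[OF b])
    qed
  qed
  have "(\<lambda>n. laplace_avg u (1 / real n) g - laplace_avg c (1 / real n) g) \<longlonglongrightarrow> 0"
    using tendsto_diff[OF lim[OF u(1) lim_u] lim[OF c(1) lim_c]] by simp
  from LIMSEQ_D[OF this, of "e/4"] obtain N where
    N: "\<And>n. n \<ge> N \<Longrightarrow> norm (laplace_avg u (1 / real n) g - laplace_avg c (1 / real n) g) < e/4"
    using e by auto
  show "\<exists>no. \<forall>n\<ge>no. norm (laplace_avg u (1 / real n) f - laplace_avg c (1 / real n) f - 0) < e"
  proof (intro exI[of _ "Suc N"] allI impI)
    fix n assume n: "n \<ge> Suc N"
    then have s: "1 / real n > 0" by simp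
    have "\<bar>laplace_avg u (1 / real n) f - laplace_avg u (1 / real n) g\<bar> \<le> e/4"
      by (rule laplace_avg_diff_le[where b = u, OF u s f gc]) (use g(2) in \<open>auto intro: less_imp_le\<close>)
    moreover have "\<bar>laplace_avg c (1 / real n) f - laplace_avg c (1 / real n) g\<bar> \<le> e/4"
      by (rule laplace_avg_diff_le[where b = c, OF c s f gc]) (use g(2) in \<open>auto intro: less_imp_le\<close>)
    moreover have "\<bar>laplace_avg u (1 / real n) g - laplace_avg c (1 / real n) g\<bar> < e/4"
      using N n by simp
    ultimately show "norm (laplace_avg u (1 / real n) f - laplace_avg c (1 / real n) f - 0) < e"
      using e unfolding real_norm_def diff_zero by linarith
  qed
qed

text \<open>In the variable \<open>x = exp (-y)\<close> this is \<open>exp y\<close> times the piecewise linear cut-off that equals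
  1 for \<open>y \<le> p\<close> and 0 for \<open>y \<ge> q\<close>.\<close>

definition cutoff :: "real \<Rightarrow> real \<Rightarrow> real \<Rightarrow> real" where
  "cutoff p q x = 1 / max x (exp (- q)) * max 0 (min 1 ((q + ln (max x (exp (- q)))) / (q - p)))"

text \<open>The truncation \<open>max x (exp (- q))\<close> keeps the reciprocal and the logarithm
  away from 0; it takes effect only where the second factor already vanishes.\<close>

lemma continuous_cutoff: "p < q \<Longrightarrow> continuous_on A (cutoff p q)"
proof -
  assume "p < q"
  moreover have "max x (exp (- q)) > 0" for x by (simp add: less_max_iff_disj)
  moreover from this have "max x (exp (- q)) \<noteq> 0" for x by (metis less_irrefl)
  ultimately show ?thesis unfolding cutoff_def by (intro continuous_intros) auto
qed

lemma cutoff_exp: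
  assumes "p < q"
  shows "0 \<le> exp (- y) * cutoff p q (exp (- y))" "exp (- y) * cutoff p q (exp (- y)) \<le> 1"
    "y \<le> p \<Longrightarrow> exp (- y) * cutoff p q (exp (- y)) = 1"
    "y > q \<Longrightarrow> exp (- y) * cutoff p q (exp (- y)) = 0"
proof -
  have eq: "exp (- y) * cutoff p q (exp (- y)) = max 0 (min 1 ((q - y) / (q - p)))" if "y \<le> q"
    using that by (simp add: cutoff_def max_absorb1)
  have eq0: "exp (- y) * cutoff p q (exp (- y)) = 0" if "y \<ge> q"
    using that by (simp add: cutoff_def max_absorb2)
  show "0 \<le> exp (- y) * cutoff p q (exp (- y))" "exp (- y) * cutoff p q (exp (- y)) \<le> 1"
    by (cases "y \<le> q"; simp add: eq eq0)+
  show "exp (- y) * cutoff p q (exp (- y)) = 1" if "y \<le> p"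
    using that assms by (subst eq) (auto simp: min_def max_def field_simps)
  show "exp (- y) * cutoff p q (exp (- y)) = 0" if "y > q" using that by (intro eq0) simp
qed

text \<open>The factor \<open>1 / x\<close> in \<open>cutoff\<close> cancels the exponential weight.
  Hence an index with \<open>k / n <= p\<close> contributes \<open>b k\<close> in full, one with
  \<open>k / n > q\<close> nothing, and the others a fraction.\<close>

lemma laplace_avg_cutoff:
  assumes b: "\<And>k. 0 \<le> b k \<and> b k \<le> 1" "b 0 > 0" and pq: "0 < p" "p < q" and n: "n \<ge> 1"
  shows "(\<Sum>k\<le>nat \<lfloor>real n * p\<rfloor>. b k) / laplace b (1 / real n) \<le> laplace_avg b (1 / real n) (cutoff p q)"
    and "laplace_avg b (1 / real n) (cutoff p q) \<le> (\<Sum>k\<le>nat \<lfloor>real n * q\<rfloor>. b k) / laplace b (1 / real n)"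
proof -
  let ?s = "1 / real n"
  let ?h = "\<lambda>k. b k * exp (- (real k * ?s)) * cutoff p q (exp (- (real k * ?s)))"
  have s: "?s > 0" using n by simp
  have pos: "laplace b ?s > 0" by (rule laplace_pos[where b = b, OF b(1) s b(2)])
  have sm: "summable ?h" by (intro laplace_avg_summable b s continuous_cutoff pq)
  have le: "k \<le> nat \<lfloor>real n * r\<rfloor> \<longleftrightarrow> real k * ?s \<le> r" if "r > 0" for k r
    using that n by (simp add: le_nat_iff le_floor_iff field_simps)
  have "(\<Sum>k\<le>nat \<lfloor>real n * p\<rfloor>. b k) = (\<Sum>k\<le>nat \<lfloor>real n * p\<rfloor>. ?h k)"
    using cutoff_exp(3)[OF pq(2)] le[OF pq(1)] by (intro sum.cong) (auto simp: mult.assoc)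
  also have "\<dots> \<le> suminf ?h"
    using b(1) cutoff_exp(1)[OF pq(2)] by (intro sum_le_suminf sm) (auto simp: mult.assoc)
  finally show "(\<Sum>k\<le>nat \<lfloor>real n * p\<rfloor>. b k) / laplace b ?s \<le> laplace_avg b ?s (cutoff p q)"
    unfolding laplace_avg_def using pos by (intro divide_right_mono) auto
  have q0: "q > 0" using pq by simp
  have "suminf ?h = (\<Sum>k\<le>nat \<lfloor>real n * q\<rfloor>. ?h k)"
    using cutoff_exp(4)[OF pq(2)] le[OF q0] by (intro suminf_finite) (auto simp: mult.assoc not_le)
  also have "\<dots> \<le> (\<Sum>k\<le>nat \<lfloor>real n * q\<rfloor>. b k)"
    using b(1) cutoff_exp(2)[OF pq(2)] by (intro sum_mono) (auto simp: mult.assoc intro!: mult_left_le)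
  finally show "laplace_avg b ?s (cutoff p q) \<le> (\<Sum>k\<le>nat \<lfloor>real n * q\<rfloor>. b k) / laplace b ?s"
    unfolding laplace_avg_def using pos by (intro divide_right_mono) auto
qed

text \<open>The Tauberian half, obtained by comparison with a sequence \<open>c\<close> whose partial sums are known.\<close>

lemma karamata_tauberian:
  assumes u: "\<And>k. 0 \<le> u k \<and> u k \<le> 1" "u 0 > 0" and c: "\<And>k. 0 \<le> c k \<and> c k \<le> 1" "c 0 > 0"
    and lim_u: "\<And>j. j \<ge> 1 \<Longrightarrow> (\<lambda>n. laplace u (real j / real n) / laplace u (1 / real n)) \<longlonglongrightarrow> m j"
    and lim_c: "\<And>j. j \<ge> 1 \<Longrightarrow> (\<lambda>n. laplace c (real j / real n) / laplace c (1 / real n)) \<longlonglongrightarrow> m j"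
    and C: "\<And>y. y > 0 \<Longrightarrow> (\<lambda>n. (\<Sum>k\<le>nat \<lfloor>real n * y\<rfloor>. c k) / laplace c (1 / real n)) \<longlonglongrightarrow> y powr \<rho> * \<kappa>"
  shows "(\<lambda>n. (\<Sum>k\<le>n. u k) / laplace u (1 / real n)) \<longlonglongrightarrow> \<kappa>"
proof (rule LIMSEQ_I)
  fix e :: real assume e: "e > 0"
  have "((\<lambda>y::real. y powr \<rho> * \<kappa>) \<longlongrightarrow> 1 powr \<rho> * \<kappa>) (at 1)"
    by (intro tendsto_intros) auto
  from tendstoD[OF this, of "e/2"] obtain r where r: "r > 0"
    "\<And>y. y \<noteq> 1 \<Longrightarrow> dist y 1 < r \<Longrightarrow> dist (y powr \<rho> * \<kappa>) \<kappa> < e/2"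
    using e by (auto simp: eventually_at)
  \<comment> \<open>\<open>r\<close> comes from continuity of
    \<open>y powr \<rho> * \<kappa>\<close> at 1; the bound \<open>1/2\<close> keeps
    \<open>1 - d\<close> positive.\<close>
  define d where "d = min (r/2) (1/2)"
  have d: "d > 0" "d < r" "d < 1" using r(1) by (auto simp: d_def)
  have lo: "\<bar>(1 - d) powr \<rho> * \<kappa> - \<kappa>\<bar> < e/2" and hi: "\<bar>(1 + d) powr \<rho> * \<kappa> - \<kappa>\<bar> < e/2"
    using r(2)[of "1 - d"] r(2)[of "1 + d"] d by (auto simp: dist_real_def)
  let ?D = "\<lambda>f n. laplace_avg u (1 / real n) f - laplace_avg c (1 / real n) f"
  \<comment> \<open>The cut-off between \<open>1 - d\<close> and 1 lies below the indicator of
    \<open>y <= 1\<close>, the one between 1 and \<open>1 + d\<close> above it.\<close>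
  have 1: "(\<lambda>n. ?D (cutoff (1 - d) 1) n + (\<Sum>k\<le>nat \<lfloor>real n * (1 - d)\<rfloor>. c k) / laplace c (1 / real n)) \<longlonglongrightarrow> 0 + (1 - d) powr \<rho> * \<kappa>"
    using d by (intro tendsto_add C laplace_avg_compare[OF u c lim_u lim_c] continuous_cutoff) auto
  have 2: "(\<lambda>n. ?D (cutoff 1 (1 + d)) n + (\<Sum>k\<le>nat \<lfloor>real n * (1 + d)\<rfloor>. c k) / laplace c (1 / real n)) \<longlonglongrightarrow> 0 + (1 + d) powr \<rho> * \<kappa>"
    using d by (intro tendsto_add C laplace_avg_compare[OF u c lim_u lim_c] continuous_cutoff) auto
  have lo': "\<kappa> - e < 0 + (1 - d) powr \<rho> * \<kappa>" and hi': "0 + (1 + d) powr \<rho> * \<kappa> < \<kappa> + e"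
    using lo hi e by linarith+
  have "\<forall>\<^sub>F n in sequentially. norm ((\<Sum>k\<le>n. u k) / laplace u (1 / real n) - \<kappa>) < e"
    using order_tendstoD(1)[OF 1 lo'] order_tendstoD(2)[OF 2 hi'] eventually_ge_at_top[of 1]
  proof eventually_elim
    case (elim n)
    have "laplace_avg u (1 / real n) (cutoff (1 - d) 1) \<le> (\<Sum>k\<le>n. u k) / laplace u (1 / real n)"
      using laplace_avg_cutoff(2)[where b = u and p = "1 - d" and q = 1 and n = n, OF u] d elim(3) by simp
    moreover have "(\<Sum>k\<le>n. u k) / laplace u (1 / real n) \<le> laplace_avg u (1 / real n) (cutoff 1 (1 + d))"
      using laplace_avg_cutoff(1)[where b = u and p = 1 and q = "1 + d" and n = n, OF u] d elim(3) by simp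
    moreover have "(\<Sum>k\<le>nat \<lfloor>real n * (1 - d)\<rfloor>. c k) / laplace c (1 / real n) \<le> laplace_avg c (1 / real n) (cutoff (1 - d) 1)"
      using laplace_avg_cutoff(1)[where b = c and p = "1 - d" and q = 1 and n = n, OF c] d elim(3) by simp
    moreover have "laplace_avg c (1 / real n) (cutoff 1 (1 + d)) \<le> (\<Sum>k\<le>nat \<lfloor>real n * (1 + d)\<rfloor>. c k) / laplace c (1 / real n)"
      using laplace_avg_cutoff(2)[where b = c and p = 1 and q = "1 + d" and n = n, OF c] d elim(3) by simp
    ultimately show ?case using elim(1,2) by (simp add: abs_less_iff)
  qed
  then show "\<exists>no. \<forall>n\<ge>no. norm ((\<Sum>k\<le>n. u k) / laplace u (1 / real n) - \<kappa>) < e"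
    by (simp add: eventually_sequentially)
qed

section \<open>The weak renewal law\<close>

text \<open>The form in which expansiveness is used: regular variation of \<open>t\<close> along
  integer dilations, with no slowly varying function left in view.\<close>

locale rv_partition = partition +
  fixes \<theta> :: real
  assumes theta: "0 \<le> \<theta>" "\<theta> \<le> 1"
    and t_rv: "m \<ge> 1 \<Longrightarrow> (\<lambda>n. t (m * n) / t n) \<longlonglongrightarrow> real m powr (- \<theta>)"
begin

lemma mult_at_top: "m \<ge> 1 \<Longrightarrow> filterlim (\<lambda>n::nat. m * n) at_top sequentially"
  by (simp add: mult_nat_left_at_top)

text \<open>If \<open>\<theta> < 1\<close> then eventually \<open>2 * t (2 * n) > t n\<close>, so
  \<open>2 ^ k * t (2 ^ k * M)\<close> stays above \<open>t M\<close>. For a convergent series,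
  however, the dyadic blocks \<open>T (2 * n) - T n\<close>, which dominate
  \<open>n * t (2 * n)\<close>, tend to 0.\<close>

lemma finite_type_imp_theta:
  assumes "finite_type a"
  shows "\<theta> = 1"
proof (rule ccontr)
  assume "\<theta> \<noteq> 1"
  with theta have th: "\<theta> < 1" by simp
  have "(2::real) powr (-1) < 2 powr (- \<theta>)" using th by (intro powr_less_mono) auto
  then have "\<forall>\<^sub>F n in sequentially. t (2 * n) / t n > 1/2"
    using t_rv[of 2] by (intro order_tendstoD(1)) (auto simp: powr_minus)
  then obtain N where N: "\<And>n. n \<ge> N \<Longrightarrow> t (2 * n) / t n > 1/2" by (auto simp: eventually_sequentially)
  define M where "M = Suc N"
  have ge: "2 ^ k * t (2 ^ k * M) \<ge> t M" for k
  proof (induction k)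
    case (Suc k)
    have "1 * M \<le> 2 ^ k * M" by (rule mult_le_mono1) simp
    then have 1: "2 ^ k * M \<ge> N" "2 ^ k * M \<ge> 1" by (simp_all add: M_def)
    then have "t (2 ^ k * M) \<le> 2 * t (2 * (2 ^ k * M))"
      using N[OF 1(1)] t_pos[OF 1(2)] by (simp add: field_simps)
    then have "2 ^ k * t (2 ^ k * M) \<le> 2 ^ k * (2 * t (2 * (2 ^ k * M)))" by (intro mult_left_mono) auto
    moreover have "2 ^ Suc k * t (2 ^ Suc k * M) = 2 ^ k * (2 * t (2 * (2 ^ k * M)))" by (simp add: mult_ac)
    ultimately show ?case using Suc by linarith
  qed simp
  note lim = T_lim_finite[OF assms]
  have "(\<lambda>n. T (2 * n) - T n) \<longlonglongrightarrow> 0"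
    using tendsto_diff[OF filterlim_compose[OF lim mult_at_top[of 2]] lim] by simp
  moreover have "t M / 2 > 0" using t_pos[of M] by (simp add: M_def)
  ultimately have "\<forall>\<^sub>F n in sequentially. T (2 * n) - T n < t M / 2"
    by (rule order_tendstoD(2))
  then obtain K where K: "\<And>n. n \<ge> K \<Longrightarrow> T (2 * n) - T n < t M / 2" by (auto simp: eventually_sequentially)
  have "K < 2 ^ K" by (rule less_exp)
  moreover have "2 ^ K * 1 \<le> 2 ^ K * M" unfolding M_def by (intro mult_le_mono2) simp
  ultimately have "2 ^ K * M \<ge> K" by linarith
  from K[OF this] T_double_diff(1)[of "2 ^ K * M"] have less: "real (2 ^ K * M) * t (2 * (2 ^ K * M)) < t M / 2"
    by linarith
  define x where "x = 2 ^ K * t (2 * (2 ^ K * M))"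
  have "0 \<le> t (2 * (2 ^ K * M))" by (rule t_nonneg) (simp add: M_def Suc_le_eq)
  then have "x * 1 \<le> x * real M" unfolding x_def by (intro mult_left_mono) (simp_all add: M_def)
  moreover have "real (2 ^ K * M) * t (2 * (2 ^ K * M)) = x * real M" by (simp add: x_def)
  moreover have "2 ^ Suc K * t (2 ^ Suc K * M) = 2 * x" by (simp add: x_def mult_ac)
  ultimately show False using ge[of "Suc K"] less by linarith
qed

text \<open>For finite type, \<open>\<theta> = 1\<close> and both \<open>T (p * n)\<close> and
  \<open>T n\<close> tend to the same positive limit. Otherwise cut \<open>{1..p*n}\<close> into
  blocks of length \<open>p\<close>: by monotonicity \<open>T (p * n)\<close> differs from
  \<open>p\<close> times the sum of the \<open>t (p * k)\<close> by at most \<open>p\<close>, and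
  \<open>weighted_cesaro\<close> compares that sum with \<open>T n\<close>.\<close>

lemma T_multiple:
  assumes p: "p \<ge> 1"
  shows "(\<lambda>n. T (p * n) / T n) \<longlonglongrightarrow> real p powr (1 - \<theta>)"
proof (cases "finite_type a")
  case True
  let ?S = "\<Sum>k. t (Suc k)"
  have "?S > 0" using True by (intro suminf_pos) (auto simp: finite_type_def t_pos)
  then have "(\<lambda>n. T (p * n) / T n) \<longlonglongrightarrow> ?S / ?S"
    using p by (intro tendsto_divide filterlim_compose[OF T_lim_finite[OF True] mult_at_top] T_lim_finite[OF True]) auto
  then show ?thesis using \<open>?S > 0\<close> p finite_type_imp_theta[OF True] by simp
next
  case False
  let ?R = "\<lambda>n. \<Sum>k=1..n. t (p * k)"
  have step: "T (p * n + p) = T (p * n) + (\<Sum>k=p*n+1..p*n+p. t k)" for n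
    unfolding T_def by (subst sum.union_disjoint[symmetric]) (auto intro!: sum.cong)
  have lower: "real p * ?R n \<le> T (p * n)" for n
  proof (induction n)
    case (Suc n)
    have "(\<Sum>k=p*n+1..p*n+p. t (p * Suc n)) \<le> (\<Sum>k=p*n+1..p*n+p. t k)"
      by (intro sum_mono t_antimono) auto
    then show ?case using Suc step[of n] by (simp add: algebra_simps)
  qed (simp add: T_0)
  have upper: "T (p * Suc n) \<le> real p + real p * ?R n" for n
  proof (induction n)
    case 0
    have "T p \<le> (\<Sum>k=1..p. 1)" unfolding T_def by (intro sum_mono t_le_1) auto
    then show ?case by simp
  next
    case (Suc n)
    have "(\<Sum>k=p*Suc n+1..p*Suc n+p. t k) \<le> (\<Sum>k=p*Suc n+1..p*Suc n+p. t (p * Suc n))"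
      using p by (intro sum_mono t_antimono) (auto intro: Suc_leI)
    then have "T (p * Suc (Suc n)) \<le> T (p * Suc n) + real p * t (p * Suc n)"
      using step[of "Suc n"] by (simp add: algebra_simps)
    with Suc show ?case by (simp add: algebra_simps)
  qed
  have R: "(\<lambda>n. ?R n / T n) \<longlonglongrightarrow> real p powr (- \<theta>)"
    using weighted_cesaro[of t, OF t_pos _ t_rv[OF p]] T_lim_at_top[OF False]
    by (simp add: T_def[abs_def])
  have R': "(\<lambda>n. real p * (?R n / T n)) \<longlonglongrightarrow> real p powr (1 - \<theta>)"
    using tendsto_mult[OF tendsto_const[of "real p"] R] p by (simp add: powr_diff powr_minus divide_inverse)
  have inv: "(\<lambda>n. real p / T n) \<longlonglongrightarrow> 0"
    using T_lim_at_top[OF False] by (intro tendsto_divide_0[OF tendsto_const] filterlim_at_top_imp_at_infinity)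
  show ?thesis
  proof (rule tendsto_sandwich[OF _ _ R'])
    show "(\<lambda>n. real p / T n + real p * (?R n / T n)) \<longlonglongrightarrow> real p powr (1 - \<theta>)"
      using tendsto_add[OF inv R'] by simp
    show "\<forall>\<^sub>F n in sequentially. real p * (?R n / T n) \<le> T (p * n) / T n"
      using eventually_ge_at_top[of 1]
    proof eventually_elim
      case (elim n)
      from divide_right_mono[OF lower[of n] T_nonneg[of n]] show ?case by simp
    qed
    show "\<forall>\<^sub>F n in sequentially. T (p * n) / T n \<le> real p / T n + real p * (?R n / T n)"
      using eventually_ge_at_top[of 1]
    proof eventually_elim
      case (elim n)
      have "T (p * n) \<le> T (p * Suc n)" by (rule T_mono) simp
      then have "T (p * n) \<le> real p + real p * ?R n" using upper[of n] by linarith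
      from divide_right_mono[OF this T_nonneg[of n]] show ?case by (simp add: add_divide_distrib)
    qed
  qed
qed

lemma T_rv: "y > 0 \<Longrightarrow> (\<lambda>n. T (nat \<lfloor>real n * y\<rfloor>) / T n) \<longlonglongrightarrow> y powr (1 - \<theta>)"
  by (rule mono_regularly_varying_real) (auto intro: T_mono T_pos T_multiple)

end

section \<open>Laplace sums of the tails and of the renewal sequence\<close>

context partition begin

text \<open>Since \<open>t\<close> decreases, every later block of length \<open>n\<close>
  contributes at most the first one. Through \<open>T_floor_le\<close> this is the linear majorant,
  with \<open>D = 1\<close>, required by \<open>karamata_abelian\<close>.\<close>

lemma T_mult_le: "T (j * n) \<le> real j * T n"
proof (induction j)
  case (Suc j)
  have "T (j * n + n) = T (j * n) + (\<Sum>k=1..n. t (j * n + k))"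
  proof -
    have "T (j * n + n) = T (j * n) + (\<Sum>k=j*n+1..j*n+n. t k)"
      unfolding T_def by (subst sum.union_disjoint[symmetric]) (auto intro!: sum.cong)
    also have "(\<Sum>k=j*n+1..j*n+n. t k) = (\<Sum>k=1..n. t (j * n + k))"
      by (rule sum.reindex_bij_witness[of _ "\<lambda>k. j * n + k" "\<lambda>k. k - j * n"]) auto
    finally show ?thesis .
  qed
  also have "(\<Sum>k=1..n. t (j * n + k)) \<le> T n"
    unfolding T_def by (intro sum_mono t_antimono) auto
  finally show ?case using Suc by (simp add: algebra_simps)
qed (simp add: T_0)

lemma T_floor_le:
  assumes "y \<ge> 0"
  shows "T (nat \<lfloor>real n * y\<rfloor>) \<le> (y + 1) * T n"
proof -
  have "real n * y \<le> real n * real_of_int \<lceil>y\<rceil>" by (intro mult_left_mono) auto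
  also have "\<dots> = real_of_int (int (nat \<lceil>y\<rceil> * n))" using assms by simp
  finally have "\<lfloor>real n * y\<rfloor> \<le> int (nat \<lceil>y\<rceil> * n)" by (metis floor_mono floor_of_int)
  then have "nat \<lfloor>real n * y\<rfloor> \<le> nat \<lceil>y\<rceil> * n" by (simp only: nat_le_iff)
  then have "T (nat \<lfloor>real n * y\<rfloor>) \<le> T (nat \<lceil>y\<rceil> * n)" by (rule T_mono)
  also have "\<dots> \<le> real (nat \<lceil>y\<rceil>) * T n" by (rule T_mult_le)
  also have "\<dots> \<le> (y + 1) * T n" using assms
    by (intro mult_right_mono T_nonneg) linarith
  finally show ?thesis .
qed

text \<open>\<open>tail a 0\<close> involves the arbitrary value \<open>a 0\<close>; with 0 in its
  place the partial sums from index 0 are \<open>T\<close>.\<close>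

definition t0 :: "nat \<Rightarrow> real" where "t0 k = (if k = 0 then 0 else t k)"

lemma t0_bounds: "0 \<le> t0 k \<and> t0 k \<le> 1"
  using t_nonneg[of k] t_le_1[of k] by (simp add: t0_def)

lemma sum_t0: "(\<Sum>k\<le>n. t0 k) = T n"
  by (induction n) (auto simp: t0_def T_0 T_Suc)

end

context rv_partition begin

lemma laplace_t0:
  assumes "c > 0"
  shows "(\<lambda>n. laplace t0 (c / real n) / T n) \<longlonglongrightarrow> c powr (- (1 - \<theta>)) * Gamma (2 - \<theta>)"
  using karamata_abelian[of t0 "1 - \<theta>" 1 c, OF t0_bounds] assms theta
  by (simp add: sum_t0 T_pos T_rv T_floor_le)

end

context renewal begin

lemma u_unit: "0 \<le> u k \<and> u k \<le> 1"
  using u_nonneg u_le_1 by simp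

text \<open>By \<open>conv_eq_1'\<close> the Cauchy product of the series of
  \<open>t (Suc k)\<close> and of \<open>u\<close> is the geometric series. The numerator
  \<open>exp (- s)\<close> compensates the index shift between \<open>t (Suc k)\<close> and
  \<open>t0 k\<close>.\<close>

lemma laplace_u:
  assumes s: "s > 0"
  shows "laplace u s = exp (- s) / ((1 - exp (- s)) * laplace t0 s)"
proof -
  let ?z = "exp (- s)"
  have z: "0 < ?z" "?z < 1" using s by auto
  have su: "summable (\<lambda>k. u k * ?z ^ k)"
    using laplace_summable[OF u_unit s] by (simp add: exp_neg_mult)
  have st: "summable (\<lambda>k. t0 k * ?z ^ k)"
    using laplace_summable[OF t0_bounds s] by (simp add: exp_neg_mult)
  have st': "summable (\<lambda>k. t (Suc k) * ?z ^ k)"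
  proof (rule summable_comparison_test)
    show "summable (\<lambda>k. ?z ^ k)" using z by (simp add: summable_geometric)
    show "\<exists>N. \<forall>n\<ge>N. norm (t (Suc n) * ?z ^ n) \<le> ?z ^ n"
      using t_nonneg t_le_1 by (auto simp: abs_mult intro!: mult_left_le_one_le)
  qed
  have "(\<lambda>n. \<Sum>i\<le>n. (t (Suc i) * ?z ^ i) * (u (n - i) * ?z ^ (n - i))) sums
      ((\<Sum>k. t (Suc k) * ?z ^ k) * (\<Sum>k. u k * ?z ^ k))"
    using su st' by (intro Cauchy_product_sums) (auto simp: abs_mult t_nonneg u_nonneg)
  moreover have "(\<Sum>i\<le>n. (t (Suc i) * ?z ^ i) * (u (n - i) * ?z ^ (n - i))) = ?z ^ n" for n
  proof -
    have "(\<Sum>i\<le>n. (t (Suc i) * ?z ^ i) * (u (n - i) * ?z ^ (n - i))) = (\<Sum>i\<le>n. t (Suc i) * u (n - i)) * ?z ^ n"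
      unfolding sum_distrib_right
      by (intro sum.cong refl) (simp add: mult_ac power_add[symmetric])
    then show ?thesis by (simp add: conv_eq_1')
  qed
  ultimately have "(\<lambda>n. ?z ^ n) sums ((\<Sum>k. t (Suc k) * ?z ^ k) * laplace u s)"
    by (simp add: laplace_def exp_neg_mult)
  moreover have "(\<lambda>n. ?z ^ n) sums (1 / (1 - ?z))" using z by (intro geometric_sums) auto
  ultimately have prod: "(\<Sum>k. t (Suc k) * ?z ^ k) * laplace u s = 1 / (1 - ?z)"
    by (rule sums_unique2)
  have "laplace t0 s = (\<Sum>k. t0 k * ?z ^ k)" by (simp add: laplace_def exp_neg_mult)
  also have "\<dots> = (\<Sum>k. t0 (Suc k) * ?z ^ Suc k)"
    using suminf_split_head[OF st] by (simp add: t0_def)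
  also have "\<dots> = ?z * (\<Sum>k. t (Suc k) * ?z ^ k)"
    by (subst suminf_mult[OF st', symmetric]) (simp add: t0_def mult_ac)
  finally have l0: "laplace t0 s = ?z * (\<Sum>k. t (Suc k) * ?z ^ k)" .
  have l0p: "laplace t0 s > 0"
    by (rule laplace_pos[where b = t0 and j = 1, OF t0_bounds s]) (simp add: t0_def t_1)
  define q where "q = (\<Sum>k. t (Suc k) * ?z ^ k)"
  have "q > 0" using l0p z unfolding l0 q_def[symmetric] by (simp add: zero_less_mult_iff)
  then have "laplace u s = 1 / (1 - ?z) / q" using prod unfolding q_def[symmetric]
    by (metis less_irrefl nonzero_mult_div_cancel_left)
  also have "\<dots> = ?z / ((1 - ?z) * (?z * q))" using z by simp
  finally show ?thesis unfolding l0 q_def .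
qed

end

text \<open>Write \<open>x powr \<theta>\<close> as \<open>x * x powr (\<theta> - 1)\<close>, where
  the second factor is decreasing. The range from 0 to 1 is what the Laplace lemmas require of a
  coefficient sequence.\<close>

lemma powr_increment_bounds:
  assumes "0 \<le> \<theta>" "\<theta> \<le> 1"
  shows "0 \<le> (real k + 1) powr \<theta> - real k powr \<theta> \<and> (real k + 1) powr \<theta> - real k powr \<theta> \<le> 1"
proof (cases "k = 0")
  case False
  then have k: "real k > 0" by simp
  have e: "x powr \<theta> = x * x powr (\<theta> - 1)" if "x > 0" for x :: real
    using that by (simp add: powr_diff)
  have "(real k + 1) powr (\<theta> - 1) \<le> real k powr (\<theta> - 1)" "(real k + 1) powr (\<theta> - 1) \<le> 1 powr (\<theta> - 1)"
    using assms k by (intro powr_mono2'; simp)+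
  then have "real k * (real k + 1) powr (\<theta> - 1) + (real k + 1) powr (\<theta> - 1) \<le> real k * real k powr (\<theta> - 1) + 1"
    using k by (intro add_mono mult_left_mono) auto
  then have "(real k + 1) powr \<theta> \<le> real k powr \<theta> + 1"
    using e[of "real k"] e[of "real k + 1"] k by (simp add: algebra_simps)
  moreover have "real k powr \<theta> \<le> (real k + 1) powr \<theta>" using assms by (intro powr_mono2) auto
  ultimately show ?thesis by simp
qed simp

text \<open>The comparison sequence for the Tauberian argument; \<open>0 powr 0 = 0\<close> makes it the unit mass
  at 0 when \<open>\<theta> = 0\<close>.\<close>

definition powr_increment :: "real \<Rightarrow> nat \<Rightarrow> real" where
  "powr_increment \<theta> k = (real k + 1) powr \<theta> - real k powr \<theta>"

lemma sum_powr_increment: "(\<Sum>k\<le>n. powr_increment \<theta> k) = (real n + 1) powr \<theta>"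
  by (induction n) (auto simp: powr_increment_def add.commute)

lemma floor_ratio_lim:
  assumes "y > 0"
  shows "(\<lambda>n. (real (nat \<lfloor>real n * y\<rfloor>) + 1) / (real n + 1)) \<longlonglongrightarrow> y"
proof (rule tendsto_sandwich)
  show "(\<lambda>n. (real n * y) / (real n + 1)) \<longlonglongrightarrow> y" "(\<lambda>n. (real n * y + 1) / (real n + 1)) \<longlonglongrightarrow> y"
    by real_asymp+
  have fl: "real n * y \<le> real (nat \<lfloor>real n * y\<rfloor>) + 1" "real (nat \<lfloor>real n * y\<rfloor>) \<le> real n * y" for n
    using assms by (linarith, simp)
  show "\<forall>\<^sub>F n in sequentially. real n * y / (real n + 1) \<le> (real (nat \<lfloor>real n * y\<rfloor>) + 1) / (real n + 1)"
    using fl(1) by (intro always_eventually allI divide_right_mono) auto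
  show "\<forall>\<^sub>F n in sequentially. (real (nat \<lfloor>real n * y\<rfloor>) + 1) / (real n + 1) \<le> (real n * y + 1) / (real n + 1)"
    using fl(2) by (intro always_eventually allI divide_right_mono) auto
qed

lemma laplace_powr_increment:
  assumes th: "0 \<le> \<theta>" "\<theta> \<le> 1" and c: "c > 0"
  shows "(\<lambda>n. laplace (powr_increment \<theta>) (c / real n) / (real n + 1) powr \<theta>) \<longlonglongrightarrow> c powr (- \<theta>) * Gamma (1 + \<theta>)"
proof -
  have rv: "(\<lambda>n. (real (nat \<lfloor>real n * y\<rfloor>) + 1) powr \<theta> / (real n + 1) powr \<theta>) \<longlonglongrightarrow> y powr \<theta>" if "y > 0" for y
    using tendsto_powr[OF floor_ratio_lim[OF that] tendsto_const[of \<theta>]] that by (simp add: powr_divide)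
  have dom: "(real (nat \<lfloor>real n * y\<rfloor>) + 1) powr \<theta> \<le> 1 * (y + 1) * (real n + 1) powr \<theta>" if "y \<ge> 0" for n y
  proof -
    have "real (nat \<lfloor>real n * y\<rfloor>) \<le> real n * y" using that by simp
    moreover have "real n * y + 1 \<le> (y + 1) * (real n + 1)" using that by (simp add: algebra_simps)
    ultimately have "real (nat \<lfloor>real n * y\<rfloor>) + 1 \<le> (y + 1) * (real n + 1)" by linarith
    then have "(real (nat \<lfloor>real n * y\<rfloor>) + 1) powr \<theta> \<le> ((y + 1) * (real n + 1)) powr \<theta>"
      using th by (intro powr_mono2) auto
    also have "\<dots> = (y + 1) powr \<theta> * (real n + 1) powr \<theta>" using that by (simp add: powr_mult)
    also have "(y + 1) powr \<theta> \<le> (y + 1) powr 1" using th that by (intro powr_mono) auto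
    finally show ?thesis using that by (simp add: mult_right_mono)
  qed
  show ?thesis
    using karamata_abelian[of "powr_increment \<theta>" \<theta> 1 c] powr_increment_bounds[OF th] rv dom th c
    by (simp add: sum_powr_increment powr_increment_def[symmetric])
qed

locale rv_renewal = rv_partition a \<theta> + renewal a u for a u \<theta>
begin

lemma Gamma_pos: "Gamma (2 - \<theta>) > 0" "Gamma (1 + \<theta>) > 0"
  using theta by (auto intro!: Gamma_real_pos)

text \<open>In the quotient of two instances of \<open>laplace_u\<close> the prefactors contribute
  \<open>1 / j\<close> and the Laplace sums of \<open>t0\<close> contribute
  \<open>j powr (1 - \<theta>)\<close>; \<open>T n\<close> and the Gamma value cancel.\<close>

lemma laplace_u_ratio:
  assumes j: "j \<ge> 1"
  shows "(\<lambda>n. laplace u (real j / real n) / laplace u (1 / real n)) \<longlonglongrightarrow> real j powr (- \<theta>)"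
proof -
  have j0: "real j > 0" using j by simp
  define e where "e n = exp (- (real j / real n)) / exp (- (1 / real n)) * ((1 - exp (- (1 / real n))) / (1 - exp (- (real j / real n))))" for n
  have "e \<longlonglongrightarrow> inverse (real j)" unfolding e_def using j0 by real_asymp
  then have e: "e \<longlonglongrightarrow> 1 / real j" by (simp add: inverse_eq_divide)
  have "(\<lambda>n. (laplace t0 (1 / real n) / T n) / (laplace t0 (real j / real n) / T n)) \<longlonglongrightarrow>
     (1 powr (- (1 - \<theta>)) * Gamma (2 - \<theta>)) / (real j powr (- (1 - \<theta>)) * Gamma (2 - \<theta>))"
    using j0 Gamma_pos by (intro tendsto_divide laplace_t0) auto
  then have lim: "(\<lambda>n. e n * ((laplace t0 (1 / real n) / T n) / (laplace t0 (real j / real n) / T n))) \<longlonglongrightarrow>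
     1 / real j * ((1 powr (- (1 - \<theta>)) * Gamma (2 - \<theta>)) / (real j powr (- (1 - \<theta>)) * Gamma (2 - \<theta>)))"
    by (intro tendsto_mult e)
  have "1 / real j * ((1 powr (- (1 - \<theta>)) * Gamma (2 - \<theta>)) / (real j powr (- (1 - \<theta>)) * Gamma (2 - \<theta>))) = real j powr (- \<theta>)"
  proof -
    have "1 / real j * ((1 powr (- (1 - \<theta>)) * Gamma (2 - \<theta>)) / (real j powr (- (1 - \<theta>)) * Gamma (2 - \<theta>)))
      = real j powr (-1) * real j powr (1 - \<theta>)"
    proof -
      have "(1 powr (- \<rho>) * G) / (real j powr (- \<rho>) * G) = real j powr \<rho>" if "G > 0" for \<rho> G :: real
        using j0 that by (simp add: powr_minus inverse_eq_divide)
      from this[OF Gamma_pos(1)] show ?thesis using j0 by (simp only: powr_minus_divide powr_one)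
    qed
    also have "\<dots> = real j powr (- \<theta>)" by (simp only: powr_add[symmetric]) simp
    finally show ?thesis .
  qed
  moreover have "\<forall>\<^sub>F n in sequentially. e n * ((laplace t0 (1 / real n) / T n) / (laplace t0 (real j / real n) / T n))
     = laplace u (real j / real n) / laplace u (1 / real n)"
    using eventually_ge_at_top[of 1]
  proof eventually_elim
    case (elim n)
    have s: "real j / real n > 0" "1 / real n > 0" using j0 elim by auto
    have "laplace t0 (real j / real n) > 0" "laplace t0 (1 / real n) > 0"
      by (rule laplace_pos[where b = t0 and j = 1, OF t0_bounds]; use s in \<open>simp add: t0_def t_1\<close>)+
    then show ?case using s T_pos[OF elim]
      unfolding laplace_u[OF s(1)] laplace_u[OF s(2)] e_def by (simp add: field_simps)
  qed
  ultimately show ?thesis using Lim_transform_eventually[OF lim] by simp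
qed

text \<open>The increments of \<open>k powr \<theta>\<close> have the same limiting Laplace ratios
  \<open>j powr (- \<theta>)\<close> as \<open>u\<close>, and their partial sums are explicit, so
  \<open>karamata_tauberian\<close> transfers the constant.\<close>

lemma U_laplace: "(\<lambda>n. U n / laplace u (1 / real n)) \<longlonglongrightarrow> 1 / Gamma (1 + \<theta>)"
proof -
  let ?c = "powr_increment \<theta>"
  have cb: "0 \<le> ?c k \<and> ?c k \<le> 1" for k
    using powr_increment_bounds[OF theta] by (simp add: powr_increment_def)
  have c0: "?c 0 > 0" by (simp add: powr_increment_def)
  have lapc: "laplace ?c (1 / real n) > 0" if "n \<ge> 1" for n
    by (rule laplace_pos[where b = ?c and j = 0, OF cb]) (use c0 that in auto)
  have ratio: "(\<lambda>n. laplace ?c (real j / real n) / laplace ?c (1 / real n)) \<longlonglongrightarrow> real j powr (- \<theta>)" if "j \<ge> 1" for j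
  proof -
    have "(\<lambda>n. (laplace ?c (real j / real n) / (real n + 1) powr \<theta>) / (laplace ?c (1 / real n) / (real n + 1) powr \<theta>)) \<longlonglongrightarrow>
      (real j powr (- \<theta>) * Gamma (1 + \<theta>)) / (1 powr (- \<theta>) * Gamma (1 + \<theta>))"
      using that Gamma_pos by (intro tendsto_divide laplace_powr_increment theta) auto
    then show ?thesis using Gamma_pos by simp
  qed
  have C: "(\<lambda>n. (\<Sum>k\<le>nat \<lfloor>real n * y\<rfloor>. ?c k) / laplace ?c (1 / real n)) \<longlonglongrightarrow> y powr \<theta> * (1 / Gamma (1 + \<theta>))" if "y > 0" for y
  proof -
    have "(\<lambda>n. ((real (nat \<lfloor>real n * y\<rfloor>) + 1) / (real n + 1)) powr \<theta> / (laplace ?c (1 / real n) / (real n + 1) powr \<theta>)) \<longlonglongrightarrow>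
        y powr \<theta> / (1 powr (- \<theta>) * Gamma (1 + \<theta>))"
      using that Gamma_pos by (intro tendsto_divide laplace_powr_increment theta tendsto_powr floor_ratio_lim) auto
    then show ?thesis by (simp add: sum_powr_increment powr_divide)
  qed
  have "(\<lambda>n. (\<Sum>k\<le>n. u k) / laplace u (1 / real n)) \<longlonglongrightarrow> 1 / Gamma (1 + \<theta>)"
    by (rule karamata_tauberian[where c = ?c and m = "\<lambda>j. real j powr (- \<theta>)" and \<rho> = \<theta>])
       (use u_unit u_pos cb c0 laplace_u_ratio ratio C in auto)
  then show ?thesis by (simp add: U_def)
qed

text \<open>Multiply \<open>U_laplace\<close> by the value of \<open>laplace u (1 / n)\<close> from
  \<open>laplace_u\<close>; the two Gamma factors come from \<open>U_laplace\<close> and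
  \<open>laplace_t0\<close>, and the elementary factor \<open>e n\<close> tends to 1.\<close>

theorem weak_renewal: "(\<lambda>n. U n * T n / real n) \<longlonglongrightarrow> 1 / (Gamma (2 - \<theta>) * Gamma (1 + \<theta>))"
proof -
  define e where "e n = exp (- (1 / real n)) / (real n * (1 - exp (- (1 / real n))))" for n
  have e: "e \<longlonglongrightarrow> 1" unfolding e_def by real_asymp
  have lim: "(\<lambda>n. U n / laplace u (1 / real n) * (e n / (laplace t0 (1 / real n) / T n))) \<longlonglongrightarrow>
      1 / Gamma (1 + \<theta>) * (1 / (1 powr (- (1 - \<theta>)) * Gamma (2 - \<theta>)))"
    using Gamma_pos by (intro tendsto_mult tendsto_divide U_laplace e laplace_t0) auto
  have "\<forall>\<^sub>F n in sequentially. U n / laplace u (1 / real n) * (e n / (laplace t0 (1 / real n) / T n)) = U n * T n / real n"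
    using eventually_ge_at_top[of 1]
  proof eventually_elim
    case (elim n)
    have s: "1 / real n > 0" using elim by auto
    have "laplace t0 (1 / real n) > 0"
      by (rule laplace_pos[where b = t0 and j = 1, OF t0_bounds]; use s in \<open>simp add: t0_def t_1\<close>)
    then show ?case using s elim T_pos[OF elim]
      unfolding laplace_u[OF s] e_def by (simp add: field_simps)
  qed
  from Lim_transform_eventually[OF lim this] show ?thesis by (simp add: mult.commute)
qed

end

section \<open>Lower bounds on circles\<close>

context partition begin

text \<open>The arbitrary value \<open>a 0\<close> must not enter the generating function as a
  constant term.\<close>

definition a0 :: "nat \<Rightarrow> real" where "a0 k = (if k = 0 then 0 else a k)"

lemma a0_nonneg: "a0 k \<ge> 0"
  using a_nonneg[of k] by (simp add: a0_def)

lemma a0_sums_tail: "(\<lambda>k. a0 k * of_bool (n < k)) sums t (Suc n)"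
proof -
  have "(\<lambda>k. a (k + Suc n)) sums t (Suc n)"
    unfolding tail_def using summable_a by (rule summable_sums)
  then have "(\<lambda>k. a0 (k + Suc n) * of_bool (n < k + Suc n)) sums t (Suc n)"
    by (simp add: a0_def)
  then show ?thesis by (subst (asm) sums_iff_shift) simp
qed

lemma a0_sums_1: "a0 sums 1"
proof -
  have "(\<lambda>k. a0 k * of_bool (0 < k)) = a0" by (auto simp: a0_def)
  then show ?thesis using a0_sums_tail[of 0] by (simp add: t_1)
qed

lemma a0_le_1: "a0 k \<le> 1"
  using sum_le_suminf[of a0 "{k}"] a0_sums_1 a0_nonneg by (auto simp: sums_iff)

text \<open>\<open>T n\<close> is the mean of the waiting time truncated at \<open>n\<close>: the
  expectation of \<open>min k n\<close> is the sum of the first \<open>n\<close> tail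
  probabilities.\<close>

lemma a0_min_sums: "(\<lambda>k. a0 k * real (min k n)) sums T n"
proof (induction n)
  case (Suc n)
  have "a0 k * real (min k n) + a0 k * of_bool (n < k) = a0 k * real (min k (Suc n))" for k
    by (cases "k \<le> n"; cases "k = Suc n") (auto simp: min_def algebra_simps)
  with sums_add[OF Suc a0_sums_tail[of n]] show ?case by (simp add: T_Suc)
qed (simp add: T_0)

definition A :: "complex \<Rightarrow> complex" where "A z = (\<Sum>k. of_real (a0 k) * z ^ k)"

lemma A_summable: "norm (z::complex) \<le> 1 \<Longrightarrow> summable (\<lambda>k. norm (of_real (a0 k) * z ^ k))"
  using a0_nonneg by (intro summable_comparison_test'[OF sums_summable[OF a0_sums_1], of 0])
    (auto simp: norm_mult norm_power intro!: mult_left_le power_le_one)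

lemma one_minus_A_sums:
  assumes "norm z \<le> 1"
  shows "(\<lambda>k. of_real (a0 k) * (1 - z ^ k)) sums (1 - A z)"
proof -
  have "(\<lambda>k. of_real (a0 k) :: complex) sums of_real 1" by (rule sums_of_real[OF a0_sums_1])
  moreover have "(\<lambda>k. of_real (a0 k) * z ^ k) sums A z"
    unfolding A_def using summable_norm_cancel[OF A_summable[OF assms]] by (rule summable_sums)
  ultimately show ?thesis using sums_diff by (fastforce simp: right_diff_distrib)
qed

lemma Re_one_minus_A_sums:
  assumes "0 \<le> r" "r \<le> 1"
  shows "(\<lambda>k. a0 k * (1 - r ^ k * cos (real k * x))) sums Re (1 - A (of_real r * cis x))"
  using sums_Re[OF one_minus_A_sums[of "of_real r * cis x"]] assms
  by (simp add: norm_mult power_mult_distrib cos_n_Re_cis_pow_n flip: of_real_power)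

text \<open>The real part of \<open>1 - A\<close> is a series of nonnegative terms, so any termwise
  minorant gives a lower bound. The next three bounds on circles differ only in which terms they
  retain.\<close>

lemma norm_one_minus_A_ge:
  assumes r: "0 \<le> r" "r \<le> 1" and g: "g sums s" "\<And>k. g k \<le> a0 k * (1 - r ^ k * cos (real k * x))"
  shows "s \<le> norm (1 - A (of_real r * cis x))"
proof -
  have "s \<le> Re (1 - A (of_real r * cis x))"
    by (rule sums_le[OF g(2) g(1) Re_one_minus_A_sums[OF r]])
  also have "\<dots> \<le> norm (1 - A (of_real r * cis x))" by (rule complex_Re_le_cmod)
  finally show ?thesis .
qed

lemma one_minus_exp_ge:
  assumes "y \<ge> (0::real)"
  shows "min y 1 / 2 \<le> 1 - exp (- y)"
proof -
  have "exp (- y) \<le> 1 / (1 + y)"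
    using exp_ge_add_one_self[of y] assms by (simp add: exp_minus field_simps)
  then have "y / (1 + y) \<le> 1 - exp (- y)" using assms by (simp add: field_simps)
  moreover have "min y 1 / 2 \<le> y / (1 + y)"
    using assms by (auto simp: min_def field_simps mult_left_le)
  ultimately show ?thesis by linarith
qed

text \<open>Replacing the cosine by 1 reduces to the point \<open>x = 0\<close>, where
  \<open>1 - exp (- (k / n))\<close> is at least half of \<open>min (k / n) 1\<close>. The bound is
  independent of \<open>x\<close> and is of the right order for
  \<open>\<bar>x\<bar> <= 1 / n\<close>.\<close>

lemma norm_one_minus_A_ge_T:
  assumes n: "n \<ge> 1"
  shows "T n / (2 * real n) \<le> norm (1 - A (of_real (exp (- (1 / real n))) * cis x))"
proof (rule norm_one_minus_A_ge)
  show "(\<lambda>k. a0 k * real (min k n) * (1 / (2 * real n))) sums (T n / (2 * real n))"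
    using sums_mult2[OF a0_min_sums, of n "1 / (2 * real n)"] by simp
  fix k
  let ?r = "exp (- (1 / real n))"
  have "real (min k n) * (1 / (2 * real n)) = min (real k / real n) 1 / 2"
    using n by (auto simp: min_def field_simps)
  also have "\<dots> \<le> 1 - exp (- (real k / real n))" by (rule one_minus_exp_ge) simp
  also have "exp (- (real k / real n)) = ?r ^ k" by (simp add: exp_of_nat_mult[symmetric])
  also have "1 - ?r ^ k \<le> 1 - ?r ^ k * cos (real k * x)"
    by (simp add: mult_left_le)
  finally show "a0 k * real (min k n) * (1 / (2 * real n)) \<le> a0 k * (1 - ?r ^ k * cos (real k * x))"
    using a0_nonneg[of k] by (simp only: mult.assoc mult_left_mono)
qed auto

text \<open>This removes the radius uniformly: for nonnegative cosine the worst case is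
  \<open>r = 1\<close>, and for negative cosine the right side is at least 1.\<close>

lemma one_minus_mult_cos_ge:
  assumes "0 \<le> r" "r \<le> (1::real)"
  shows "(1 - cos y) / 2 \<le> 1 - r * cos y"
proof (cases "cos y \<ge> 0")
  case True
  then have "r * cos y \<le> cos y" using assms by (simp add: mult_left_le_one_le)
  moreover have "(1 - c) / 2 \<le> 1 - d" if "d \<le> c" "c \<le> 1" for c d :: real
    using that by simp
  ultimately show ?thesis using cos_le_one by blast
next
  case False
  then have "r * cos y \<le> 0" using assms by (simp add: mult_nonneg_nonpos)
  moreover have "(1 - c) / 2 \<le> 1 - d" if "d \<le> 0" "- 1 \<le> c" for c d :: real
    using that by simp
  ultimately show ?thesis using cos_ge_minus_one by blast
qed

text \<open>For \<open>k\<close> in \<open>{N..<2*N}\<close> the phase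
  \<open>k * \<bar>x\<bar>\<close> lies between 1 and 3, hence below pi, so its cosine is at most
  \<open>cos 1\<close>; the retained coefficients sum to \<open>t N - t (2 * N)\<close>.\<close>

lemma norm_one_minus_A_ge_window:
  assumes r: "0 \<le> r" "r \<le> 1" and N: "N \<ge> 1" and x: "1 \<le> real N * \<bar>x\<bar>" "2 * real N * \<bar>x\<bar> \<le> 3"
  shows "(1 - cos 1) / 2 * (t N - t (2 * N)) \<le> norm (1 - A (of_real r * cis x))"
proof (rule norm_one_minus_A_ge[OF r])
  have "(\<lambda>k. if k \<in> {N..<2*N} then a0 k * ((1 - cos 1) / 2) else 0) sums (\<Sum>k=N..<2*N. a0 k * ((1 - cos 1) / 2))"
    by (rule sums_If_finite_set) simp
  also have "(\<Sum>k=N..<2*N. a0 k * ((1 - cos 1) / 2)) = (\<Sum>k=N..<2*N. a k) * ((1 - cos 1) / 2)"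
    unfolding sum_distrib_right using N by (intro sum.cong) (auto simp: a0_def)
  also have "\<dots> = (1 - cos 1) / 2 * (t N - t (2 * N))"
    using sum_a_eq[of N "2 * N"] N by simp
  finally show "(\<lambda>k. if k \<in> {N..<2*N} then a0 k * ((1 - cos 1) / 2) else 0) sums ((1 - cos 1) / 2 * (t N - t (2 * N)))" .
  fix k
  have rk: "0 \<le> r ^ k" "r ^ k \<le> 1" using r by (auto simp: power_le_one)
  have b: "(1 - cos (real k * x)) / 2 \<le> 1 - r ^ k * cos (real k * x)"
    by (rule one_minus_mult_cos_ge[OF rk])
  show "(if k \<in> {N..<2*N} then a0 k * ((1 - cos 1) / 2) else 0) \<le> a0 k * (1 - r ^ k * cos (real k * x))"
  proof (cases "k \<in> {N..<2*N}")
    case True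
    have "real N * \<bar>x\<bar> \<le> real k * \<bar>x\<bar>" "real k * \<bar>x\<bar> \<le> 2 * real N * \<bar>x\<bar>"
      using True by (auto intro!: mult_right_mono)
    then have "1 \<le> real k * \<bar>x\<bar>" "real k * \<bar>x\<bar> \<le> 3" using x by linarith+
    then have "cos (real k * \<bar>x\<bar>) \<le> cos 1" using pi_gt3 by (intro cos_monotone_0_pi_le) auto
    moreover have "cos (real k * \<bar>x\<bar>) = cos (real k * x)" by (simp add: abs_if)
    ultimately have "(1 - cos 1) / 2 \<le> 1 - r ^ k * cos (real k * x)" using b by simp
    then show ?thesis using True a0_nonneg[of k] by (simp only: if_True mult_left_mono)
  next
    case False
    have "0 \<le> (1 - cos (real k * x)) / 2" by simp
    then have "0 \<le> 1 - r ^ k * cos (real k * x)" using b by (rule order.trans)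
    then show ?thesis unfolding if_not_P[OF False] using a0_nonneg[of k] by simp
  qed
qed

text \<open>Away from the point 1 the single term \<open>k = 1\<close> suffices:
  \<open>a 1 > 0\<close> excludes periodicity.\<close>

lemma norm_one_minus_A_ge_far:
  assumes r: "0 \<le> r" "r \<le> 1" and x: "0 \<le> \<eta>" "\<eta> \<le> \<bar>x\<bar>" "\<bar>x\<bar> \<le> pi"
  shows "a 1 * ((1 - cos \<eta>) / 2) \<le> norm (1 - A (of_real r * cis x))"
proof (rule norm_one_minus_A_ge[OF r])
  show "(\<lambda>k. if k = 1 then a 1 * ((1 - cos \<eta>) / 2) else 0) sums (a 1 * ((1 - cos \<eta>) / 2))"
    by (rule sums_single)
  fix k
  have rk: "0 \<le> r ^ k" "r ^ k \<le> 1" using r by (auto simp: power_le_one)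
  have b: "(1 - cos (real k * x)) / 2 \<le> 1 - r ^ k * cos (real k * x)"
    by (rule one_minus_mult_cos_ge[OF rk])
  show "(if k = 1 then a 1 * ((1 - cos \<eta>) / 2) else 0) \<le> a0 k * (1 - r ^ k * cos (real k * x))"
  proof (cases "k = 1")
    case True
    have "cos \<bar>x\<bar> \<le> cos \<eta>" using x by (intro cos_monotone_0_pi_le) auto
    moreover have "cos \<bar>x\<bar> = cos x" by (simp add: abs_if)
    ultimately have "(1 - cos \<eta>) / 2 \<le> 1 - r ^ k * cos (real k * x)" using b True by simp
    from mult_left_mono[OF this a_nonneg[of 1]] show ?thesis using True by (simp add: a0_def)
  next
    case False
    have "0 \<le> (1 - cos (real k * x)) / 2" by simp
    then have "0 \<le> 1 - r ^ k * cos (real k * x)" using b by (rule order.trans)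
    then show ?thesis using a0_nonneg[of k] False by simp
  qed
qed

lemma norm_one_minus_power_le:
  assumes "norm (z::complex) \<le> 1"
  shows "norm (1 - z ^ k) \<le> real k * norm (1 - z)"
    and "norm (1 - z ^ k - of_nat k * (1 - z)) \<le> (real k)\<^sup>2 * (norm (1 - z))\<^sup>2"
proof -
  show le: "norm (1 - z ^ k) \<le> real k * norm (1 - z)" for k
  proof (induction k)
    case (Suc k)
    have "1 - z ^ Suc k = (1 - z) + z * (1 - z ^ k)" by (simp add: algebra_simps)
    also have "norm \<dots> \<le> norm (1 - z) + norm z * norm (1 - z ^ k)"
      by (rule order.trans[OF norm_triangle_ineq]) (simp add: norm_mult)
    also have "\<dots> \<le> norm (1 - z) + 1 * norm (1 - z ^ k)"
      using assms by (intro add_left_mono mult_right_mono) auto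
    finally show ?case using Suc by (simp add: algebra_simps)
  qed simp
  show "norm (1 - z ^ k - of_nat k * (1 - z)) \<le> (real k)\<^sup>2 * (norm (1 - z))\<^sup>2"
  proof (induction k)
    case (Suc k)
    have "1 - z ^ Suc k - of_nat (Suc k) * (1 - z) = (1 - z ^ k - of_nat k * (1 - z)) - (1 - z) * (1 - z ^ k)"
      by (simp add: algebra_simps)
    also have "norm \<dots> \<le> norm (1 - z ^ k - of_nat k * (1 - z)) + norm (1 - z) * norm (1 - z ^ k)"
      by (rule order.trans[OF norm_triangle_ineq4]) (simp add: norm_mult)
    also have "\<dots> \<le> (real k)\<^sup>2 * (norm (1 - z))\<^sup>2 + norm (1 - z) * (real k * norm (1 - z))"
      by (intro add_mono Suc mult_left_mono le) auto
    also have "\<dots> = ((real k)\<^sup>2 + real k) * (norm (1 - z))\<^sup>2" by (simp add: algebra_simps power2_eq_square)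
    also have "\<dots> \<le> (real (Suc k))\<^sup>2 * (norm (1 - z))\<^sup>2"
      by (intro mult_right_mono) (auto simp: power2_eq_square algebra_simps)
    finally show ?case .
  qed simp
qed

text \<open>Summation by parts for \<open>a k = t k - t (Suc k)\<close>. The boundary term on the
  left is what lets the induction close.\<close>

lemma sum_squares_a_le: "(\<Sum>k\<le>N. (real k)\<^sup>2 * a0 k) + real N * real (Suc N) * t (Suc N) \<le> 2 * (\<Sum>k=1..N. real k * t k)"
proof (induction N)
  case (Suc N)
  have "a (Suc N) \<ge> 0" by (rule a_nonneg) simp
  then have "0 \<le> real (Suc N) * a (Suc N)" by simp
  then show ?case using Suc t_Suc[of "Suc N"]
    by (simp add: a0_def algebra_simps power2_eq_square)
qed (simp add: a0_def)

text \<open>Linearising \<open>1 - z ^ k\<close> for \<open>k \<le> N\<close> compares \<open>1 - A z\<close> with \<open>T N * (1 - z)\<close>.\<close>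

lemma norm_one_minus_A_linear:
  assumes z: "norm z \<le> 1"
  shows "norm (1 - A z - of_real (T N) * (1 - z)) \<le>
     2 * (norm (1 - z))\<^sup>2 * (\<Sum>k=1..N. real k * t k) + (2 + real N * norm (1 - z)) * t (Suc N)"
proof -
  let ?d = "norm (1 - z)"
  let ?g = "\<lambda>k. of_real (a0 k) * (1 - z ^ k) - of_real (a0 k * real (min k N)) * (1 - z)"
  \<comment> \<open>Up to \<open>N\<close> the quadratic Taylor error of \<open>z ^ k\<close> at 1;
    beyond \<open>N\<close>, where the linear term has been truncated to \<open>N * (1 - z)\<close>,
    only the triangle inequality.\<close>
  define h where "h k = (if k \<in> {..N} then ?d\<^sup>2 * ((real k)\<^sup>2 * a0 k) else 0) + (2 + real N * ?d) * (a0 k * of_bool (N < k))" for k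
  have gs: "?g sums (1 - A z - of_real (T N) * (1 - z))"
    by (intro sums_diff one_minus_A_sums z sums_mult2 sums_of_real a0_min_sums)
  have hs: "h sums ((\<Sum>k\<le>N. ?d\<^sup>2 * ((real k)\<^sup>2 * a0 k)) + (2 + real N * ?d) * t (Suc N))"
    unfolding h_def by (intro sums_add sums_mult a0_sums_tail sums_If_finite_set) simp
  have gh: "norm (?g k) \<le> h k" for k
  proof (cases "k \<le> N")
    case True
    then have "?g k = of_real (a0 k) * (1 - z ^ k - of_nat k * (1 - z))" by (simp add: algebra_simps min_def)
    then have "norm (?g k) = a0 k * norm (1 - z ^ k - of_nat k * (1 - z))"
      using a0_nonneg[of k] by (simp add: norm_mult)
    also have "\<dots> \<le> a0 k * ((real k)\<^sup>2 * ?d\<^sup>2)"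
      by (intro mult_left_mono norm_one_minus_power_le z a0_nonneg)
    finally show ?thesis using True by (simp add: h_def mult_ac)
  next
    case False
    then have "?g k = of_real (a0 k) * (1 - z ^ k - of_nat N * (1 - z))" by (simp add: algebra_simps min_def)
    then have "norm (?g k) = a0 k * norm (1 - z ^ k - of_nat N * (1 - z))"
      using a0_nonneg[of k] by (simp add: norm_mult)
    also have "\<dots> \<le> a0 k * (2 + real N * ?d)"
    proof (intro mult_left_mono a0_nonneg)
      have "norm (1 - z ^ k - of_nat N * (1 - z)) \<le> norm (1 - z ^ k) + norm (of_nat N * (1 - z))"
        by (rule norm_triangle_ineq4)
      also have "norm (1 - z ^ k) \<le> norm (1::complex) + norm (z ^ k)" by (rule norm_triangle_ineq4)
      also have "norm (z ^ k) \<le> 1" using z by (simp add: norm_power power_le_one)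
      finally show "norm (1 - z ^ k - of_nat N * (1 - z)) \<le> 2 + real N * ?d" by (simp add: norm_mult)
    qed
    finally show ?thesis using False by (simp add: h_def mult_ac)
  qed
  have "norm (1 - A z - of_real (T N) * (1 - z)) \<le> (\<Sum>k\<le>N. ?d\<^sup>2 * ((real k)\<^sup>2 * a0 k)) + (2 + real N * ?d) * t (Suc N)"
  proof -
    have "norm (suminf ?g) \<le> suminf h"
      using gh sums_summable[OF hs] by (rule norm_suminf_le)
    then show ?thesis using gs hs by (simp add: sums_iff)
  qed
  moreover have "(\<Sum>k\<le>N. ?d\<^sup>2 * ((real k)\<^sup>2 * a0 k)) \<le> ?d\<^sup>2 * (2 * (\<Sum>k=1..N. real k * t k))"
  proof -
    have "(\<Sum>k\<le>N. (real k)\<^sup>2 * a0 k) \<le> 2 * (\<Sum>k=1..N. real k * t k)"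
    proof -
      have "0 \<le> real N * real (Suc N) * t (Suc N)" using t_nonneg[of "Suc N"] by simp
      then show ?thesis using sum_squares_a_le[of N] by linarith
    qed
    then show ?thesis unfolding sum_distrib_left[symmetric] by (rule mult_left_mono) simp
  qed
  ultimately show ?thesis by (simp add: mult_ac)
qed

end

lemma norm_cis_diff_le: "norm (cis x - cis y) \<le> \<bar>x - y\<bar>"
proof -
  have "cis x - cis y = cis y * (exp (\<i> * of_real (x - y)) - 1)"
    by (simp add: cis_conv_exp right_diff_distrib exp_add[symmetric])
  then have "norm (cis x - cis y) = norm (exp (\<i> * of_real (x - y)) - 1)" by (simp add: norm_mult)
  also have "\<dots> = 2 * \<bar>sin ((x - y) / 2)\<bar>" by (rule dist_exp_i_1)
  also have "\<dots> \<le> 2 * \<bar>(x - y) / 2\<bar>"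
    using abs_sin_x_le_abs_x[of "(x - y) / 2"] by simp
  finally show ?thesis by simp
qed

lemma abs_sin_ge_half:
  assumes "\<bar>x\<bar> \<le> (1::real)"
  shows "\<bar>x\<bar> / 2 \<le> \<bar>sin x\<bar>"
proof (cases "x = 0")
  case False
  have "0 < \<bar>x\<bar>" using False by simp
  then obtain y where y: "0 < y" "y < \<bar>x\<bar>" "sin \<bar>x\<bar> - sin 0 = (\<bar>x\<bar> - 0) * cos y"
    using MVT2[of 0 "\<bar>x\<bar>" sin cos] DERIV_sin by blast
  have "cos (pi / 3) \<le> cos y" using y assms pi_gt3 by (intro cos_monotone_0_pi_le) auto
  then have "\<bar>x\<bar> * (1 / 2) \<le> \<bar>x\<bar> * cos y" by (intro mult_left_mono) (auto simp: cos_60)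
  then have "\<bar>x\<bar> / 2 \<le> sin \<bar>x\<bar>" using y by simp
  also have "\<dots> \<le> \<bar>sin x\<bar>" by (auto simp: abs_if)
  finally show ?thesis .
qed simp

text \<open>For \<open>\<bar>x\<bar> >= 1 / n\<close> the radial deviation is at most the angular
  one, hence the factor 2. The lower bound uses the imaginary part: the radius is at least
  \<open>exp (- 1) >= 1/3\<close> and the sine at least half its argument, hence
  \<open>1/6\<close>.\<close>

lemma norm_one_minus_circle_bounds:
  assumes n: "n \<ge> 1" and x: "1 / real n \<le> \<bar>x\<bar>" "\<bar>x\<bar> \<le> 1"
  defines "z \<equiv> of_real (exp (- (1 / real n))) * cis x"
  shows "norm (1 - z) \<le> 2 * \<bar>x\<bar>" "\<bar>x\<bar> / 6 \<le> norm (1 - z)"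
proof -
  let ?r = "exp (- (1 / real n))"
  have r: "0 < ?r" "?r \<le> 1" by auto
  have "1 - z = (1 - of_real ?r) + of_real ?r * (cis 0 - cis x)" by (simp add: z_def algebra_simps)
  also have "norm \<dots> \<le> norm (1 - complex_of_real ?r) + norm (of_real ?r * (cis 0 - cis x))"
    by (rule norm_triangle_ineq)
  also have "norm (1 - complex_of_real ?r) = 1 - ?r"
  proof -
    have "norm (1 - complex_of_real ?r) = norm (complex_of_real (1 - ?r))" by simp
    also have "\<dots> = 1 - ?r" using r by (simp only: norm_of_real)
    finally show ?thesis .
  qed
  also have "1 - ?r \<le> 1 / real n" using exp_ge_add_one_self[of "- (1 / real n)"] by simp
  also have "norm (of_real ?r * (cis 0 - cis x)) \<le> 1 * \<bar>0 - x\<bar>"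
    unfolding norm_mult using r by (intro mult_mono norm_cis_diff_le) auto
  finally show "norm (1 - z) \<le> 2 * \<bar>x\<bar>" using x by simp
  have "1 / 3 \<le> exp (- 1 :: real)" using exp_le by (simp add: exp_minus field_simps)
  also have "\<dots> \<le> ?r" using n by simp
  finally have "1 / 3 * (\<bar>x\<bar> / 2) \<le> ?r * \<bar>sin x\<bar>"
    using abs_sin_ge_half[OF x(2)] by (intro mult_mono) auto
  also have "\<dots> = \<bar>Im (1 - z)\<bar>" by (simp add: z_def abs_mult)
  also have "\<dots> \<le> norm (1 - z)" by (rule abs_Im_le_cmod)
  finally show "\<bar>x\<bar> / 6 \<le> norm (1 - z)" by simp
qed

lemma ceiling_inverse_bounds:
  assumes "0 < y" "y \<le> (1::real)"
  defines "N \<equiv> nat \<lceil>1 / y\<rceil>"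
  shows "N \<ge> 1" "1 \<le> real N * y" "real N * y \<le> 1 + y"
proof -
  have "0 < 1 / y" using assms by simp
  then have "real N = of_int \<lceil>1 / y\<rceil>" unfolding N_def by simp
  then have "1 / y \<le> real N" "real N < 1 / y + 1" using ceiling_correct[of "1 / y"] by linarith+
  show 1: "1 \<le> real N * y" using \<open>1 / y \<le> real N\<close> pos_divide_le_eq[OF assms(1)] by blast
  have "real N * y \<le> (1 / y + 1) * y" using \<open>real N < 1 / y + 1\<close> assms by (intro mult_right_mono) auto
  then show "real N * y \<le> 1 + y" using assms by (simp add: algebra_simps)
  show "N \<ge> 1" using 1 by (cases N) auto
qed

section \<open>A uniform lower bound for 1 - A under regular variation\<close>

context rv_partition begin

lemma T_doubling: "(\<lambda>n. T (2 * n) / T n) \<longlonglongrightarrow> 2 powr (1 - \<theta>)"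
  using T_multiple[of 2] by simp

text \<open>Potter's bound. Eventually each doubling multiplies \<open>T\<close> by less than
  \<open>2 powr \<beta>\<close>, and iteration settles \<open>N >= N0\<close>. Smaller
  \<open>N\<close> are reached by dilating both arguments by \<open>N0\<close>, at the cost of the
  factor \<open>N0\<close> from \<open>T_mult_le\<close>.\<close>

lemma T_potter:
  assumes "1 - \<theta> < \<beta>"
  shows "\<exists>C>0. \<forall>N n. 1 \<le> N \<longrightarrow> N \<le> n \<longrightarrow> T n \<le> C * T N * (real n / real N) powr \<beta>"
proof -
  have b0: "\<beta> > 0" using assms theta by simp
  have "(2::real) powr (1 - \<theta>) < 2 powr \<beta>" using assms by (intro powr_less_mono) auto
  then have "\<forall>\<^sub>F n in sequentially. T (2 * n) / T n < 2 powr \<beta>"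
    by (rule order_tendstoD(2)[OF T_doubling])
  then obtain M where M: "\<And>n. n \<ge> M \<Longrightarrow> T (2 * n) / T n < 2 powr \<beta>" by (auto simp: eventually_sequentially)
  define N0 where "N0 = Suc M"
  have dbl: "T (2 * n) \<le> 2 powr \<beta> * T n" if "n \<ge> N0" for n
    using M[of n] that T_pos[of n] by (simp add: N0_def field_simps)
  have big: "T n \<le> 2 powr \<beta> * (real n / real N) powr \<beta> * T N" if "N0 \<le> N" "N \<le> n" for N n
    using that
  proof (induction "n - N" arbitrary: N rule: less_induct)
    case less
    have N1: "N \<ge> 1" using less.prems by (simp add: N0_def)
    show ?case
    proof (cases "n < 2 * N")
      case True
      have "T n \<le> T (2 * N)" using True by (intro T_mono) simp
      also have "\<dots> \<le> 2 powr \<beta> * 1 * T N" using dbl[OF less.prems(1)] by simp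
      also have "\<dots> \<le> 2 powr \<beta> * (real n / real N) powr \<beta> * T N"
        using less.prems N1 b0 by (intro mult_right_mono mult_left_mono T_nonneg ge_one_powr_ge_zero) auto
      finally show ?thesis .
    next
      case False
      have "T n \<le> 2 powr \<beta> * (real n / real (2 * N)) powr \<beta> * T (2 * N)"
        using False less.prems N1 by (intro less.hyps) auto
      also have "\<dots> \<le> 2 powr \<beta> * (real n / real (2 * N)) powr \<beta> * (2 powr \<beta> * T N)"
        by (intro mult_left_mono dbl less.prems) auto
      also have "(real n / real (2 * N)) powr \<beta> = (real n / real N) powr \<beta> / 2 powr \<beta>"
        by (simp add: powr_divide powr_mult)
      finally show ?thesis by (simp add: mult_ac)
    qed
  qed
  show ?thesis
  proof (intro exI[of _ "2 powr \<beta> * real N0"] conjI allI impI)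
    fix N n :: nat assume Nn: "1 \<le> N" "N \<le> n"
    have "T n \<le> T (N0 * n)" by (intro T_mono) (simp add: N0_def)
    also have "\<dots> \<le> 2 powr \<beta> * (real (N0 * n) / real (N0 * N)) powr \<beta> * T (N0 * N)"
      using Nn by (intro big) auto
    also have "\<dots> \<le> 2 powr \<beta> * (real (N0 * n) / real (N0 * N)) powr \<beta> * (real N0 * T N)"
      by (intro mult_left_mono T_mult_le) auto
    also have "real (N0 * n) / real (N0 * N) = real n / real N"
      unfolding of_nat_mult by (rule mult_divide_mult_cancel_left) (simp add: N0_def)
    finally show "T n \<le> 2 powr \<beta> * real N0 * T N * (real n / real N) powr \<beta>" by (simp add: mult_ac)
  qed (simp add: N0_def)
qed

text \<open>Both strict inequalities on \<theta> are used to bound the window mass from below: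
  \<open>\<theta> > 0\<close> makes \<open>t (2 * N)\<close> a proper fraction of
  \<open>t N\<close>, so the mass is at least \<open>(1 - q) * t N\<close>;
  \<open>\<theta> < 1\<close> makes \<open>T (2 * N) - T N\<close> a fixed proportion of
  \<open>T N\<close>, so \<open>N * t N >= p * T N\<close>.\<close>

lemma one_minus_A_lower_less_1:
  assumes th: "0 < \<theta>" "\<theta> < 1"
  shows "\<exists>c>0. \<exists>\<eta>>0. \<forall>n x. n \<ge> 1 \<longrightarrow> 1 / real n \<le> \<bar>x\<bar> \<longrightarrow> \<bar>x\<bar> \<le> \<eta> \<longrightarrow>
    c * \<bar>x\<bar> * T (nat \<lceil>1 / \<bar>x\<bar>\<rceil>) \<le> norm (1 - A (of_real (exp (- (1 / real n))) * cis x))"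
proof -
  have "(2::real) powr (- \<theta>) < 2 powr 0" "(2::real) powr 0 < 2 powr (1 - \<theta>)"
    using th by (intro powr_less_mono; simp)+
  then have p2: "(2::real) powr (- \<theta>) < 1" "1 < (2::real) powr (1 - \<theta>)" by simp_all
  \<comment> \<open>\<open>q\<close> is the midpoint of \<open>2 powr (- \<theta>)\<close> and 1,
    and \<open>1 + p\<close> that of 1 and \<open>2 powr (1 - \<theta>)\<close>.\<close>
  define q where "q = (1 + 2 powr (- \<theta>)) / (2::real)"
  define p where "p = (2 powr (1 - \<theta>) - 1) / (2::real)"
  have q: "2 powr (- \<theta>) < q" "q < 1" and p: "0 < p" "1 + p < 2 powr (1 - \<theta>)"
    using p2 by (auto simp: q_def p_def field_simps)
  have "(\<lambda>n. t (2 * n) / t n) \<longlonglongrightarrow> 2 powr (- \<theta>)" using t_rv[of 2] by simp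
  from eventually_conj[OF order_tendstoD(2)[OF this q(1)] order_tendstoD(1)[OF T_doubling p(2)]]
  obtain M where M: "\<And>n. n \<ge> M \<Longrightarrow> t (2 * n) / t n < q" "\<And>n. n \<ge> M \<Longrightarrow> 1 + p < T (2 * n) / T n"
    by (auto simp: eventually_sequentially)
  define c where "c = (1 - cos 1) / 2 * (1 - q) * p / (2::real)"
  have cos1: "cos 1 < (1::real)" using cos_monotone_0_pi[of 0 1] pi_gt3 by simp
  show ?thesis
  \<comment> \<open>The bound \<open>1/2\<close> on \<open>\<bar>x\<bar>\<close> gives
    \<open>2 * N * \<bar>x\<bar> <= 3\<close> for the window, and \<open>1 / Suc M\<close> gives
    \<open>N >= M\<close>.\<close>
  proof (rule exI[of _ c], intro conjI exI[of _ "min (1/2) (1 / real (Suc M))"] allI impI)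
    show "c > 0" using cos1 q p by (simp add: c_def)
    show "min (1/2) (1 / real (Suc M)) > 0" by simp
    fix n :: nat and x :: real assume n: "n \<ge> 1" and x: "1 / real n \<le> \<bar>x\<bar>" "\<bar>x\<bar> \<le> min (1/2) (1 / real (Suc M))"
    let ?y = "\<bar>x\<bar>"
    have y: "0 < ?y" "?y \<le> 1" "?y \<le> 1/2" "?y \<le> 1 / real (Suc M)"
      using x n by (auto intro: less_le_trans[of 0 "1 / real n"])
    define N where "N = nat \<lceil>1 / ?y\<rceil>"
    note N = ceiling_inverse_bounds[OF y(1,2), folded N_def]
    have "real (Suc M) * ?y \<le> 1" using y(4) by (simp add: field_simps)
    then have "real (Suc M) * ?y \<le> real N * ?y" using N(2) by linarith
    then have NM: "N \<ge> M" using y(1) by simp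
    have tN: "t N > 0" using N(1) by (rule t_pos)
    have TN: "T N > 0" using N(1) by (rule T_pos)
    have "p * T N \<le> T (2 * N) - T N" using M(2)[OF NM] TN by (simp add: field_simps)
    also have "\<dots> \<le> real N * t (Suc N)" by (rule T_double_diff)
    also have "\<dots> \<le> real N * t N" using N(1) by (intro mult_left_mono t_antimono) auto
    finally have pT: "p * T N \<le> real N * t N" .
    have "p * T N * (?y / 2) \<le> real N * t N * (?y / 2)"
      using pT y by (intro mult_right_mono) auto
    also have "\<dots> = t N * (real N * ?y / 2)" by simp
    also have "\<dots> \<le> t N * 1" using N(3) y tN by (intro mult_left_mono) auto
    finally have pT': "p * T N * (?y / 2) \<le> t N" by simp
    have "t (2 * N) \<le> q * t N" using M(1)[OF NM] tN by (simp add: field_simps)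
    then have qt: "(1 - q) * t N \<le> t N - t (2 * N)" by (simp add: algebra_simps)
    have "c * ?y * T N = (1 - cos 1) / 2 * ((1 - q) * (p * T N * (?y / 2)))" by (simp add: c_def)
    also have "\<dots> \<le> (1 - cos 1) / 2 * ((1 - q) * t N)"
      using pT' q cos1 by (intro mult_left_mono) auto
    also have "\<dots> \<le> (1 - cos 1) / 2 * (t N - t (2 * N))"
      using qt cos1 by (intro mult_left_mono) auto
    also have "\<dots> \<le> norm (1 - A (of_real (exp (- (1 / real n))) * cis x))"
      using N y by (intro norm_one_minus_A_ge_window) auto
    finally show "c * ?y * T (nat \<lceil>1 / ?y\<rceil>) \<le> norm (1 - A (of_real (exp (- (1 / real n))) * cis x))"
      by (simp add: N_def)
  qed
qed

text \<open>At \<open>\<theta> = 1\<close> the ratio \<open>T (2 * n) / T n\<close> tends to 1, so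
  the block \<open>T (2 * n) - T n\<close>, which dominates \<open>n * t (2 * n)\<close>, is
  \<open>o(T n)\<close>; the factor 3 covers the passage from \<open>2 * n\<close> to
  \<open>m\<close>.\<close>

lemma t_small_theta_1:
  assumes th: "\<theta> = 1" and e: "e > 0"
  shows "\<exists>M\<ge>1. \<forall>n\<ge>M. real n * t n \<le> e * T n"
proof -
  have "(\<lambda>n. T (2 * n) / T n) \<longlonglongrightarrow> 1" using T_doubling th by simp
  then have "\<forall>\<^sub>F n in sequentially. T (2 * n) / T n < 1 + e / 3"
    using e by (intro order_tendstoD(2)) auto
  then obtain K where K: "\<And>n. n \<ge> K \<Longrightarrow> T (2 * n) / T n < 1 + e / 3" by (auto simp: eventually_sequentially)
  show ?thesis
  proof (intro exI[of _ "2 * K + 2"] conjI allI impI)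
    fix m assume m: "m \<ge> 2 * K + 2"
    define n where "n = m div 2"
    have n: "n \<ge> K" "n \<ge> 1" "2 * n \<le> m" "m \<le> 3 * n" using m by (auto simp: n_def)
    have "real m * t m \<le> real (3 * n) * t (2 * n)"
      using n by (intro mult_mono t_antimono of_nat_mono t_nonneg) auto
    also have "\<dots> \<le> 3 * (T (2 * n) - T n)" using T_double_diff(1)[of n] by simp
    also have "\<dots> \<le> e * T n" using K[OF n(1)] T_pos[OF n(2)] by (simp add: field_simps)
    also have "\<dots> \<le> e * T m" using e n by (intro mult_left_mono T_mono) auto
    finally show "real m * t m \<le> e * T m" .
  qed simp
qed

text \<open>Now \<open>t N\<close> is of smaller order than \<open>T N / N\<close>, so the window
  bound is too weak. Instead \<open>1 - A z\<close> is close to \<open>T N * (1 - z)\<close>: the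
  same smallness of \<open>t\<close> makes the error in \<open>norm_one_minus_A_linear\<close> a
  small multiple of the main term.\<close>

lemma one_minus_A_lower_eq_1:
  assumes th: "\<theta> = 1"
  shows "\<exists>c>0. \<exists>\<eta>>0. \<forall>n x. n \<ge> 1 \<longrightarrow> 1 / real n \<le> \<bar>x\<bar> \<longrightarrow> \<bar>x\<bar> \<le> \<eta> \<longrightarrow>
    c * \<bar>x\<bar> * T (nat \<lceil>1 / \<bar>x\<bar>\<rceil>) \<le> norm (1 - A (of_real (exp (- (1 / real n))) * cis x))"
proof -
  \<comment> \<open>The error below is at most \<open>22 * e * T N * \<bar>x\<bar>\<close>; this
    value makes it half of the main term \<open>T N * \<bar>x\<bar> / 6\<close>.\<close>
  define e :: real where "e = 1 / 264"
  have e: "e > 0" by (simp add: e_def)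
  obtain K where K: "K \<ge> 1" "\<And>n. n \<ge> K \<Longrightarrow> real n * t n \<le> e / 2 * T n"
    using t_small_theta_1[OF th, of "e / 2"] e by auto
  \<comment> \<open>The first \<open>K\<close> terms of the sum of \<open>k * t k\<close> are only
    bounded by \<open>K\<close> each; \<open>M0\<close> is so large that
    \<open>e / 2 * N * T N\<close> absorbs their total.\<close>
  obtain M0 :: nat where M0: "real M0 > 2 * (real K)\<^sup>2 / e" using reals_Archimedean2 by blast
  define M where "M = M0 + K"
  have S: "(\<Sum>k=1..N. real k * t k) \<le> e * real N * T N" if "N \<ge> M" for N
  proof -
    have N1: "N \<ge> 1" using that K by (simp add: M_def)
    have "(\<Sum>k=1..N. real k * t k) \<le> (\<Sum>k=1..N. (if k < K then real K else 0) + e / 2 * T N)"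
    proof (rule sum_mono)
      fix k assume k: "k \<in> {1..N}"
      show "real k * t k \<le> (if k < K then real K else 0) + e / 2 * T N"
      proof (cases "k < K")
        case True
        have "real k * t k \<le> real K * 1" using True k t_nonneg[of k] by (intro mult_mono t_le_1) auto
        then show ?thesis using True e T_nonneg[of N] by (simp add: add_increasing2)
      next
        case False
        then have "real k * t k \<le> e / 2 * T k" using K(2) by simp
        also have "\<dots> \<le> e / 2 * T N" using k e by (intro mult_left_mono T_mono) auto
        finally show ?thesis using False by simp
      qed
    qed
    also have "\<dots> = (\<Sum>k\<in>{1..N} \<inter> {..<K}. real K) + real N * (e / 2 * T N)"
      unfolding sum.distrib by (subst sum.inter_restrict) (auto intro!: sum.cong)
    also have "(\<Sum>k\<in>{1..N} \<inter> {..<K}. real K) \<le> (\<Sum>k\<in>{..<K}. real K)"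
      by (intro sum_mono2) auto
    also have "(\<Sum>k\<in>{..<K}. real K) = (real K)\<^sup>2" by (simp add: power2_eq_square)
    also have "(real K)\<^sup>2 \<le> real N * (e / 2 * T N)"
    proof -
      have "(real K)\<^sup>2 \<le> real M0 * (e / 2)" using M0 e by (simp add: field_simps)
      also have "\<dots> \<le> real N * (e / 2 * T N)"
        using that e T_ge_1[OF N1] by (intro mult_mono) (auto simp: M_def mult_le_cancel_left1)
      finally show ?thesis .
    qed
    finally show ?thesis by (simp add: field_simps)
  qed
  show ?thesis
  proof (rule exI[of _ "1 / 12 :: real"], intro conjI exI[of _ "1 / real M"] allI impI)
    show "1 / real M > 0" using K by (simp add: M_def)
    fix n :: nat and x :: real assume n: "n \<ge> 1" and x: "1 / real n \<le> \<bar>x\<bar>" "\<bar>x\<bar> \<le> 1 / real M"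
    let ?y = "\<bar>x\<bar>"
    have M1: "M \<ge> 1" using K by (simp add: M_def)
    have y: "0 < ?y" using x n by (auto intro: less_le_trans[of 0 "1 / real n"])
    have My: "real M * ?y \<le> 1" using x M1 by (simp add: field_simps)
    have "1 * ?y \<le> real M * ?y" using M1 by (intro mult_right_mono) auto
    then have y1: "?y \<le> 1" using My by simp
    define N where "N = nat \<lceil>1 / ?y\<rceil>"
    note N = ceiling_inverse_bounds[OF y y1, folded N_def]
    have "real M * ?y \<le> real N * ?y" using N(2) My by linarith
    then have NM: "N \<ge> M" using y by simp
    have TN: "T N > 0" using N(1) by (rule T_pos)
    define z where "z = of_real (exp (- (1 / real n))) * cis x"
    define d where "d = norm (1 - z)"
    have d: "d \<le> 2 * ?y" "?y / 6 \<le> d" "0 \<le> d"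
      using norm_one_minus_circle_bounds[OF n x(1) y1] by (auto simp: d_def z_def)
    have z1: "norm z \<le> 1" by (simp add: z_def norm_mult)
    have "t (Suc N) \<le> t N" using N(1) by (intro t_antimono) auto
    also have "\<dots> \<le> e / 2 * T N / real N" using K(2)[of N] NM N(1) by (simp add: M_def field_simps)
    also have "\<dots> \<le> e * T N * ?y"
    proof -
      have "e / 2 * T N * 1 \<le> e / 2 * T N * (real N * ?y)" using N(2) e TN by (intro mult_left_mono) auto
      then have "e / 2 * T N \<le> e * T N * ?y * real N"
        using e TN y by (simp add: mult_ac)
      then show ?thesis using N(1) by (simp add: field_simps)
    qed
    finally have tb: "t (Suc N) \<le> e * T N * ?y" .
    have "real N * d \<le> real N * (2 * ?y)" using d by (intro mult_left_mono) auto
    then have Nd: "real N * d \<le> 4" using N(3) y1 by simp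
    have "2 * d\<^sup>2 * (\<Sum>k=1..N. real k * t k) \<le> 2 * (2 * ?y)\<^sup>2 * (e * real N * T N)"
      using d S[OF NM] by (intro mult_mono power_mono sum_nonneg) (auto intro!: mult_nonneg_nonneg t_nonneg)
    also have "\<dots> = 8 * e * ?y * T N * (real N * ?y)" by (simp add: power2_eq_square)
    also have "\<dots> \<le> 8 * e * ?y * T N * 2" using N(3) y1 e y TN by (intro mult_left_mono) auto
    finally have b1: "2 * d\<^sup>2 * (\<Sum>k=1..N. real k * t k) \<le> 16 * (e * T N * ?y)" by (simp add: mult_ac)
    have "(2 + real N * d) * t (Suc N) \<le> 6 * (e * T N * ?y)"
      using Nd tb d e TN y by (intro mult_mono t_nonneg) auto
    with b1 norm_one_minus_A_linear[OF z1, of N, folded d_def]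
    have "norm (1 - A z - of_real (T N) * (1 - z)) \<le> 22 * (e * T N * ?y)" by linarith
    moreover have "norm (of_real (T N) * (1 - z)) - norm (1 - A z - of_real (T N) * (1 - z)) \<le> norm (1 - A z)"
      by (metis norm_minus_commute norm_triangle_sub diff_le_eq)
    moreover have "norm (of_real (T N) * (1 - z)) = T N * d" using TN by (simp add: norm_mult d_def)
    moreover have "T N * (?y / 6) \<le> T N * d" using d TN by (intro mult_left_mono) auto
    ultimately have "T N * (?y / 6) - 22 * (e * T N * ?y) \<le> norm (1 - A z)" by linarith
    then show "1 / 12 * ?y * T (nat \<lceil>1 / ?y\<rceil>) \<le> norm (1 - A (of_real (exp (- (1 / real n))) * cis x))"
      by (simp add: e_def N_def z_def)
  qed simp
qed

text \<open>Three ranges of \<open>\<bar>x\<bar>\<close>. Up to \<open>1 / n\<close> the bound by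
  \<open>T n / (2 * n)\<close> suffices; up to \<open>\<eta>'\<close> the local bound at scale
  \<open>N\<close>, about \<open>1 / \<bar>x\<bar>\<close>, is converted to scale \<open>n\<close>
  by Potter's inequality; beyond, a constant bounds the norm below, and Potter's inequality from
  \<open>N = 1\<close> bounds the left side.\<close>

lemma one_minus_A_lower:
  assumes th: "0 < \<theta>" and beta: "1 - \<theta> < \<beta>" "\<beta> < 1"
  shows "\<exists>c>0. \<forall>n x. n \<ge> 1 \<longrightarrow> \<bar>x\<bar> \<le> pi \<longrightarrow>
    c * (T n / real n) * (1 + real n * \<bar>x\<bar>) powr (1 - \<beta>) \<le> norm (1 - A (of_real (exp (- (1 / real n))) * cis x))"
proof -
  have "\<exists>c>0. \<exists>\<eta>>0. \<forall>n x. n \<ge> 1 \<longrightarrow> 1 / real n \<le> \<bar>x\<bar> \<longrightarrow> \<bar>x\<bar> \<le> \<eta> \<longrightarrow>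
    c * \<bar>x\<bar> * T (nat \<lceil>1 / \<bar>x\<bar>\<rceil>) \<le> norm (1 - A (of_real (exp (- (1 / real n))) * cis x))"
  proof (cases "\<theta> = 1")
    case True then show ?thesis by (rule one_minus_A_lower_eq_1)
  next
    case False
    with theta have "\<theta> < 1" by simp
    with th show ?thesis by (rule one_minus_A_lower_less_1)
  qed
  then obtain c \<eta> where c: "c > 0" "\<eta> > 0" and near: "\<And>n x. n \<ge> 1 \<Longrightarrow> 1 / real n \<le> \<bar>x\<bar> \<Longrightarrow> \<bar>x\<bar> \<le> \<eta> \<Longrightarrow>
    c * \<bar>x\<bar> * T (nat \<lceil>1 / \<bar>x\<bar>\<rceil>) \<le> norm (1 - A (of_real (exp (- (1 / real n))) * cis x))"
    by blast
  obtain C where C: "C > 0" "\<And>N n. 1 \<le> N \<Longrightarrow> N \<le> n \<Longrightarrow> T n \<le> C * T N * (real n / real N) powr \<beta>"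
    using T_potter[OF beta(1)] by blast
  have b0: "\<beta> > 0" using beta theta by simp
  define \<eta>' where "\<eta>' = min \<eta> 1"
  have eta: "0 < \<eta>'" "\<eta>' \<le> \<eta>" "\<eta>' \<le> 1" "\<eta>' \<le> pi" using c pi_gt3 by (auto simp: \<eta>'_def)
  define c2 where "c2 = a 1 * ((1 - cos \<eta>') / 2)"
  have c2: "c2 > 0" using a_pos[of 1] cos_monotone_0_pi[of 0 \<eta>'] eta by (simp add: c2_def)
  \<comment> \<open>One entry for each range of \<open>\<bar>x\<bar>\<close>. The 5 majorises
    \<open>1 + pi\<close>, so that \<open>1 + n * \<bar>x\<bar> <= 5 * n\<close>.\<close>
  define k where "k = min (1/4) (min (c / (2 * C)) (c2 / (5 * C)))"
  have k: "k > 0" "k \<le> 1/4" "k \<le> c / (2 * C)" "k \<le> c2 / (5 * C)" using c c2 C by (auto simp: k_def)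
  show ?thesis
  proof (intro exI[of _ k] conjI allI impI)
    fix n :: nat and x :: real assume n: "n \<ge> 1" and x: "\<bar>x\<bar> \<le> pi"
    let ?y = "\<bar>x\<bar>" and ?F = "norm (1 - A (of_real (exp (- (1 / real n))) * cis x))"
    let ?L = "T n / real n" and ?w = "(1 + real n * \<bar>x\<bar>) powr (1 - \<beta>)"
    have n0: "real n > 0" and T0: "T n > 0" using n T_pos by auto
    have L0: "?L > 0" using n0 T0 by simp
    consider "?y \<le> 1 / real n" | "1 / real n \<le> ?y" "?y \<le> \<eta>'" | "\<eta>' \<le> ?y" by linarith
    then show "k * ?L * ?w \<le> ?F"
    proof cases
      case 1
      then have "1 + real n * ?y \<le> 2" using n0 by (simp add: field_simps)
      then have "?w \<le> 2 powr (1 - \<beta>)" using beta by (intro powr_mono2) auto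
      also have "\<dots> \<le> 2 powr 1" using b0 by (intro powr_mono) auto
      finally have "k * ?L * ?w \<le> 1/4 * ?L * 2"
        using k L0 by (intro mult_mono) auto
      also have "\<dots> = T n / (2 * real n)" by simp
      also have "\<dots> \<le> ?F" by (rule norm_one_minus_A_ge_T[OF n])
      finally show ?thesis .
    next
      case 2
      have y: "0 < ?y" "?y \<le> 1" using 2 n0 eta by (auto intro: less_le_trans[of 0 "1 / real n"])
      define N where "N = nat \<lceil>1 / ?y\<rceil>"
      note N = ceiling_inverse_bounds[OF y, folded N_def]
      have "1 / ?y \<le> real n" using 2(1) y n0 by (simp add: field_simps)
      then have Nn: "N \<le> n" unfolding N_def by linarith
      have ny: "real n * ?y \<ge> 1" using 2(1) n0 by (simp add: field_simps)
      have "real n * 1 \<le> real n * (real N * ?y)" using N(2) by (intro mult_left_mono) auto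
      then have "real n / real N \<le> real n * ?y" using N(1) by (simp add: field_simps)
      then have "(real n / real N) powr \<beta> \<le> (real n * ?y) powr \<beta>" using b0 by (intro powr_mono2) auto
      then have "C * T N * (real n / real N) powr \<beta> \<le> C * T N * (real n * ?y) powr \<beta>"
        using C T_nonneg[of N] by (intro mult_left_mono) auto
      with C(2)[OF N(1) Nn] have "T n \<le> C * T N * (real n * ?y) powr \<beta>" by linarith
      moreover have "0 < (real n * ?y) powr \<beta>" using y n0 by simp
      ultimately have TT: "T n / (real n * ?y) powr \<beta> \<le> C * T N" by (simp only: pos_divide_le_eq)
      have "?w \<le> (2 * (real n * ?y)) powr (1 - \<beta>)"
      proof (rule powr_mono2)
        show "1 + real n * ?y \<le> 2 * (real n * ?y)" using ny by linarith
        show "0 \<le> 1 + real n * ?y" using ny by linarith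
      qed (use beta in simp)
      also have "\<dots> = 2 powr (1 - \<beta>) * (real n * ?y) powr (1 - \<beta>)" using ny by (subst powr_mult) auto
      also have "\<dots> \<le> 2 powr 1 * (real n * ?y) powr (1 - \<beta>)"
        using b0 by (intro mult_right_mono powr_mono) auto
      also have "(real n * ?y) powr (1 - \<beta>) = real n * ?y / (real n * ?y) powr \<beta>"
        using ny by (simp add: powr_diff)
      finally have w: "?w \<le> 2 * (real n * ?y / (real n * ?y) powr \<beta>)" by simp
      define D where "D = (real n * ?y) powr \<beta>"
      have D0: "D > 0" unfolding D_def using y n0 by simp
      have "k * ?L * ?w \<le> c / (2 * C) * ?L * (2 * (real n * ?y / D))"
      proof (rule mult_mono[OF mult_right_mono])
        show "k \<le> c / (2 * C)" by (rule k)
        show "?w \<le> 2 * (real n * ?y / D)" using w by (simp only: D_def)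
        show "0 \<le> c / (2 * C) * ?L" using c C L0 by (intro mult_nonneg_nonneg) auto
      qed (use L0 in auto)
      also have "\<dots> = c * ?y / C * (T n / D)"
        using n0 C D0 by (simp only: times_divide_eq_right times_divide_eq_left mult_ac) (simp add: mult_ac)
      also have "\<dots> \<le> c * ?y / C * (C * T N)"
        using TT c C unfolding D_def by (intro mult_left_mono) auto
      also have "\<dots> = c * ?y * T N" using C by simp
      also have "\<dots> \<le> ?F" unfolding N_def using 2 eta n by (intro near) auto
      finally show ?thesis .
    next
      case 3
      have T1: "T 1 = 1" using t_1 by (simp add: T_def)
      have "T n \<le> C * real n powr \<beta>" using C(2)[of 1 n] n T1 by simp
      then have L: "?L \<le> C * real n powr \<beta> / real n" using n0 by (simp add: divide_right_mono)
      have "1 + real n * ?y \<le> real n * 5"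
      proof -
        have "real n * ?y \<le> real n * 4" using x pi_less_4 by (intro mult_left_mono) auto
        moreover have "1 \<le> real n" using n by simp
        ultimately show ?thesis by linarith
      qed
      then have "?w \<le> (real n * 5) powr (1 - \<beta>)"
        by (rule powr_mono2[rotated 2]) (use beta in simp_all)
      also have "\<dots> = real n powr (1 - \<beta>) * 5 powr (1 - \<beta>)" by (simp add: powr_mult)
      also have "\<dots> \<le> real n powr (1 - \<beta>) * 5 powr 1" using b0 by (intro mult_left_mono powr_mono) auto
      finally have w: "?w \<le> real n powr (1 - \<beta>) * 5" by simp
      have "k * ?L * ?w \<le> c2 / (5 * C) * (C * real n powr \<beta> / real n) * (real n powr (1 - \<beta>) * 5)"
      proof (rule mult_mono[OF mult_mono])
        show "k \<le> c2 / (5 * C)" by (rule k)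
        show "0 \<le> c2 / (5 * C)" "0 \<le> c2 / (5 * C) * (C * real n powr \<beta> / real n)"
          using c2 C n0 by simp_all
      qed (use L w L0 in auto)
      also have "\<dots> = c2 * (real n powr \<beta> * real n powr (1 - \<beta>) / real n)" using C by simp
      also have "real n powr \<beta> * real n powr (1 - \<beta>) = real n" using n0 by (simp flip: powr_add)
      finally have "k * ?L * ?w \<le> c2" using n0 by simp
      also have "c2 \<le> ?F" unfolding c2_def using 3 x eta by (intro norm_one_minus_A_ge_far) auto
      finally show ?thesis .
    qed
  qed (rule k)
qed

end

section \<open>The strong renewal law\<close>

lemma integral_cis_int:
  fixes j :: int
  shows "((\<lambda>x. cis (of_int j * x)) has_integral (if j = 0 then of_real (2 * pi) else 0)) {-pi..pi}"
proof (cases "j = 0")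
  case True
  have "((\<lambda>x. 1 :: complex) has_integral (pi - (- pi)) *\<^sub>R 1) {-pi..pi}"
    using has_integral_const_real[of "1::complex" "-pi" pi] by simp
  then show ?thesis using True by (simp add: scaleR_conv_of_real)
next
  case False
  define F where "F x = cis (of_int j * x) / (\<i> * of_int j)" for x
  have "((\<lambda>x. cis (of_int j * x)) has_integral (F pi - F (- pi))) {-pi..pi}"
  proof (rule fundamental_theorem_of_calculus)
    fix x :: real
    have "((\<lambda>z. exp (\<i> * of_int j * z) / (\<i> * of_int j)) has_field_derivative exp (\<i> * of_int j * of_real x)) (at (of_real x))"
      using False by (auto intro!: derivative_eq_intros)
    then have "((\<lambda>x. exp (\<i> * of_int j * of_real x) / (\<i> * of_int j)) has_vector_derivative exp (\<i> * of_int j * of_real x)) (at x)"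
      by (rule has_vector_derivative_real_field)
    then have "(F has_vector_derivative cis (of_int j * x)) (at x)"
      by (simp add: F_def[abs_def] cis_conv_exp mult_ac)
    then show "(F has_vector_derivative cis (of_int j * x)) (at x within {-pi..pi})"
      by (rule has_vector_derivative_at_within)
  qed simp
  moreover have "cis (of_int j * pi) = cis (of_int j * (- pi))"
  proof -
    have "cis (of_int j * pi) = cis (of_int j * (- pi)) * cis (2 * pi * of_int j)"
      by (simp add: cis_mult algebra_simps)
    then show ?thesis by (simp add: cis_multiple_2pi)
  qed
  ultimately show ?thesis using False by (simp add: F_def)
qed

text \<open>Absolute summability gives uniform convergence on the circle by the M-test, hence
  integration term by term.\<close>

lemma fourier_coefficient:
  fixes w :: "nat \<Rightarrow> complex"
  assumes sw: "summable (\<lambda>k. norm (w k))"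
  shows "((\<lambda>x. (\<Sum>k. w k * cis (real k * x)) * cis (- (real m * x))) has_integral of_real (2 * pi) * w m) {-pi..pi}"
proof -
  define f where "f K x = (\<Sum>k<K. w k * cis (real k * x) * cis (- (real m * x)))" for K x
  have u: "uniform_limit {-pi..pi} f (\<lambda>x. \<Sum>k. w k * cis (real k * x) * cis (- (real m * x))) sequentially"
    unfolding f_def by (rule Weierstrass_m_test[OF _ sw]) (simp add: norm_mult)
  have "continuous_on {-pi..pi} (f K)" for K
    unfolding f_def cis_conv_exp by (intro continuous_intros)
  from uniform_limit_integral[OF u this] obtain I J where IJ:
    "\<And>K. (f K has_integral I K) {-pi..pi}"
    "((\<lambda>x. \<Sum>k. w k * cis (real k * x) * cis (- (real m * x))) has_integral J) {-pi..pi}" "I \<longlonglongrightarrow> J"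
    using trivial_limit_sequentially by blast
  have IK: "I K = of_real (2 * pi) * w m" if "K > m" for K
  proof -
    have eq: "w k * cis (real k * x) * cis (- (real m * x)) = w k * cis (of_int (int k - int m) * x)" for k x
      by (simp add: cis_mult mult.assoc algebra_simps)
    have "(f K has_integral (\<Sum>k<K. w k * (if int k - int m = 0 then of_real (2 * pi) else 0))) {-pi..pi}"
      unfolding f_def eq by (intro has_integral_sum has_integral_mult_right integral_cis_int) simp
    moreover have "(\<Sum>k<K. w k * (if int k - int m = 0 then of_real (2 * pi) else 0)) = (\<Sum>k<K. if k = m then of_real (2 * pi) * w k else 0)"
      by (intro sum.cong) auto
    ultimately show ?thesis using IJ(1)[of K] that by (simp add: has_integral_unique)
  qed
  have "\<forall>\<^sub>F K in sequentially. of_real (2 * pi) * w m = I K"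
    using eventually_gt_at_top[of m] by eventually_elim (rule IK[symmetric])
  then have "I \<longlonglongrightarrow> of_real (2 * pi) * w m"
    by (rule Lim_transform_eventually[OF tendsto_const])
  then have J: "J = of_real (2 * pi) * w m" using IJ(3) LIMSEQ_unique by blast
  have "(\<Sum>k. w k * cis (real k * x) * cis (- (real m * x))) = (\<Sum>k. w k * cis (real k * x)) * cis (- (real m * x))" for x
    by (rule suminf_mult2[symmetric], rule summable_norm_cancel) (simp add: norm_mult sw)
  then show ?thesis using IJ(2) J by simp
qed

text \<open>The bound is the integral over the whole real line; \<open>s > 1\<close> makes it of
  order \<open>1 / n\<close>. The two halves agree by reflection.\<close>

lemma integral_decay_bound:
  assumes n: "n > (0::real)" and s: "s > 1"
  shows "\<exists>I\<le>2 / (n * (s - 1)). ((\<lambda>x. (1 + n * \<bar>x\<bar>) powr (- s)) has_integral I) {-pi..pi}"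
proof -
  let ?g = "\<lambda>x. (1 + n * \<bar>x\<bar>) powr (- s)"
  define G where "G x = - ((1 + n * x) powr (1 - s)) / (n * (s - 1))" for x
  have "(?g has_integral (G pi - G 0)) {0..pi}"
  proof (rule fundamental_theorem_of_calculus)
    fix x assume x: "x \<in> {0..pi}"
    have p: "1 + n * x > 0" using x n by (simp add: add_pos_nonneg)
    have "(G has_real_derivative ((1 + n * x) powr (- s))) (at x)"
    proof -
      have "((\<lambda>x. 1 + n * x) has_real_derivative n) (at x)"
        by (auto intro!: derivative_eq_intros)
      from DERIV_chain2[OF has_real_derivative_powr[OF p, of "1 - s"] this]
      have "((\<lambda>x. (1 + n * x) powr (1 - s)) has_real_derivative ((1 - s) * (1 + n * x) powr (- s) * n)) (at x)"
        by simp
      from DERIV_cdivide[OF DERIV_minus[OF this], of "n * (s - 1)"]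
      have "(G has_real_derivative (- ((1 - s) * (1 + n * x) powr (- s) * n) / (n * (s - 1)))) (at x)"
        unfolding G_def .
      moreover have "- ((1 - s) * D * n) / (n * (s - 1)) = D" for D
        using n s by (simp add: field_simps)
      ultimately show ?thesis by simp
    qed
    then show "(G has_vector_derivative ?g x) (at x within {0..pi})"
      using x by (simp add: has_real_derivative_iff_has_vector_derivative[symmetric] has_field_derivative_at_within)
  qed simp
  then have right: "(?g has_integral (G pi - G 0)) {0..pi}" .
  then have "((\<lambda>x. ?g (- x)) has_integral (G pi - G 0)) {-pi..-0}"
    by (rule has_integral_reflect_real[THEN iffD2])
  then have left: "(?g has_integral (G pi - G 0)) {-pi..0}"
    by (simp only: abs_minus_cancel minus_zero)
  have "(?g has_integral ((G pi - G 0) + (G pi - G 0))) {-pi..pi}"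
    by (rule has_integral_combine[OF _ _ left right]) auto
  moreover have "(G pi - G 0) + (G pi - G 0) \<le> 2 / (n * (s - 1))"
  proof -
    have "G pi \<le> 0" using n s by (simp add: G_def)
    moreover have "G 0 = - (1 / (n * (s - 1)))" by (simp add: G_def)
    ultimately show ?thesis by simp
  qed
  ultimately show ?thesis by blast
qed

section \<open>Generating functions inside the unit disc\<close>

context renewal begin

definition Ugen :: "complex \<Rightarrow> complex" where "Ugen z = (\<Sum>k. of_real (u k) * z ^ k)"

definition Wgen :: "complex \<Rightarrow> complex" where "Wgen z = (\<Sum>k. of_real (real k * u k) * z ^ k)"

definition Bgen :: "complex \<Rightarrow> complex" where "Bgen z = (\<Sum>k. of_real (real k * a0 k) * z ^ k)"

lemma summable_linear_power:
  assumes z: "norm (z::complex) < 1" and b: "\<And>k. 0 \<le> b k \<and> b k \<le> (1::real)"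
  shows "summable (\<lambda>k. norm (of_real (real k * b k) * z ^ k))" "summable (\<lambda>k. norm (of_real (b k) * z ^ k))"
proof -
  have g: "summable (\<lambda>k. norm z ^ k)" using z by (simp add: summable_geometric)
  have kg: "summable (\<lambda>k. real k * norm z ^ k)"
  proof (rule summable_comparison_test')
    show "summable (\<lambda>k. of_nat (Suc k) * norm z ^ k)"
      using geometric_deriv_sums[of "norm z"] z by (auto simp: sums_iff)
    show "norm (real k * norm z ^ k) \<le> of_nat (Suc k) * norm z ^ k" for k
      by (auto simp: abs_mult intro!: mult_right_mono)
  qed
  show "summable (\<lambda>k. norm (of_real (real k * b k) * z ^ k))"
  proof (rule summable_comparison_test'[OF kg, of 0])
    fix k
    have "real k * b k * norm z ^ k \<le> real k * 1 * norm z ^ k"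
      using b[of k] by (intro mult_right_mono mult_left_mono) auto
    then show "norm (norm (of_real (real k * b k) * z ^ k)) \<le> real k * norm z ^ k"
      using b[of k] by (simp add: norm_mult norm_power)
  qed
  show "summable (\<lambda>k. norm (of_real (b k) * z ^ k))"
  proof (rule summable_comparison_test'[OF g, of 0])
    fix k
    have "b k * norm z ^ k \<le> 1 * norm z ^ k" using b[of k] by (intro mult_right_mono) auto
    then show "norm (norm (of_real (b k) * z ^ k)) \<le> norm z ^ k"
      using b[of k] by (simp add: norm_mult norm_power)
  qed
qed

lemma a0_unit: "0 \<le> a0 k \<and> a0 k \<le> 1"
  using a0_nonneg a0_le_1 by simp

text \<open>The recursion as a full convolution. It misses \<open>u 0 = 1\<close> at
  \<open>n = 0\<close>, which becomes the right side of \<open>Ugen_eq\<close>.\<close>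

lemma u_rec0: "(\<Sum>i\<le>n. a0 i * u (n - i)) = (if n = 0 then 0 else u n)"
proof (cases "n = 0")
  case False
  then have "(\<Sum>i\<le>n. a0 i * u (n - i)) = (\<Sum>i=1..n. a i * u (n - i))"
    by (intro sum.mono_neutral_cong_right) (auto simp: a0_def Suc_le_eq)
  then show ?thesis using False u_rec[of n] by simp
qed (simp add: a0_def)

lemma power_series_mult:
  fixes b c :: "nat \<Rightarrow> real" and z :: complex
  assumes "summable (\<lambda>k. norm (of_real (b k) * z ^ k))" "summable (\<lambda>k. norm (of_real (c k) * z ^ k))"
  shows "(\<lambda>n. of_real (\<Sum>i\<le>n. b i * c (n - i)) * z ^ n) sums ((\<Sum>k. of_real (b k) * z ^ k) * (\<Sum>k. of_real (c k) * z ^ k))"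
proof -
  have "(\<Sum>i\<le>n. (of_real (b i) * z ^ i) * (of_real (c (n - i)) * z ^ (n - i))) = of_real (\<Sum>i\<le>n. b i * c (n - i)) * z ^ n" for n
    unfolding of_real_sum sum_distrib_right
    by (intro sum.cong refl) (simp add: mult_ac power_add[symmetric])
  then show ?thesis using Cauchy_product_sums[OF assms] by simp
qed

lemma Ugen_eq:
  assumes z: "norm z < 1"
  shows "Ugen z * (1 - A z) = 1"
proof -
  note su = summable_linear_power[where b = u, OF z u_unit] and sa = summable_linear_power[where b = a0, OF z a0_unit]
  have "(\<lambda>n. of_real (if n = 0 then 0 else u n) * z ^ n) sums (A z * Ugen z)"
    using power_series_mult[OF sa(2) su(2)] by (simp add: u_rec0 A_def Ugen_def)
  moreover have "(\<lambda>n. if n = 0 then 1 else (0::complex)) sums 1" by (rule sums_single)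
  ultimately have "(\<lambda>n. of_real (if n = 0 then 0 else u n) * z ^ n + (if n = 0 then 1 else 0)) sums (A z * Ugen z + 1)"
    by (rule sums_add)
  moreover have "(\<lambda>n. of_real (if n = 0 then 0 else u n) * z ^ n + (if n = 0 then 1 else 0)) = (\<lambda>n. of_real (u n) * z ^ n)"
    by (auto simp: u_0)
  ultimately have "Ugen z = A z * Ugen z + 1" by (simp add: sums_iff Ugen_def)
  then show ?thesis by (simp add: algebra_simps)
qed

text \<open>The logarithmic-derivative identity \<open>z U' = z A' / (1 - A)\<^sup>2\<close>, in coefficient form.\<close>

lemma Wgen_eq:
  assumes z: "norm z < 1"
  shows "Wgen z * (1 - A z)\<^sup>2 = Bgen z"
proof -
  note su = summable_linear_power[where b = u, OF z u_unit] and sa = summable_linear_power[where b = a0, OF z a0_unit]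
  have "(\<lambda>n. of_real (\<Sum>i\<le>n. (real i * a0 i) * u (n - i)) * z ^ n + of_real (\<Sum>i\<le>n. a0 i * (real (n - i) * u (n - i))) * z ^ n)
    sums (Bgen z * Ugen z + A z * Wgen z)"
    unfolding Bgen_def Ugen_def Wgen_def A_def
    by (intro sums_add power_series_mult sa su)
  moreover have "of_real (\<Sum>i\<le>n. (real i * a0 i) * u (n - i)) * z ^ n + of_real (\<Sum>i\<le>n. a0 i * (real (n - i) * u (n - i))) * z ^ n
     = of_real (real n * u n) * z ^ n" for n
  proof -
    \<comment> \<open>Leibniz rule on coefficients, from \<open>n = i + (n - i)\<close>.\<close>
    have "(\<Sum>i\<le>n. (real i * a0 i) * u (n - i)) + (\<Sum>i\<le>n. a0 i * (real (n - i) * u (n - i))) = (\<Sum>i\<le>n. real n * (a0 i * u (n - i)))"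
      unfolding sum.distrib[symmetric] by (intro sum.cong refl) (auto simp: of_nat_diff algebra_simps)
    also have "\<dots> = real n * u n" unfolding sum_distrib_left[symmetric] u_rec0 by simp
    finally show ?thesis unfolding distrib_right[symmetric] of_real_add[symmetric] by (rule arg_cong)
  qed
  ultimately have "Wgen z = Bgen z * Ugen z + A z * Wgen z" by (simp add: sums_iff Wgen_def)
  then have "Wgen z * (1 - A z) = Bgen z * Ugen z" by (simp add: algebra_simps)
  then have "Wgen z * (1 - A z)\<^sup>2 = Bgen z * (Ugen z * (1 - A z))"
    by (simp add: power2_eq_square mult.assoc[symmetric])
  then show ?thesis by (simp add: Ugen_eq[OF z])
qed

text \<open>At this radius the damped factor \<open>k * exp (- (k / n))\<close> is at most
  \<open>min k n\<close>, so the truncated mean bounds the series.\<close>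

lemma norm_Bgen_le:
  assumes n: "n \<ge> 1"
  shows "norm (Bgen (of_real (exp (- (1 / real n))) * cis x)) \<le> T n"
proof -
  let ?z = "of_real (exp (- (1 / real n))) * cis x"
  have z: "norm ?z < 1" using n by (simp add: norm_mult)
  have le: "norm (of_real (real k * a0 k) * ?z ^ k) \<le> a0 k * real (min k n)" for k
  proof -
    have r: "norm ?z ^ k = exp (- (real k / real n))" by (simp add: norm_mult exp_of_nat_mult[symmetric])
    have "real k * exp (- (real k / real n)) \<le> real (min k n)"
    proof -
      have "real k / real n \<le> exp (real k / real n)"
        using exp_ge_add_one_self[of "real k / real n"] by linarith
      then have "real k * exp (- (real k / real n)) \<le> real n"
        using n by (simp add: exp_minus field_simps)
      moreover have "real k * exp (- (real k / real n)) \<le> real k * 1"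
        by (intro mult_left_mono) auto
      ultimately show ?thesis by (simp add: min_def)
    qed
    from mult_left_mono[OF this a0_nonneg[of k]]
    have "real k * a0 k * norm ?z ^ k \<le> a0 k * real (min k n)" unfolding r by (simp add: mult_ac)
    moreover have "norm (of_real (real k * a0 k) * ?z ^ k) = real k * a0 k * norm ?z ^ k"
      unfolding norm_mult[of _ "?z ^ k"] norm_power norm_of_real using a0_nonneg[of k] by simp
    ultimately show ?thesis by simp
  qed
  have "norm (Bgen ?z) \<le> (\<Sum>k. a0 k * real (min k n))"
    unfolding Bgen_def by (rule norm_suminf_le[OF le]) (rule sums_summable[OF a0_min_sums])
  then show ?thesis using a0_min_sums[of n] by (simp add: sums_iff)
qed

end

section \<open>Local regularity of n * u n and the strong law\<close>

context rv_renewal begin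

text \<open>Interpolation between the Lipschitz bound and the trivial bound 2. A small exponent
  keeps the product with the squared reciprocal of \<open>1 - A\<close> integrable.\<close>

lemma norm_cis_diff_powr_le:
  assumes "0 \<le> \<gamma>" "\<gamma> \<le> 1" "\<bar>x - y\<bar> \<le> d"
  shows "norm (cis x - cis y) \<le> 2 * d powr \<gamma>"
proof (cases "d \<le> 1")
  case True
  have d0: "0 \<le> d" using assms by simp
  have "norm (cis x - cis y) \<le> d" using norm_cis_diff_le[of x y] assms by simp
  also have "d \<le> d powr \<gamma>"
  proof (cases "d = 0")
    case False
    then have "d powr 1 \<le> d powr \<gamma>" using d0 True assms by (intro powr_mono') auto
    then show ?thesis using d0 by simp
  qed simp
  finally show ?thesis by (smt (verit) powr_ge_zero)
next
  case False
  have "norm (cis x - cis y) \<le> norm (cis x) + norm (cis y)" by (rule norm_triangle_ineq4)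
  moreover have "1 \<le> d powr \<gamma>" using False assms by (intro ge_one_powr_ge_zero) auto
  ultimately show ?thesis by simp
qed

text \<open>Here \<open>\<theta> > 1/2\<close> enters: it makes \<open>(1 - A)\<^sup>-\<^sup>2\<close> integrable along the circle with a power to spare.\<close>

lemma regularity:
  assumes th: "1/2 < \<theta>"
  shows "\<exists>C>0. \<exists>\<gamma>>0. \<forall>n m \<delta>. 1 \<le> n \<longrightarrow> n \<le> m \<longrightarrow> 0 \<le> \<delta> \<longrightarrow> real m \<le> (1 + \<delta>) * real n \<longrightarrow>
    \<bar>real n * u n * exp (- 1) - real m * u m * exp (- (real m / real n))\<bar> \<le> C * \<delta> powr \<gamma> * (real n / T n)"
proof -
  \<comment> \<open>\<beta> is the midpoint of \<open>1 - \<theta>\<close> and \<open>1/2\<close>.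
    Then \<open>2 * (1 - \<beta>) = 1 + 2 * \<gamma>\<close>: half of the excess over 1 is spent on
    the difference of the characters, leaving \<open>s = 1 + \<gamma>\<close>.\<close>
  define \<beta> where "\<beta> = (3 / 2 - \<theta>) / 2"
  define \<gamma> where "\<gamma> = (1 - 2 * \<beta>) / 2"
  define s where "s = 2 * (1 - \<beta>) - \<gamma>"
  have b: "1 - \<theta> < \<beta>" "\<beta> < 1" "\<gamma> > 0" "\<gamma> \<le> 1" "s > 1"
    using th theta by (auto simp: \<beta>_def \<gamma>_def s_def field_simps)
  obtain c where c: "c > 0" "\<And>n x. n \<ge> 1 \<Longrightarrow> \<bar>x\<bar> \<le> pi \<Longrightarrow>
    c * (T n / real n) * (1 + real n * \<bar>x\<bar>) powr (1 - \<beta>) \<le> norm (1 - A (of_real (exp (- (1 / real n))) * cis x))"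
    using one_minus_A_lower[of \<beta>] b th by auto
  define C where "C = 2 / (c\<^sup>2 * (s - 1))"
  have C: "C > 0" using c b by (simp add: C_def)
  show ?thesis
  proof (rule exI[of _ C], intro conjI exI[of _ \<gamma>] allI impI)
    fix n m :: nat and \<delta> :: real
    assume n: "1 \<le> n" and m: "n \<le> m" and d: "0 \<le> \<delta>" "real m \<le> (1 + \<delta>) * real n"
    have n0: "real n > 0" and T0: "T n > 0" using n T_pos by auto
    \<comment> \<open>One radius, fixed by \<open>n\<close>, serves both coefficients; this is the
      origin of \<open>exp (- 1)\<close> and \<open>exp (- (real m / real n))\<close> in the
      statement.\<close>
    let ?r = "exp (- (1 / real n))"
    define w where "w k = complex_of_real (real k * u k * ?r ^ k)" for k
    define W where "W x = Wgen (of_real ?r * cis x)" for x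
    have z: "norm (of_real ?r * cis x) < 1" for x using n by (simp add: norm_mult)
    have Weq: "W x = (\<Sum>k. w k * cis (real k * x))" for x
      unfolding W_def Wgen_def w_def by (simp only: power_mult_distrib Complex.DeMoivre of_real_mult of_real_power mult_ac)
    have sw: "summable (\<lambda>k. norm (w k))"
      using summable_linear_power(1)[where b = u, OF z[of 0] u_unit] u_nonneg
      by (simp add: w_def norm_mult norm_power mult_ac)
    have diff: "((\<lambda>x. W x * (cis (- (real n * x)) - cis (- (real m * x)))) has_integral of_real (2 * pi) * (w n - w m)) {-pi..pi}"
      using has_integral_diff[OF fourier_coefficient[OF sw, of n] fourier_coefficient[OF sw, of m]]
      by (simp add: Weq right_diff_distrib)
    obtain I where I: "I \<le> 2 / (real n * (s - 1))" "((\<lambda>x. (1 + real n * \<bar>x\<bar>) powr (- s)) has_integral I) {-pi..pi}"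
      using integral_decay_bound[OF n0 b(5)] by blast
    define K where "K = 2 * \<delta> powr \<gamma> * ((real n)\<^sup>2 / (c\<^sup>2 * T n))"
    have bound: "norm (W x * (cis (- (real n * x)) - cis (- (real m * x)))) \<le> K * (1 + real n * \<bar>x\<bar>) powr (- s)"
      if x: "x \<in> {-pi..pi}" for x
    proof -
      let ?y = "1 + real n * \<bar>x\<bar>"
      have y: "?y \<ge> 1" by simp
      have lo: "c * (T n / real n) * ?y powr (1 - \<beta>) \<le> norm (1 - A (of_real ?r * cis x))"
        using x by (intro c n) auto
      have "norm (W x) * (c * (T n / real n) * ?y powr (1 - \<beta>))\<^sup>2 \<le> norm (W x) * (norm (1 - A (of_real ?r * cis x)))\<^sup>2"
        using lo c T0 n0 by (intro mult_left_mono power_mono) auto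
      also have "\<dots> = norm (Bgen (of_real ?r * cis x))"
        unfolding W_def Wgen_eq[OF z, symmetric] by (simp add: norm_mult norm_power)
      also have "\<dots> \<le> T n" by (rule norm_Bgen_le[OF n])
      finally have "norm (W x) * (c * (T n / real n) * ?y powr (1 - \<beta>))\<^sup>2 \<le> T n" .
      moreover have "(c * (T n / real n) * ?y powr (1 - \<beta>))\<^sup>2 = c\<^sup>2 * (T n)\<^sup>2 / (real n)\<^sup>2 * ?y powr (2 * (1 - \<beta>))"
      proof -
        have "(?y powr (1 - \<beta>))\<^sup>2 = ?y powr (2 * (1 - \<beta>))"
          unfolding power2_eq_square powr_add[symmetric] by simp
        then show ?thesis by (simp add: power_mult_distrib power_divide)
      qed
      ultimately have "norm (W x) * (c\<^sup>2 * (T n)\<^sup>2 / (real n)\<^sup>2 * ?y powr (2 * (1 - \<beta>))) \<le> T n" by simp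
      moreover have "0 < c\<^sup>2 * (T n)\<^sup>2 / (real n)\<^sup>2 * ?y powr (2 * (1 - \<beta>))"
      proof -
        have "0 < ?y powr (2 * (1 - \<beta>))" using y by (subst powr_gt_zero) linarith
        then show ?thesis using c T0 n0 by (intro mult_pos_pos divide_pos_pos) auto
      qed
      ultimately have "norm (W x) \<le> T n / (c\<^sup>2 * (T n)\<^sup>2 / (real n)\<^sup>2 * ?y powr (2 * (1 - \<beta>)))"
        by (simp only: pos_le_divide_eq)
      also have "\<dots> = (real n)\<^sup>2 / (c\<^sup>2 * T n) * ?y powr (- (2 * (1 - \<beta>)))"
      proof -
        have "T n / (c\<^sup>2 * (T n)\<^sup>2 / (real n)\<^sup>2 * P) = (real n)\<^sup>2 / (c\<^sup>2 * T n) * (1 / P)" for P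
          using T0 n0 c by (simp add: power2_eq_square)
        then show ?thesis by (simp only: powr_minus_divide)
      qed
      finally have Wb: "norm (W x) \<le> (real n)\<^sup>2 / (c\<^sup>2 * T n) * ?y powr (- (2 * (1 - \<beta>)))" .
      have "norm (cis (- (real n * x)) - cis (- (real m * x))) \<le> 2 * (\<delta> * ?y) powr \<gamma>"
      proof (rule norm_cis_diff_powr_le)
        have "\<bar>- (real n * x) - - (real m * x)\<bar> = (real m - real n) * \<bar>x\<bar>"
          using m by (simp add: left_diff_distrib[symmetric] abs_mult)
        also have "\<dots> \<le> (\<delta> * real n) * \<bar>x\<bar>" using d by (intro mult_right_mono) (auto simp: algebra_simps)
        also have "\<dots> \<le> \<delta> * ?y" using d by (simp add: algebra_simps)
        finally show "\<bar>- (real n * x) - - (real m * x)\<bar> \<le> \<delta> * ?y" .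
      qed (use b in auto)
      also have "(\<delta> * ?y) powr \<gamma> = \<delta> powr \<gamma> * ?y powr \<gamma>" using d y by (simp add: powr_mult)
      finally have cb: "norm (cis (- (real n * x)) - cis (- (real m * x))) \<le> 2 * (\<delta> powr \<gamma> * ?y powr \<gamma>)" .
      have "norm (W x * (cis (- (real n * x)) - cis (- (real m * x))))
        \<le> ((real n)\<^sup>2 / (c\<^sup>2 * T n) * ?y powr (- (2 * (1 - \<beta>)))) * (2 * (\<delta> powr \<gamma> * ?y powr \<gamma>))"
        unfolding norm_mult using T0 by (intro mult_mono Wb cb) auto
      also have "\<dots> = K * (?y powr (- (2 * (1 - \<beta>))) * ?y powr \<gamma>)" by (simp add: K_def)
      also have "?y powr (- (2 * (1 - \<beta>))) * ?y powr \<gamma> = ?y powr (- s)"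
        unfolding powr_add[symmetric] by (simp add: s_def algebra_simps)
      finally show ?thesis .
    qed
    have K0: "K \<ge> 0" using T0 by (simp add: K_def)
    have "norm (of_real (2 * pi) * (w n - w m)) \<le> K * I"
    proof -
      have "norm (integral {-pi..pi} (\<lambda>x. W x * (cis (- (real n * x)) - cis (- (real m * x)))))
        \<le> integral {-pi..pi} (\<lambda>x. K * (1 + real n * \<bar>x\<bar>) powr (- s))"
        using diff I(2) bound by (intro integral_norm_bound_integral) (auto intro: has_integral_mult_right has_integral_integrable)
      then show ?thesis
        using diff I(2) by (simp add: integral_unique has_integral_integral[symmetric] integral_unique[OF has_integral_mult_right[OF I(2)]])
    qed
    also have "K * I \<le> K * (2 / (real n * (s - 1)))" by (intro mult_left_mono I K0)
    also have "\<dots> = 2 * (C * \<delta> powr \<gamma> * (real n / T n))"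
      using n0 b by (simp add: K_def C_def power2_eq_square)
    finally have "2 * pi * norm (w n - w m) \<le> 2 * (C * \<delta> powr \<gamma> * (real n / T n))"
      by (simp add: norm_mult)
    moreover have "2 * 1 * norm (w n - w m) \<le> 2 * pi * norm (w n - w m)"
      using pi_gt3 by (intro mult_right_mono) auto
    ultimately have "norm (w n - w m) \<le> C * \<delta> powr \<gamma> * (real n / T n)" by simp
    moreover have "w n - w m = of_real (real n * u n * exp (- 1) - real m * u m * exp (- (real m / real n)))"
    proof -
      have "?r ^ k = exp (- (real k / real n))" for k by (simp add: exp_of_nat_mult[symmetric])
      then show ?thesis using n0 by (simp add: w_def)
    qed
    ultimately show "\<bar>real n * u n * exp (- 1) - real m * u m * exp (- (real m / real n))\<bar> \<le> C * \<delta> powr \<gamma> * (real n / T n)"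
      by (simp only: norm_of_real)
  qed (use C b in auto)
qed

end

context rv_renewal begin

text \<open>Compare \<open>u n * T n\<close> with the average of \<open>u q * T n\<close> over
  \<open>q\<close> between \<open>n\<close> and \<open>(1 + \<delta>) * n\<close>. By the weak law
  this average tends to \<open>K * ((1 + \<delta>) powr \<theta> - 1) / \<delta>\<close>, and
  letting \<delta> tend to 0 gives the derivative \<open>\<theta> * K\<close>. The order of limits
  is \<open>n\<close> first, then \<delta>.\<close>

theorem strong_renewal:
  assumes th: "1/2 < \<theta>"
  shows "(\<lambda>n. u n * T n) \<longlonglongrightarrow> 1 / (Gamma (2 - \<theta>) * Gamma \<theta>)"
proof -
  obtain C \<gamma> where C: "C > 0" "\<gamma> > 0" and reg: "\<And>n m \<delta>. 1 \<le> n \<Longrightarrow> n \<le> m \<Longrightarrow> 0 \<le> \<delta> \<Longrightarrow> real m \<le> (1 + \<delta>) * real n \<Longrightarrow>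
    \<bar>real n * u n * exp (- 1) - real m * u m * exp (- (real m / real n))\<bar> \<le> C * \<delta> powr \<gamma> * (real n / T n)"
    using regularity[OF th] by blast
  define K where "K = 1 / (Gamma (2 - \<theta>) * Gamma (1 + \<theta>))"
  define E where "E \<delta> = C * exp 1 * \<delta> powr \<gamma>" for \<delta>
  have th0: "\<theta> > 0" using th by simp
  have weak: "(\<lambda>n. U n * T n / real n) \<longlonglongrightarrow> K" unfolding K_def by (rule weak_renewal)
  \<comment> \<open>The factors \<open>1 + \<delta>\<close> and \<open>exp (- \<delta>)\<close>
    bound the effect of replacing \<open>q\<close> by \<open>n\<close> in
    \<open>q * exp (- (q / n))\<close>; \<open>E \<delta>\<close> is the error from
    \<open>regularity\<close> after normalisation.\<close>
  define hi where "hi \<delta> = (1 + \<delta>) * (K * ((1 + \<delta>) powr \<theta> - 1)) / \<delta> + E \<delta>" for \<delta>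
  define lo where "lo \<delta> = exp (- \<delta>) * (K * ((1 + \<delta>) powr \<theta> - 1)) / \<delta> - E \<delta>" for \<delta>
  have key: "\<forall>\<^sub>F n in sequentially. y < u n * T n \<and> u n * T n < y'"
    if d: "\<delta> > 0" and y: "y < lo \<delta>" "hi \<delta> < y'" for y y' \<delta>
  proof -
    define M where "M n = nat \<lfloor>real n * (1 + \<delta>)\<rfloor>" for n
    define m where "m n = (real (M n) - real n) / real n" for n
    define D where "D n = T n / real n * (U (M n) - U n)" for n
    have M1: "real (M n) \<le> real n * (1 + \<delta>)" "real n * (1 + \<delta>) < real (M n) + 1" for n
      using d by (auto simp: M_def)
    have Mn: "n \<le> M n" for n
    proof -
      have "0 \<le> real n * \<delta>" using d by simp
      then have "real n < real (M n) + 1" using M1(2)[of n] unfolding distrib_left by linarith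
      then show ?thesis by linarith
    qed
    have M_top: "filterlim M at_top sequentially"
      by (rule filterlim_at_top_mono[OF filterlim_ident]) (simp add: Mn)
    have Mlim: "(\<lambda>n. real (M n) / real n) \<longlonglongrightarrow> 1 + \<delta>"
    proof (rule tendsto_sandwich)
      show "(\<lambda>n. (real n * (1 + \<delta>) - 1) / real n) \<longlonglongrightarrow> 1 + \<delta>" by real_asymp
      show "(\<lambda>n. 1 + \<delta>) \<longlonglongrightarrow> 1 + \<delta>" by simp
      show "\<forall>\<^sub>F n in sequentially. (real n * (1 + \<delta>) - 1) / real n \<le> real (M n) / real n"
        by (intro always_eventually allI divide_right_mono) (use M1(2) in \<open>auto simp: less_eq_real_def algebra_simps\<close>)
      show "\<forall>\<^sub>F n in sequentially. real (M n) / real n \<le> 1 + \<delta>"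
        using eventually_gt_at_top[of 0]
        by eventually_elim (use M1(1) in \<open>simp add: pos_divide_le_eq mult.commute\<close>)
    qed
    have mlim: "m \<longlonglongrightarrow> \<delta>"
    proof -
      have "(\<lambda>n. real (M n) / real n - 1) \<longlonglongrightarrow> 1 + \<delta> - 1" by (intro tendsto_intros Mlim)
      then show ?thesis
      proof (rule Lim_transform_eventually[THEN tendsto_eq_rhs])
        show "\<forall>\<^sub>F n in sequentially. real (M n) / real n - 1 = m n"
          using eventually_gt_at_top[of 0] by eventually_elim (simp add: m_def diff_divide_distrib)
      qed simp
    qed
    have Dlim: "D \<longlonglongrightarrow> K * ((1 + \<delta>) powr \<theta> - 1)"
    proof -
      \<comment> \<open>The weak law at \<open>M n\<close> and at \<open>n\<close>, combined through
        the limits of \<open>M n / n\<close> and \<open>T (M n) / T n\<close>.\<close>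
      have "(\<lambda>n. (U (M n) * T (M n) / real (M n)) * (real (M n) / real n) / (T (M n) / T n) - U n * T n / real n)
         \<longlonglongrightarrow> K * (1 + \<delta>) / (1 + \<delta>) powr (1 - \<theta>) - K"
      proof (intro tendsto_diff tendsto_divide tendsto_mult Mlim weak)
        show "(\<lambda>n. U (M n) * T (M n) / real (M n)) \<longlonglongrightarrow> K" by (rule filterlim_compose[OF weak M_top])
        show "(\<lambda>n. T (M n) / T n) \<longlonglongrightarrow> (1 + \<delta>) powr (1 - \<theta>)" unfolding M_def using d by (intro T_rv) simp
        show "(1 + \<delta>) powr (1 - \<theta>) \<noteq> 0" using d by simp
      qed
      moreover have "\<forall>\<^sub>F n in sequentially. (U (M n) * T (M n) / real (M n)) * (real (M n) / real n) / (T (M n) / T n) - U n * T n / real n = D n"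
        using eventually_ge_at_top[of 1]
      proof eventually_elim
        case (elim n)
        have "T n > 0" "T (M n) > 0" "real (M n) > 0" "real n > 0" using elim Mn[of n] T_pos by auto
        then show ?case by (simp add: D_def field_simps)
      qed
      ultimately have "D \<longlonglongrightarrow> K * (1 + \<delta>) / (1 + \<delta>) powr (1 - \<theta>) - K" by (rule Lim_transform_eventually)
      moreover have "K * (1 + \<delta>) / (1 + \<delta>) powr (1 - \<theta>) = K * (1 + \<delta>) powr \<theta>"
        using d by (simp add: powr_diff)
      ultimately show ?thesis by (simp only: right_diff_distrib mult_1_right)
    qed
    have bounds: "(1 + \<delta>) * D n + m n * E \<delta> \<ge> m n * (u n * T n) \<and> m n * (u n * T n) \<ge> exp (- \<delta>) * D n - m n * E \<delta>"
      if n: "n \<ge> 1" for n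
    proof -
      have n0: "real n > 0" and T0: "T n > 0" using n T_pos by auto
      have q: "u n * T n \<le> (1 + \<delta>) * (u q * T n) + E \<delta> \<and> exp (- \<delta>) * (u q * T n) - E \<delta> \<le> u n * T n"
        if q: "q \<in> {n<..M n}" for q
      proof -
        have "real q \<le> real (M n)" using q by simp
        then have q1: "real q \<le> (1 + \<delta>) * real n" using M1(1)[of n] by (simp add: mult.commute)
        have q2: "1 \<le> real q / real n" "real q / real n \<le> 1 + \<delta>"
          using q q1 n0 by (simp_all add: pos_le_divide_eq pos_divide_le_eq)
        let ?x = "real q * u q * exp (- (real q / real n))"
        have r: "\<bar>real n * u n * exp (- 1) - ?x\<bar> \<le> C * \<delta> powr \<gamma> * (real n / T n)"
          using q q1 n d by (intro reg) auto
        have up: "?x \<le> ((1 + \<delta>) * real n) * u q * exp (- 1)"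
          using q1 q2 d u_nonneg by (intro mult_mono mult_nonneg_nonneg) auto
        have dn: "real n * u q * exp (- 1 - \<delta>) \<le> ?x"
          using q q2 u_nonneg by (intro mult_mono mult_nonneg_nonneg) auto
        \<comment> \<open>The normalisation turning \<open>n * u n * exp (- 1)\<close> into
          \<open>u n * T n\<close> and the regularity error into \<open>E \<delta>\<close>.\<close>
        define s where "s = exp 1 * T n / real n"
        have s0: "s > 0" using n0 T0 by (simp add: s_def)
        have "(real n * u n * exp (- 1)) * s \<le> (((1 + \<delta>) * real n) * u q * exp (- 1) + C * \<delta> powr \<gamma> * (real n / T n)) * s"
          using r up s0 by (intro mult_right_mono) (auto simp: abs_le_iff)
        moreover have "(real n * u q * exp (- 1 - \<delta>) - C * \<delta> powr \<gamma> * (real n / T n)) * s \<le> (real n * u n * exp (- 1)) * s"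
          using r dn s0 by (intro mult_right_mono) (auto simp: abs_le_iff)
        moreover have "(real n * u n * exp (- 1)) * s = u n * T n"
          using n0 by (simp add: s_def exp_minus)
        moreover have "(((1 + \<delta>) * real n) * u q * exp (- 1) + C * \<delta> powr \<gamma> * (real n / T n)) * s = (1 + \<delta>) * (u q * T n) + E \<delta>"
          using n0 T0 by (simp add: s_def E_def exp_minus field_simps)
        moreover have "(real n * u q * exp (- 1 - \<delta>) - C * \<delta> powr \<gamma> * (real n / T n)) * s = exp (- \<delta>) * (u q * T n) - E \<delta>"
        proof -
          have "exp (- 1 - \<delta>) = exp (- \<delta>) / exp (1::real)" by (simp add: exp_diff exp_minus field_simps)
          then show ?thesis using n0 T0 by (simp add: s_def E_def field_simps)
        qed
        ultimately show ?thesis by simp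
      qed
      have sumU: "(\<Sum>q\<in>{n<..M n}. u q) = U (M n) - U n"
      proof -
        have "U (M n) = (\<Sum>q\<in>{..n} \<union> {n<..M n}. u q)" unfolding U_def
          using Mn[of n] by (intro sum.cong) auto
        also have "\<dots> = U n + (\<Sum>q\<in>{n<..M n}. u q)" unfolding U_def by (rule sum.union_disjoint) auto
        finally show ?thesis by simp
      qed
      have card: "real (card {n<..M n}) = m n * real n" using Mn[of n] n0 by (simp add: m_def of_nat_diff)
      have DU: "T n * (U (M n) - U n) = D n * real n" using n0 by (simp add: D_def)
      have sT: "(\<Sum>q\<in>{n<..M n}. u q * T n) = D n * real n"
        unfolding sum_distrib_right[symmetric] sumU using DU by (simp add: mult.commute)
      have "(\<Sum>q\<in>{n<..M n}. u n * T n) \<le> (\<Sum>q\<in>{n<..M n}. (1 + \<delta>) * (u q * T n) + E \<delta>)"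
        by (intro sum_mono) (use q in blast)
      also have "\<dots> = (1 + \<delta>) * (D n * real n) + m n * real n * E \<delta>"
        by (simp add: sum.distrib sum_distrib_left[symmetric] sT card del: card_greaterThanAtMost)
      finally have "m n * real n * (u n * T n) \<le> (1 + \<delta>) * (D n * real n) + m n * real n * E \<delta>"
        by (simp add: card del: card_greaterThanAtMost)
      then have "real n * (m n * (u n * T n)) \<le> real n * ((1 + \<delta>) * D n + m n * E \<delta>)" by (simp add: algebra_simps)
      moreover have "(\<Sum>q\<in>{n<..M n}. exp (- \<delta>) * (u q * T n) - E \<delta>) \<le> (\<Sum>q\<in>{n<..M n}. u n * T n)"
        by (intro sum_mono) (use q in blast)
      then have "exp (- \<delta>) * (D n * real n) - m n * real n * E \<delta> \<le> m n * real n * (u n * T n)"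
        by (simp add: sum_subtractf sum_distrib_left[symmetric] sT card del: card_greaterThanAtMost)
      then have "real n * (exp (- \<delta>) * D n - m n * E \<delta>) \<le> real n * (m n * (u n * T n))" by (simp add: algebra_simps)
      ultimately show ?thesis using n0 by simp
    qed
    have "(\<lambda>n. (1 + \<delta>) * D n / m n + E \<delta>) \<longlonglongrightarrow> hi \<delta>" "(\<lambda>n. exp (- \<delta>) * D n / m n - E \<delta>) \<longlonglongrightarrow> lo \<delta>"
      unfolding hi_def lo_def using d by (intro tendsto_intros Dlim mlim; simp)+
    from order_tendstoD(2)[OF this(1) y(2)] order_tendstoD(1)[OF this(2) y(1)] order_tendstoD(1)[OF mlim d]
      eventually_ge_at_top[of 1]
    show ?thesis
    proof eventually_elim
      case (elim n)
      have "u n * T n \<le> (1 + \<delta>) * D n / m n + E \<delta>" "exp (- \<delta>) * D n / m n - E \<delta> \<le> u n * T n"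
        using bounds[OF elim(4)] elim(3) by (simp_all add: field_simps)
      then show ?case using elim(1,2) by linarith
    qed
  qed
  \<comment> \<open>The quotient \<open>((1 + \<delta>) powr \<theta> - 1) / \<delta>\<close> tends
    to \<theta>, and \<open>E \<delta>\<close> vanishes because \<open>\<gamma> > 0\<close>.\<close>
  have lim: "(hi \<longlongrightarrow> \<theta> * K) (at_right 0)" "(lo \<longlongrightarrow> \<theta> * K) (at_right 0)"
    unfolding hi_def lo_def E_def using C th0 by (real_asymp simp: mult.commute)+
  have "(\<lambda>n. u n * T n) \<longlonglongrightarrow> \<theta> * K"
  proof (rule LIMSEQ_I)
    fix e :: real assume e: "e > 0"
    have "\<forall>\<^sub>F \<delta> in at_right 0. hi \<delta> < \<theta> * K + e \<and> \<theta> * K - e < lo \<delta> \<and> \<delta> > 0"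
      using order_tendstoD(2)[OF lim(1), of "\<theta> * K + e"] order_tendstoD(1)[OF lim(2), of "\<theta> * K - e"] e
        eventually_at_right_less[of 0]
      by (auto intro: eventually_conj)
    then obtain \<delta> where "hi \<delta> < \<theta> * K + e" "\<theta> * K - e < lo \<delta>" "\<delta> > 0"
      using eventually_happens'[OF trivial_limit_at_right_real] by blast
    then have "\<forall>\<^sub>F n in sequentially. norm (u n * T n - \<theta> * K) < e"
      using key[of \<delta> "\<theta> * K - e" "\<theta> * K + e"] by (auto elim!: eventually_mono simp: abs_less_iff)
    then show "\<exists>no. \<forall>n\<ge>no. norm (u n * T n - \<theta> * K) < e" by (simp add: eventually_sequentially)
  qed
  moreover have "\<theta> * K = 1 / (Gamma (2 - \<theta>) * Gamma \<theta>)"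
  proof -
    have "Gamma (1 + \<theta>) = \<theta> * Gamma \<theta>" using Gamma_plus1[of \<theta>] th0 by (simp add: add.commute nonpos_Ints_def)
    then show ?thesis using th0 by (simp add: K_def)
  qed
  ultimately show ?thesis by simp
qed

end

section \<open>Expansive and finite-type partitions: assembling the laws\<close>

lemma (in partition) expansive_imp_rv_partition:
  assumes "expansive a \<theta>" "\<theta> \<le> 1"
  shows "rv_partition a \<theta>"
proof
  show "0 \<le> \<theta>" "\<theta> \<le> 1" using assms by (auto simp: expansive_def)
  obtain \<psi> where psi: "slowly_varying \<psi>" "\<And>n. n \<ge> 1 \<Longrightarrow> t n = \<psi> (real n) * real n powr (-\<theta>)"
    using assms(1) by (auto simp: expansive_def)
  fix m :: nat assume m: "m \<ge> 1"
  have "((\<lambda>x. \<psi> (x * real m) / \<psi> x) \<longlongrightarrow> 1) at_top"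
    using psi(1) m by (auto simp: slowly_varying_def)
  then have "(\<lambda>n. \<psi> (real n * real m) / \<psi> (real n)) \<longlonglongrightarrow> 1"
    using filterlim_real_sequentially by (rule filterlim_compose)
  then have "(\<lambda>n. \<psi> (real n * real m) / \<psi> (real n) * real m powr (-\<theta>)) \<longlonglongrightarrow> 1 * real m powr (-\<theta>)"
    by (intro tendsto_intros)
  moreover have "\<forall>\<^sub>F n in sequentially. \<psi> (real n * real m) / \<psi> (real n) * real m powr (-\<theta>) = t (m * n) / t n"
    using eventually_ge_at_top[of 1]
  proof eventually_elim
    case (elim n)
    have "1 \<le> m * n" using m elim by simp
    then show ?case using elim psi(2)[of n] psi(2)[of "m * n"] by (simp add: powr_mult mult_ac)
  qed
  ultimately show "(\<lambda>n. t (m * n) / t n) \<longlonglongrightarrow> real m powr (- \<theta>)"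
    using Lim_transform_eventually by fastforce
qed

context renewal begin

lemma sum_u_eq: "(\<Sum>k=1..n. u k) = U n - 1"
proof -
  have "U n = (\<Sum>k\<in>insert 0 {1..n}. u k)" unfolding U_def by (intro sum.cong) auto
  then show ?thesis by (simp add: u_0)
qed

text \<open>The Cesaro means of the convergent sequence \<open>u\<close> have its limit, the
  reciprocal of the limit of \<open>T\<close>.\<close>

lemma weak_renewal_finite:
  assumes "finite_type a"
  shows "(\<lambda>n. \<Sum>k=1..n. u k) \<sim>[sequentially] (\<lambda>n. real n / T n)"
proof (rule asymp_equivI')
  let ?S = "\<Sum>k. t (Suc k)"
  have S: "?S > 0" using assms by (intro suminf_pos) (auto simp: finite_type_def t_pos)
  have "filterlim (\<lambda>n. \<Sum>k=1..n. 1 :: real) at_top sequentially" by (simp add: filterlim_real_sequentially)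
  then have "(\<lambda>n. (\<Sum>k=1..n. u k) / (\<Sum>k=1..n. 1)) \<longlonglongrightarrow> 1 / ?S"
    using u_lim_finite[OF assms] by (intro weighted_cesaro) auto
  then have "(\<lambda>n. (\<Sum>k=1..n. u k) / (\<Sum>k=1..n. 1) * T n) \<longlonglongrightarrow> 1 / ?S * ?S"
    by (intro tendsto_mult T_lim_finite assms)
  then show "(\<lambda>n. (\<Sum>k=1..n. u k) / (real n / T n)) \<longlonglongrightarrow> 1" using S by simp
qed

lemma strong_renewal_finite:
  assumes "finite_type a"
  shows "u \<sim>[sequentially] (\<lambda>n. 1 / T n)"
proof (rule asymp_equivI')
  let ?S = "\<Sum>k. t (Suc k)"
  have S: "?S > 0" using assms by (intro suminf_pos) (auto simp: finite_type_def t_pos)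
  have "(\<lambda>n. u n * T n) \<longlonglongrightarrow> 1 / ?S * ?S"
    by (intro tendsto_mult T_lim_finite u_lim_finite assms)
  then show "(\<lambda>n. u n / (1 / T n)) \<longlonglongrightarrow> 1" using S by simp
qed

end

context rv_renewal begin

lemma weak_renewal_asymp:
  "(\<lambda>n. \<Sum>k=1..n. u k) \<sim>[sequentially] (\<lambda>n. 1 / (Gamma (2 - \<theta>) * Gamma (1 + \<theta>)) * real n / T n)"
proof (rule asymp_equivI')
  define G where "G = Gamma (2 - \<theta>) * Gamma (1 + \<theta>)"
  have G: "G > 0" using Gamma_pos by (simp add: G_def)
  \<comment> \<open>\<open>U\<close> counts \<open>u 0 = 1\<close> while the stated sum starts at 1;
    as \<open>U\<close> diverges, the correcting factor \<open>1 - 1 / U n\<close> tends to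
    1.\<close>
  have "(\<lambda>n. 1 / U n) \<longlonglongrightarrow> 0"
    by (intro tendsto_divide_0[OF tendsto_const] filterlim_at_top_imp_at_infinity U_lim_at_top)
  then have "(\<lambda>n. (U n * T n / real n) * G * (1 - 1 / U n)) \<longlonglongrightarrow> 1 / G * G * (1 - 0)"
    using weak_renewal[folded G_def] by (intro tendsto_mult tendsto_diff tendsto_const)
  moreover have "(U n * T n / real n) * G * (1 - 1 / U n) = (\<Sum>k=1..n. u k) / (1 / G * real n / T n)" for n
  proof -
    have "(U n * T n / real n) * G * (1 - 1 / U n) = U n * (1 - 1 / U n) * (T n * G / real n)" by simp
    also have "U n * (1 - 1 / U n) = U n - 1" using U_pos[of n] by (simp add: right_diff_distrib)
    finally show ?thesis unfolding sum_u_eq by simp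
  qed
  ultimately have "(\<lambda>n. (\<Sum>k=1..n. u k) / (1 / G * real n / T n)) \<longlonglongrightarrow> 1 / G * G * (1 - 0)"
    by (simp only:)
  moreover have "1 / G * G * (1 - 0) = 1" using G by simp
  ultimately show "(\<lambda>n. (\<Sum>k=1..n. u k) / (1 / (Gamma (2 - \<theta>) * Gamma (1 + \<theta>)) * real n / T n)) \<longlonglongrightarrow> 1"
    unfolding G_def by (simp only:)
qed

lemma strong_renewal_asymp:
  assumes "1/2 < \<theta>"
  shows "u \<sim>[sequentially] (\<lambda>n. 1 / (Gamma (2 - \<theta>) * Gamma \<theta>) / T n)"
proof (rule asymp_equivI')
  define G where "G = Gamma (2 - \<theta>) * Gamma \<theta>"
  have G: "G > 0" using Gamma_pos assms by (simp add: G_def)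
  have "(\<lambda>n. u n * T n * G) \<longlonglongrightarrow> 1 / G * G"
    using strong_renewal[OF assms] unfolding G_def by (intro tendsto_intros)
  then show "(\<lambda>n. u n / (1 / (Gamma (2 - \<theta>) * Gamma \<theta>) / T n)) \<longlonglongrightarrow> 1"
    unfolding G_def[symmetric] using G by (simp add: mult_ac)
qed

end

theorem theorem1p1:
  fixes a :: "nat \<Rightarrow> real"
  assumes "is_partition_seq a"
  shows "(\<not> summable (\<lambda>n. measure lborel (sum_level a n))) \<and>
    (\<not> finite_type a \<longrightarrow> (\<lambda>n. measure lborel (sum_level a n)) \<longlonglongrightarrow> 0) \<and>
    (finite_type a \<longrightarrow>
       (\<lambda>n. measure lborel (sum_level a n)) \<longlonglongrightarrow> 1 / (\<Sum>k. tail a (Suc k))) \<and>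
    (\<forall>\<theta>. expansive a \<theta> \<and> 0 \<le> \<theta> \<and> \<theta> \<le> 1 \<longrightarrow>
       (\<lambda>n. \<Sum>k=1..n. measure lborel (sum_level a k)) \<sim>[sequentially]
       (\<lambda>n. 1 / (Gamma (2 - \<theta>) * Gamma (1 + \<theta>)) * real n / (\<Sum>k=1..n. tail a k))) \<and>
    (finite_type a \<longrightarrow>
       (\<lambda>n. \<Sum>k=1..n. measure lborel (sum_level a k)) \<sim>[sequentially]
       (\<lambda>n. real n / (\<Sum>k=1..n. tail a k))) \<and>
    (\<forall>\<theta>. expansive a \<theta> \<and> 1/2 < \<theta> \<and> \<theta> \<le> 1 \<longrightarrow>
       (\<lambda>n. measure lborel (sum_level a n)) \<sim>[sequentially]
       (\<lambda>n. 1 / (Gamma (2 - \<theta>) * Gamma \<theta>) / (\<Sum>k=1..n. tail a k))) \<and>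
    (finite_type a \<longrightarrow>
       (\<lambda>n. measure lborel (sum_level a n)) \<sim>[sequentially]
       (\<lambda>n. 1 / (\<Sum>k=1..n. tail a k)))"
proof -
  interpret partition a using assms by unfold_locales (auto simp: is_partition_seq_def)
  define u where "u n = measure lborel (level n)" for n
  interpret renewal a u unfolding u_def[abs_def] by (rule renewal_level)
  let ?s = "\<lambda>n. measure lborel (sum_level a n)"
  \<comment> \<open>\<open>level\<close> and \<open>sum_level\<close> differ only at index 0, which
    affects neither limits and summability nor sums starting at 1.\<close>
  have su: "?s n = u n" if "n \<ge> 1" for n using that by (simp add: u_def level_def)
  have ev: "\<forall>\<^sub>F n in sequentially. u n = ?s n" using eventually_ge_at_top[of 1] by eventually_elim (simp add: su)
  have sums: "(\<Sum>k=1..n. ?s k) = (\<Sum>k=1..n. u k)" for n by (intro sum.cong) (auto simp: su)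
  note Tn = T_def[symmetric]
  have rv: "rv_renewal a u \<theta>" if "expansive a \<theta>" "\<theta> \<le> 1" for \<theta>
    unfolding rv_renewal_def using expansive_imp_rv_partition[OF that] renewal_axioms by blast
  have equiv: "?s \<sim>[sequentially] g" if "u \<sim>[sequentially] g" for g
    using asymp_equiv_cong[OF ev, of g g] that by simp
  show ?thesis
    unfolding Tn sums
  proof (intro conjI allI impI)
    show "\<not> summable ?s" using not_summable_u summable_cong[OF ev] by simp
    show "?s \<longlonglongrightarrow> 0" if "\<not> finite_type a"
      by (rule Lim_transform_eventually[OF u_lim_infinite[OF that] ev])
    show "?s \<longlonglongrightarrow> 1 / (\<Sum>k. t (Suc k))" if "finite_type a"
      by (rule Lim_transform_eventually[OF u_lim_finite[OF that] ev])
    show "(\<lambda>n. \<Sum>k=1..n. u k) \<sim>[sequentially] (\<lambda>n. 1 / (Gamma (2 - \<theta>) * Gamma (1 + \<theta>)) * real n / T n)"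
      if "expansive a \<theta> \<and> 0 \<le> \<theta> \<and> \<theta> \<le> 1" for \<theta>
      using rv_renewal.weak_renewal_asymp[OF rv] that by blast
    show "(\<lambda>n. \<Sum>k=1..n. u k) \<sim>[sequentially] (\<lambda>n. real n / T n)" if "finite_type a"
      by (rule weak_renewal_finite[OF that])
    show "?s \<sim>[sequentially] (\<lambda>n. 1 / (Gamma (2 - \<theta>) * Gamma \<theta>) / T n)"
      if "expansive a \<theta> \<and> 1/2 < \<theta> \<and> \<theta> \<le> 1" for \<theta>
      using rv_renewal.strong_renewal_asymp[OF rv] that by (intro equiv) blast
    show "?s \<sim>[sequentially] (\<lambda>n. 1 / T n)" if "finite_type a"
      by (intro equiv strong_renewal_finite that)
  qed
qed

end
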